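(* Let $n\ge 3$ and $1\le p<n$. There are two positive constants $c_0,c_1$ such that for any $\varepsilon\in(0,1/4)$ there exist a vector-function $b_\varepsilon\in C^\infty(\overline{B_{1/2}})$, $b_\varepsilon:\overline{B_{1/2}}\to\mathbb{R}^n$, with $$\operatorname{div} b_\varepsilon=0,\qquad \|b_\varepsilon\|_{L_p(B_{1/2})}\le c_0,$$ and a scalar function $u_\varepsilon\in C^\infty(\overline{B_{1/2}})$ with $$\|u_\varepsilon\|_{L_\infty(B_{1/2})}\le 1,\qquad \|u_\varepsilon\|_{W_2^1(B_{1/2})}\le c_0,$$ which satisfy the equations $$-\Delta u_\varepsilon+b_\varepsilon\cdot\nabla u_\varepsilon=0\quad\text{and}\quad -\Delta u_\varepsilon+\operatorname{div}(b_\varepsilon u_\varepsilon)=0\quad\text{in }B_{1/2},$$ and moreover $$u_\varepsilon(0)=0,\qquad u_\varepsilon(0,\dots,0,2\varepsilon)\ge c_1.$$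
   Context: $B_R$ is the ball in $\mathbb{R}^n$ of radius $R$ centered at the origin. $W_2^1$ is the Sobolev space of functions with weak first derivatives in $L_2$. The constants $c_0,c_1$ may depend on $n$ and $p$ but not on $\varepsilon$. *)

theory Defs
  imports "HOL-Analysis.Analysis" "HOL-Probability.Essential_Supremum"
begin

definition partial_deriv ::
    "'n \<Rightarrow> (real^'n::finite \<Rightarrow> 'b::real_normed_vector) \<Rightarrow> real^'n \<Rightarrow> 'b" where
  "partial_deriv i f x = vector_derivative (\<lambda>t. f (x + t *\<^sub>R axis i 1)) (at 0)"

fun iter_partial ::
    "'n list \<Rightarrow> (real^'n::finite \<Rightarrow> 'b::real_normed_vector) \<Rightarrow> real^'n \<Rightarrow> 'b" where
  "iter_partial [] f = f"
| "iter_partial (i # is) f = partial_deriv i (iter_partial is f)"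

definition gradient :: "(real^'n::finite \<Rightarrow> real) \<Rightarrow> real^'n \<Rightarrow> real^'n" where
  "gradient u x = (\<chi> i. partial_deriv i u x)"

definition divergence :: "(real^'n::finite \<Rightarrow> real^'n) \<Rightarrow> real^'n \<Rightarrow> real" where
  "divergence b x = (\<Sum>i\<in>UNIV. partial_deriv i (\<lambda>y. b y $ i) x)"

definition laplacian :: "(real^'n::finite \<Rightarrow> real) \<Rightarrow> real^'n \<Rightarrow> real" where
  "laplacian u x = (\<Sum>i\<in>UNIV. partial_deriv i (partial_deriv i u) x)"

text \<open>Smoothness on an open set: all partial derivatives of all orders exist and are
  continuous. The differentiability clause is what makes the values of
  \<^const>\<open>partial_deriv\<close> at the next order meaningful.\<close>

definition smooth_in ::
    "(real^'n::finite) set \<Rightarrow> (real^'n \<Rightarrow> 'b::real_normed_vector) \<Rightarrow> bool" where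
  "smooth_in S f \<longleftrightarrow>
     (\<forall>is. continuous_on S (iter_partial is f) \<and>
           (\<forall>x\<in>S. \<forall>i. (\<lambda>t. iter_partial is f (x + t *\<^sub>R axis i 1)) differentiable (at 0)))"

text \<open>The class of functions that are smooth up to the boundary of the open set \<open>S\<close>: smooth in
  \<open>S\<close>, continuous on the closure, and every partial derivative extends continuously from \<open>S\<close> to
  the closure. Values of \<open>f\<close> outside the closure play no role.\<close>

definition smooth_closure ::
    "(real^'n::finite) set \<Rightarrow> (real^'n \<Rightarrow> 'b::real_normed_vector) \<Rightarrow> bool" where
  "smooth_closure S f \<longleftrightarrow>
     smooth_in S f \<and> continuous_on (closure S) f \<and>
     (\<forall>is. \<exists>g. continuous_on (closure S) g \<and> (\<forall>x\<in>S. g x = iter_partial is f x))"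

text \<open>Since the Bochner integral of a non-integrable function is \<open>0\<close>, a bound on \<open>Lp_norm\<close> is
  only meaningful together with membership in \<open>Lp_space\<close>.\<close>

definition Lp_space :: "real \<Rightarrow> 'a measure \<Rightarrow> ('a \<Rightarrow> 'b::euclidean_space) set" where
  "Lp_space p M = {f \<in> borel_measurable M. integrable M (\<lambda>x. norm (f x) powr p)}"

definition Lp_norm :: "real \<Rightarrow> 'a measure \<Rightarrow> ('a \<Rightarrow> 'b::euclidean_space) \<Rightarrow> real" where
  "Lp_norm p M f = (LINT x|M. norm (f x) powr p) powr (1 / p)"

definition Linf_norm :: "'a measure \<Rightarrow> ('a \<Rightarrow> 'b::euclidean_space) \<Rightarrow> ereal" where
  "Linf_norm M f = esssup M (\<lambda>x. ereal (norm (f x)))"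

definition test_function :: "(real^'n::finite) set \<Rightarrow> (real^'n \<Rightarrow> real) \<Rightarrow> bool" where
  "test_function S \<phi> \<longleftrightarrow>
     smooth_in UNIV \<phi> \<and> compact (closure {x. \<phi> x \<noteq> 0}) \<and> closure {x. \<phi> x \<noteq> 0} \<subseteq> S"

definition locally_integrable_on ::
    "(real^'n::finite \<Rightarrow> real) \<Rightarrow> (real^'n) set \<Rightarrow> bool" where
  "locally_integrable_on u S \<longleftrightarrow>
     (\<forall>K. compact K \<and> K \<subseteq> S \<longrightarrow> u absolutely_integrable_on K)"

definition has_weak_partial ::
    "(real^'n::finite) set \<Rightarrow> 'n \<Rightarrow> (real^'n \<Rightarrow> real) \<Rightarrow> (real^'n \<Rightarrow> real) \<Rightarrow> bool" where
  "has_weak_partial S i u g \<longleftrightarrow>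
     locally_integrable_on u S \<and> locally_integrable_on g S \<and>
     (\<forall>\<phi>. test_function S \<phi> \<longrightarrow>
        (LINT x|lebesgue_on S. u x * partial_deriv i \<phi> x) = - (LINT x|lebesgue_on S. g x * \<phi> x))"

definition W12_space :: "(real^'n::finite) set \<Rightarrow> (real^'n \<Rightarrow> real) set" where
  "W12_space S =
     {u \<in> Lp_space 2 (lebesgue_on S).
        \<forall>i. \<exists>g \<in> Lp_space 2 (lebesgue_on S). has_weak_partial S i u g}"

text \<open>Weak derivatives are unique up to null sets, so the chosen representative does not affect the
  norm below.\<close>

definition weak_partial ::
    "(real^'n::finite) set \<Rightarrow> 'n \<Rightarrow> (real^'n \<Rightarrow> real) \<Rightarrow> real^'n \<Rightarrow> real" where
  "weak_partial S i u = (SOME g. has_weak_partial S i u g)"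

definition W12_norm :: "(real^'n::finite) set \<Rightarrow> (real^'n \<Rightarrow> real) \<Rightarrow> real" where
  "W12_norm S u =
     sqrt ((Lp_norm 2 (lebesgue_on S) u)\<^sup>2 +
           (\<Sum>i\<in>UNIV. (Lp_norm 2 (lebesgue_on S) (weak_partial S i u))\<^sup>2))"

end

theory Submission
  imports Defs
begin

text \<open>Write \<open>z\<close> for the last coordinate and \<open>\<rho>\<close> for the distance to the \<open>z\<close>-axis. The solution
  \<open>u = h(\<rho>, z)\<close> is prescribed through its level sets \<open>z = h * sqrt (\<rho>\<^sup>2 + \<zeta>(h\<^sup>2))\<close>: for a profile \<open>\<zeta>\<close>
  that is tiny when \<open>\<bar>h\<bar> < 1/2\<close> and of order one when \<open>\<bar>h\<bar>\<close> is near \<open>1\<close>, all levels in \<open>(-1/2, 1/2)\<close>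
  fan out of a neighbourhood of the origin of size about \<open>\<epsilon>\<close>, while the higher levels cross the axis at
  macroscopic height. For axially symmetric \<open>b\<close>, the conditions \<open>div b = 0\<close> and
  \<open>b \<bullet> \<nabla>u = \<Delta>u\<close> form a first-order equation for the stream function, which is solved by
  integrating from the axis along each level set; in the coordinates \<open>(\<rho>\<^sup>2, h)\<close> this is an integral
  over a fixed interval of an explicit integrand. Taking \<open>\<zeta>\<close> to be (nearly) the \<open>M\<close>-th power of the
  positive part of \<open>h\<^sup>2 - 1/4\<close>, each \<open>h\<close>-derivative costs only a factor \<open>\<zeta> powr (-1/M)\<close>, so that
  \<open>\<bar>b\<bar>\<close> is at most a constant times \<open>\<bar>x\<bar> powr (-1 - 8/M)\<close> uniformly in \<open>\<epsilon>\<close>, and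
  this is bounded in \<open>L\<^sub>p\<close> as soon as \<open>p * (1 + 8/M) < n\<close>.\<close>

section \<open>Smooth functions\<close>

text \<open>The constant profile \<open>\<zeta> = \<epsilon>\<^sup>2\<close> would give
  \<open>u = z / sqrt (\<rho>\<^sup>2 + \<epsilon>\<^sup>2)\<close>, which behaves well near the
  origin but grows to about 1/(2\<epsilon>) along the axis. It is the bound 1 on \<open>u\<close>
  that forces the profile to climb to order one before \<open>h\<close> reaches 1. The price is paid
  by the derivatives of \<zeta>, up to the third order; the worst term loses four factors, each a
  power -1/M of \<open>\<rho>\<^sup>2 + \<zeta>(h\<^sup>2)\<close>, and that is the 8/M in the
  exponent of the length of x.

  All formulas are written in \<open>\<rho>\<^sup>2\<close> and \<open>h\<^sup>2\<close>, which
  keeps them smooth across the axis and across \<open>h = 0\<close>. As \<open>u\<close> is only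
  given implicitly, its smoothness is bootstrapped: its partial derivatives are again expressions in
  \<open>u\<close> and the coordinates. Integrals are estimated without polar coordinates, because
  \<open>\<rho>\<^sup>2 + \<zeta>(h\<^sup>2)\<close> dominates the square of every single coordinate
  and so yields a product of one-dimensional weights. The Sobolev norm picks weak derivatives by
  choice, which brings in their uniqueness up to null sets.\<close>

lemma smooth_in_coinduct:
  fixes f :: "real^'n::finite \<Rightarrow> 'b::real_normed_vector"
  assumes "f \<in> F"
    and cont: "\<And>f. f \<in> F \<Longrightarrow> continuous_on UNIV f"
    and deriv: "\<And>f i. f \<in> F \<Longrightarrow>
      \<exists>g\<in>F. \<forall>x. ((\<lambda>t. f (x + t *\<^sub>R axis i 1)) has_vector_derivative g x) (at 0)"
  shows "smooth_in S f"
proof -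
  have step: "partial_deriv i g \<in> F \<and>
      (\<forall>x. (\<lambda>t. g (x + t *\<^sub>R axis i 1)) differentiable (at 0))" if g: "g \<in> F" for g i
  proof -
    obtain g' where g': "g' \<in> F"
      "\<And>x. ((\<lambda>t. g (x + t *\<^sub>R axis i 1)) has_vector_derivative g' x) (at 0)"
      using deriv[OF g, of i] by blast
    have "partial_deriv i g = g'"
      using g'(2) by (auto simp: partial_deriv_def fun_eq_iff vector_derivative_at)
    with g' show ?thesis
      using differentiableI_vector[OF g'(2)] by auto
  qed
  have mem: "iter_partial is f \<in> F" for "is"
    by (induction "is") (auto simp: \<open>f \<in> F\<close> step)
  show ?thesis
    unfolding smooth_in_def
    using step[OF mem] continuous_on_subset[OF cont[OF mem] subset_UNIV] by blast
qed

lemma smooth_in_UNIV_imp_smooth_closure: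
  assumes "smooth_in UNIV f"
  shows "smooth_closure S f"
proof -
  have c: "continuous_on T (iter_partial is f)" for T "is"
    using assms continuous_on_subset unfolding smooth_in_def by blast
  have "continuous_on (closure S) f"
    using c[of _ "[]"] by simp
  with c show ?thesis
    using assms unfolding smooth_closure_def smooth_in_def by blast
qed

text \<open>The parameter \<open>t\<close> is there because the drift involves integrals over \<open>t\<close> in \<open>{0..1}\<close>, which are
  differentiated under the integral sign. In the rule \<open>comp\<close> the sequence \<open>\<phi>\<close> lists the successive
  derivatives of \<open>\<phi> 0\<close> on \<open>S\<close>.\<close>

inductive_set kernels :: "(real^'n::finite \<Rightarrow> real) \<Rightarrow> (real \<Rightarrow> real^'n \<Rightarrow> real) set"
  for h :: "real^'n \<Rightarrow> real" where
  base: "(\<lambda>t. h) \<in> kernels h"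
| const: "(\<lambda>t x. c) \<in> kernels h"
| param: "(\<lambda>t x. t) \<in> kernels h"
| coord: "(\<lambda>t x. x $ i) \<in> kernels h"
| add: "k \<in> kernels h \<Longrightarrow> l \<in> kernels h \<Longrightarrow> (\<lambda>t x. k t x + l t x) \<in> kernels h"
| mult: "k \<in> kernels h \<Longrightarrow> l \<in> kernels h \<Longrightarrow> (\<lambda>t x. k t x * l t x) \<in> kernels h"
| comp: "k \<in> kernels h \<Longrightarrow> (\<And>j v. v \<in> S \<Longrightarrow> (\<phi> j has_real_derivative \<phi> (Suc j) v) (at v)) \<Longrightarrow>
    (\<And>t x. k t x \<in> S) \<Longrightarrow> (\<lambda>t x. \<phi> (j::nat) (k t x)) \<in> kernels h"

lemma kernels_minus: "k \<in> kernels h \<Longrightarrow> (\<lambda>t x. - k t x) \<in> kernels h"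
  using kernels.mult[OF kernels.const[of "-1"]] by simp

lemma kernels_diff:
  "k \<in> kernels h \<Longrightarrow> l \<in> kernels h \<Longrightarrow> (\<lambda>t x. k t x - l t x) \<in> kernels h"
  using kernels.add[OF _ kernels_minus] by simp

lemma kernels_power:
  assumes "k \<in> kernels h"
  shows "(\<lambda>t x. k t x ^ m) \<in> kernels h"
proof (induction m)
  case (Suc m)
  then show ?case
    using kernels.mult[OF assms Suc] by simp
qed (simp add: kernels.const)

lemma kernels_sum:
  "(\<And>a. a \<in> A \<Longrightarrow> k a \<in> kernels h) \<Longrightarrow> (\<lambda>t x. \<Sum>a\<in>A. k a t x) \<in> kernels h"
proof (induction A rule: infinite_finite_induct)
  case (insert a A)
  then show ?case
    using kernels.add[of "k a" h "\<lambda>t x. \<Sum>a\<in>A. k a t x"] by simp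
qed (simp_all add: kernels.const)

lemma kernels_prod:
  "(\<And>a. a \<in> A \<Longrightarrow> k a \<in> kernels h) \<Longrightarrow> (\<lambda>t x. \<Prod>a\<in>A. k a t x) \<in> kernels h"
proof (induction A rule: infinite_finite_induct)
  case (insert a A)
  then show ?case
    using kernels.mult[of "k a" h "\<lambda>t x. \<Prod>a\<in>A. k a t x"] by simp
qed (simp_all add: kernels.const)

lemma kernels_powr:
  assumes "k \<in> kernels h" and "\<And>t x. k t x > 0"
  shows "(\<lambda>t x. k t x powr a) \<in> kernels h"
proof -
  define \<phi> where "\<phi> = (\<lambda>j v. (\<Prod>i<j. a - real i) * v powr (a - real j))"
  have "(\<phi> j has_real_derivative \<phi> (Suc j) v) (at v)" if "v > 0" for j v
    unfolding \<phi>_def using that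
    by (auto intro!: derivative_eq_intros simp: algebra_simps)
  then have "(\<lambda>t x. \<phi> 0 (k t x)) \<in> kernels h"
    by (rule kernels.comp[OF assms(1), where S = "{0<..}" and \<phi> = \<phi> and j = 0])
      (use assms(2) in auto)
  then show ?thesis by (simp add: \<phi>_def)
qed

lemma kernels_inverse:
  assumes "k \<in> kernels h" and "\<And>t x. k t x > 0"
  shows "(\<lambda>t x. inverse (k t x)) \<in> kernels h"
proof -
  have "(\<lambda>t x. k t x powr (- 1)) \<in> kernels h"
    by (intro kernels_powr assms)
  moreover have "k t x powr (- 1) = inverse (k t x)" for t x
    using assms(2)[of t x] by (simp add: powr_minus)
  ultimately show ?thesis by simp
qed

lemma kernels_divide:
  assumes "l \<in> kernels h" "k \<in> kernels h" and "\<And>t x. k t x > 0"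
  shows "(\<lambda>t x. l t x / k t x) \<in> kernels h"
  unfolding divide_inverse by (intro kernels.mult kernels_inverse assms)

lemma kernels_sqrt:
  assumes "k \<in> kernels h" and "\<And>t x. k t x > 0"
  shows "(\<lambda>t x. sqrt (k t x)) \<in> kernels h"
  using kernels_powr[OF assms, of "1/2"] assms(2) by (simp add: powr_half_sqrt less_imp_le)

lemmas kernels_intros = kernels.base kernels.const kernels.param kernels.coord kernels.add
  kernels.mult kernels_minus kernels_diff kernels_power kernels_sum kernels_prod kernels_powr
  kernels_inverse kernels_divide kernels_sqrt

text \<open>Only first partial derivatives of \<open>h\<close> are mentioned, but they must again
  lie in \<open>kernels h\<close>. This is the self-reference of implicit differentiation: one
  formula for the gradient in terms of \<open>h\<close> and the coordinates yields derivatives of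
  every order.\<close>

definition generator_closed :: "(real^'n::finite \<Rightarrow> real) \<Rightarrow> bool" where
  "generator_closed h \<longleftrightarrow> continuous_on UNIV h \<and>
     (\<forall>i. \<exists>k\<in>kernels h. \<forall>t x. ((\<lambda>s. h (x + s *\<^sub>R axis i 1)) has_real_derivative k t x) (at 0))"

lemma kernels_continuous:
  assumes "generator_closed h" and "k \<in> kernels h"
  shows "continuous_on UNIV (\<lambda>(t, x). k t x)"
  using assms(2)
proof induction
  case base
  have "continuous_on UNIV h"
    using assms(1) by (simp add: generator_closed_def)
  then show ?case
    by (auto simp: case_prod_unfold intro!: continuous_on_compose2[of UNIV h] continuous_intros)
next
  case (comp k S \<phi> j)
  have "continuous_on S (\<phi> j)"
    using comp(2) by (intro continuous_at_imp_continuous_on ballI) (blast intro: DERIV_isCont)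
  then show ?case
    using comp by (auto simp: case_prod_unfold intro: continuous_on_compose2)
qed (auto simp: case_prod_unfold intro!: continuous_intros)

lemma kernels_continuous':
  assumes "generator_closed h" and "k \<in> kernels h"
  shows "continuous_on S (k t)" and "continuous_on T (\<lambda>t. k t x)"
proof -
  note c = kernels_continuous[OF assms]
  show "continuous_on S (k t)"
    using continuous_on_compose2[OF c, of S "\<lambda>x. (t, x)"] by (simp add: continuous_intros)
  show "continuous_on T (\<lambda>t. k t x)"
    using continuous_on_compose2[OF c, of T "\<lambda>t. (t, x)"] by (simp add: continuous_intros)
qed

text \<open>Structural induction with the sum, product and chain rules. The chain rule moves one
  step along the sequence \<phi>, which is why the rule \<open>comp\<close> admits every index j and
  not just 0.\<close>

lemma kernels_derivative:
  assumes h: "generator_closed h" and "k \<in> kernels h"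
  obtains k' where "k' \<in> kernels h"
    "\<And>t x. ((\<lambda>s. k t (x + s *\<^sub>R axis i 1)) has_real_derivative k' t x) (at 0)"
proof -
  have "\<exists>k'\<in>kernels h. \<forall>t x. ((\<lambda>s. k t (x + s *\<^sub>R axis i 1)) has_real_derivative k' t x) (at 0)"
    using assms(2)
  proof induction
    case base
    then show ?case using h by (auto simp: generator_closed_def)
  next
    case (const c)
    show ?case by (rule bexI[of _ "\<lambda>t x. 0"]) (auto intro: kernels.const)
  next
    case param
    show ?case by (rule bexI[of _ "\<lambda>t x. 0"]) (auto intro: kernels.const)
  next
    case (coord j)
    show ?case
      by (rule bexI[of _ "\<lambda>t x. axis i 1 $ j"])
        (auto intro: kernels.const intro!: derivative_eq_intros)
  next
    case (add k l)
    then obtain k' l' where *: "k' \<in> kernels h" "l' \<in> kernels h"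
      "\<And>t x. ((\<lambda>s. k t (x + s *\<^sub>R axis i 1)) has_real_derivative k' t x) (at 0)"
      "\<And>t x. ((\<lambda>s. l t (x + s *\<^sub>R axis i 1)) has_real_derivative l' t x) (at 0)"
      by metis
    show ?case
      by (rule bexI[of _ "\<lambda>t x. k' t x + l' t x"])
        (auto intro!: kernels.add DERIV_add *)
  next
    case (mult k l)
    then obtain k' l' where *: "k' \<in> kernels h" "l' \<in> kernels h"
      "\<And>t x. ((\<lambda>s. k t (x + s *\<^sub>R axis i 1)) has_real_derivative k' t x) (at 0)"
      "\<And>t x. ((\<lambda>s. l t (x + s *\<^sub>R axis i 1)) has_real_derivative l' t x) (at 0)"
      by metis
    show ?case
    proof (rule bexI[of _ "\<lambda>t x. k' t x * l t x + l' t x * k t x"], intro allI)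
      show "((\<lambda>s. k t (x + s *\<^sub>R axis i 1) * l t (x + s *\<^sub>R axis i 1))
          has_real_derivative k' t x * l t x + l' t x * k t x) (at 0)" for t x
        using DERIV_mult[OF *(3)[of t x] *(4)[of t x]] by simp
    qed (intro kernels.add kernels.mult * mult(1,2))
  next
    case (comp k S \<phi> j)
    then obtain k' where *: "k' \<in> kernels h"
      "\<And>t x. ((\<lambda>s. k t (x + s *\<^sub>R axis i 1)) has_real_derivative k' t x) (at 0)"
      by metis
    show ?case
    proof (rule bexI[of _ "\<lambda>t x. \<phi> (Suc j) (k t x) * k' t x"], intro allI)
      show "((\<lambda>s. \<phi> j (k t (x + s *\<^sub>R axis i 1)))
          has_real_derivative \<phi> (Suc j) (k t x) * k' t x) (at 0)" for t x
        using DERIV_chain2[where f = "\<phi> j" and g = "\<lambda>s. k t (x + s *\<^sub>R axis i 1)", OF _ *(2)[of t x]]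
          comp(2)[OF comp(3)[of t x]] by simp
      show "(\<lambda>t x. \<phi> (Suc j) (k t x) * k' t x) \<in> kernels h"
        by (rule kernels.mult[OF kernels.comp[where k = k and S = S and \<phi> = \<phi>, OF comp(1-3)] *(1)])
    qed
  qed
  then show ?thesis using that by blast
qed

lemma kernel_integral_derivative:
  assumes h: "generator_closed h" and k: "k \<in> kernels h" and k': "k' \<in> kernels h"
    and d: "\<And>t x. ((\<lambda>s. k t (x + s *\<^sub>R axis i 1)) has_real_derivative k' t x) (at 0)"
  shows "((\<lambda>s. integral {0..1} (\<lambda>t. k t (x + s *\<^sub>R axis i 1))) has_real_derivative
    integral {0..1} (\<lambda>t. k' t x)) (at 0)"
proof -
  have d': "((\<lambda>s. k t (x + s *\<^sub>R axis i 1)) has_real_derivative k' t (x + s *\<^sub>R axis i 1)) (at s)"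
    for t s
    using d[of t "x + s *\<^sub>R axis i 1"] DERIV_shift[of "\<lambda>s. k t (x + s *\<^sub>R axis i 1)" _ 0 s]
    by (simp add: algebra_simps)
  have "continuous_on UNIV (\<lambda>p. k' (snd p) (x + fst p *\<^sub>R axis i 1))"
    using continuous_on_compose2[OF kernels_continuous[OF h k'],
        of UNIV "\<lambda>p. (snd p, x + fst p *\<^sub>R axis i 1)"]
    by (simp add: continuous_intros)
  then have c: "continuous_on (UNIV \<times> cbox 0 1) (\<lambda>(s, t). k' t (x + s *\<^sub>R axis i 1))"
    unfolding case_prod_unfold using continuous_on_subset by blast
  have i: "(\<lambda>t. k t (x + s *\<^sub>R axis i 1)) integrable_on cbox 0 1" for s
    by (simp add: integrable_continuous_interval kernels_continuous'(2)[OF h k])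
  have "((\<lambda>s. integral (cbox 0 1) (\<lambda>t. k t (x + s *\<^sub>R axis i 1))) has_field_derivative
    integral (cbox 0 1) (\<lambda>t. k' t (x + 0 *\<^sub>R axis i 1))) (at 0 within UNIV)"
    by (rule leibniz_rule_field_derivative[OF d' i c]) auto
  then show ?thesis by simp
qed

lemma kernel_integral_continuous:
  assumes h: "generator_closed h" and k: "k \<in> kernels h"
  shows "continuous_on UNIV (\<lambda>x. integral {0..1} (\<lambda>t. k t x))"
proof -
  have "continuous_on (UNIV \<times> cbox 0 1) (\<lambda>(x, t). k t x)"
    using continuous_on_compose2[OF kernels_continuous[OF h k], of "UNIV \<times> cbox 0 1" "\<lambda>p. (snd p, fst p)"]
    by (simp add: continuous_intros case_prod_unfold)
  from integral_continuous_on_param[OF this] show ?thesis by simp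
qed

lemma smooth_in_kernel_integral:
  assumes h: "generator_closed h" and k: "k \<in> kernels h"
  shows "smooth_in S (\<lambda>x. integral {0..1} (\<lambda>t. k t x))"
proof (rule smooth_in_coinduct[where F = "(\<lambda>k x. integral {0..1} (\<lambda>t. k t x)) ` kernels h"])
  fix f i assume "f \<in> (\<lambda>k x. integral {0..1} (\<lambda>t. k t x)) ` kernels h"
  then obtain k where k: "k \<in> kernels h" "f = (\<lambda>x. integral {0..1} (\<lambda>t. k t x))" by blast
  obtain k' where k': "k' \<in> kernels h"
    "\<And>t x. ((\<lambda>s. k t (x + s *\<^sub>R axis i 1)) has_real_derivative k' t x) (at 0)"
    using kernels_derivative[OF h k(1)] by blast
  show "\<exists>g\<in>(\<lambda>k x. integral {0..1} (\<lambda>t. k t x)) ` kernels h.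
      \<forall>x. ((\<lambda>t. f (x + t *\<^sub>R axis i 1)) has_vector_derivative g x) (at 0)"
    using kernel_integral_derivative[OF h k(1) k'] k' k
    by (auto simp: has_real_derivative_iff_has_vector_derivative)
qed (use k kernel_integral_continuous[OF h] in auto)

text \<open>The interval of integration has length one, so a kernel that is constant in t equals its
  own integral.\<close>

lemma smooth_in_kernel:
  assumes h: "generator_closed h" and k: "k \<in> kernels h" and "\<And>t x. k t x = f x"
  shows "smooth_in S f"
  using smooth_in_kernel_integral[OF h k] assms(3) by simp

lemma smooth_in_vec:
  fixes f :: "real^'n::finite \<Rightarrow> real^'m::finite"
  assumes "\<And>j. smooth_in UNIV (\<lambda>x. f x $ j)"
  shows "smooth_in S f"
proof (rule smooth_in_coinduct[where F = "{f. \<forall>j. smooth_in UNIV (\<lambda>x. f x $ j)}"])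
  fix f :: "real^'n \<Rightarrow> real^'m" and i
  assume "f \<in> {f. \<forall>j. smooth_in UNIV (\<lambda>x. f x $ j)}"
  then have f: "smooth_in UNIV (\<lambda>x. f x $ j)" for j by blast
  show "continuous_on UNIV f"
  proof -
    have "continuous_on UNIV (iter_partial [] (\<lambda>x. f x $ j))" for j
      using f[of j] unfolding smooth_in_def by blast
    then show ?thesis
      by (subst continuous_on_componentwise) (auto simp: Basis_vec_def inner_axis)
  qed
  have sm: "smooth_in UNIV (partial_deriv i (\<lambda>x. f x $ j))" for j
  proof -
    \<comment> \<open>The head of the index list is differentiated last, so one more derivative on
      the inside is appended at the end of the list.\<close>
    have "iter_partial is (partial_deriv i g) = iter_partial (is @ [i]) g" for "is"
      and g :: "real^'n \<Rightarrow> real"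
      by (induction "is") auto
    note e = this
    show ?thesis
      using f[of j] unfolding smooth_in_def e by blast
  qed
  have d: "((\<lambda>t. f (x + t *\<^sub>R axis i 1) $ j) has_vector_derivative partial_deriv i (\<lambda>x. f x $ j) x) (at 0)" for x j
  proof -
    have "(\<lambda>t. iter_partial [] (\<lambda>x. f x $ j) (x + t *\<^sub>R axis i 1)) differentiable (at 0)"
      using f[of j] unfolding smooth_in_def by blast
    then show ?thesis by (simp add: partial_deriv_def vector_derivative_works)
  qed
  have "((\<lambda>t. f (x + t *\<^sub>R axis i 1)) has_vector_derivative (\<chi> j. partial_deriv i (\<lambda>x. f x $ j) x)) (at 0)" for x
    using d unfolding has_vector_derivative_def
    by (subst has_derivative_componentwise_within)
      (auto simp: Basis_vec_def inner_axis)
  then show "\<exists>g\<in>{f. \<forall>j. smooth_in UNIV (\<lambda>x. f x $ j)}.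
      \<forall>x. ((\<lambda>t. f (x + t *\<^sub>R axis i 1)) has_vector_derivative g x) (at 0)"
    using sm by (intro bexI[of _ "\<lambda>x. \<chi> j. partial_deriv i (\<lambda>x. f x $ j) x"]) auto
qed (use assms in auto)


section \<open>Weak derivatives\<close>

lemma smooth_in_partial_derivative:
  fixes f :: "real^'n::finite \<Rightarrow> real"
  assumes "smooth_in UNIV f"
  shows "((\<lambda>t. f (x + t *\<^sub>R axis i 1)) has_real_derivative
    partial_deriv i f (x + s *\<^sub>R axis i 1)) (at s)"
proof -
  have "(\<lambda>t. iter_partial [] f (y + t *\<^sub>R axis i 1)) differentiable (at 0)" for y
    using assms unfolding smooth_in_def by blast
  then have "((\<lambda>t. f ((x + s *\<^sub>R axis i 1) + t *\<^sub>R axis i 1)) has_real_derivative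
    partial_deriv i f (x + s *\<^sub>R axis i 1)) (at 0)"
    by (simp add: partial_deriv_def vector_derivative_works has_real_derivative_iff_has_vector_derivative)
  then show ?thesis
    using DERIV_shift[of "\<lambda>t. f (x + t *\<^sub>R axis i 1)" _ 0 s] by (simp add: algebra_simps)
qed

lemma smooth_in_continuous:
  assumes "smooth_in UNIV f"
  shows "continuous_on S f" and "continuous_on S (partial_deriv i f)"
proof -
  have "continuous_on UNIV (iter_partial is f)" for "is"
    using assms unfolding smooth_in_def by blast
  from continuous_on_subset[OF this[of "[]"]] continuous_on_subset[OF this[of "[i]"]]
  show "continuous_on S f" and "continuous_on S (partial_deriv i f)" by simp_all
qed

text \<open>Translation invariance makes the integral of every difference quotient vanish.\<close>

lemma integral_partial_eq_0:
  fixes v v' :: "real^'n::finite \<Rightarrow> real"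
  assumes v: "continuous_on UNIV v" and v': "continuous_on UNIV v'"
    and d: "\<And>x s. ((\<lambda>t. v (x + t *\<^sub>R axis i 1)) has_real_derivative v' (x + s *\<^sub>R axis i 1)) (at s)"
    and K: "compact K" and vK: "\<And>x. x \<notin> K \<Longrightarrow> v x = 0"
  shows "(LINT x|lborel. v' x) = 0"
proof -
  let ?e = "axis i 1 :: real^'n"
  obtain r where r: "K \<subseteq> cball 0 r"
    using bounded_subset_ballD[OF compact_imp_bounded[OF K], of 0] ball_subset_cball by blast
  have v0: "v x = 0" if "norm x > r" for x
    using vK[of x] subsetD[OF r, of x] that by auto
  define C where "C = cball (0::real^'n) (r + 1)"
  obtain B where B: "\<And>x. x \<in> cball 0 (r + 2) \<Longrightarrow> norm (v' x) \<le> B"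
  proof -
    have "bounded (v' ` cball 0 (r + 2))"
      by (intro compact_imp_bounded compact_continuous_image continuous_on_subset[OF v']) auto
    then show ?thesis
      using that unfolding bounded_iff by blast
  qed
  have intC: "integrable lborel (\<lambda>x. indicator C x *\<^sub>R f x)" if "continuous_on UNIV f"
    for f :: "real^'n \<Rightarrow> real"
    by (rule borel_integrable_compact) (auto simp: C_def intro: continuous_on_subset[OF that])
  \<comment> \<open>All step sizes are at most 1: the quotients vanish outside the ball of radius r
    + 1, and the intermediate points of the mean value theorem stay in the ball of radius r + 2,
    where \<open>v'\<close> is bounded by B. This is the dominating function.\<close>
  define q where "q = (\<lambda>m x. (v (x + (1 / real (Suc m)) *\<^sub>R ?e) - v x) * real (Suc m))"
  have out: "v (x + s *\<^sub>R ?e) = 0" if "x \<notin> C" "\<bar>s\<bar> \<le> 1" for x s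
  proof (rule v0)
    have "norm x \<le> norm (x + s *\<^sub>R ?e) + norm (s *\<^sub>R ?e)"
      using norm_triangle_ineq4[of "x + s *\<^sub>R ?e" "s *\<^sub>R ?e"] by simp
    with that show "r < norm (x + s *\<^sub>R ?e)" by (simp add: C_def)
  qed
  have vint: "integrable lborel v"
  proof -
    have "(\<lambda>x. indicator C x *\<^sub>R v x) = v"
      using out[of _ 0] by (auto simp: indicator_def fun_eq_iff)
    with intC[OF v] show ?thesis by simp
  qed
  have qi: "(LINT x|lborel. q m x) = 0" for m
  proof -
    let ?c = "(1 / real (Suc m)) *\<^sub>R ?e"
    have [measurable]: "v \<in> borel_measurable borel"
      using v by (rule borel_measurable_continuous_onI)
    have "integrable (distr lborel borel ((+) ?c)) v"
      using vint by (simp add: lborel_distr_plus)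
    then have i: "integrable lborel (\<lambda>x. v (?c + x))"
      by (subst (asm) integrable_distr_eq) auto
    have "(LINT x|lborel. v x) = (LINT x|distr lborel borel ((+) ?c). v x)"
      by (simp add: lborel_distr_plus)
    also have "\<dots> = (LINT x|lborel. v (?c + x))"
      by (subst integral_distr) auto
    finally show ?thesis
      using i vint by (simp add: q_def add.commute)
  qed
  have "(\<lambda>m. LINT x|lborel. q m x) \<longlonglongrightarrow> (LINT x|lborel. v' x)"
  proof (rule integral_dominated_convergence[where w = "\<lambda>x. indicator C x *\<^sub>R B"])
    show "v' \<in> borel_measurable lborel"
      using borel_measurable_continuous_onI[OF v'] by simp
    have [measurable]: "v \<in> borel_measurable borel"
      using v by (rule borel_measurable_continuous_onI)
    show "q m \<in> borel_measurable lborel" for m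
      unfolding q_def by measurable
    show "integrable lborel (\<lambda>x. indicator C x *\<^sub>R B)"
      by (rule intC) simp
    have "(\<lambda>m. q m x) \<longlonglongrightarrow> v' x" for x
    proof -
      have "((\<lambda>s. (v (x + s *\<^sub>R ?e) - v x) / s) \<longlongrightarrow> v' x) (at 0)"
        using d[of x 0] by (simp add: DERIV_def)
      moreover have "filterlim (\<lambda>m. 1 / real (Suc m)) (at 0) sequentially"
        using LIMSEQ_inverse_real_of_nat
        by (auto simp: filterlim_at inverse_eq_divide simp del: of_nat_Suc)
      ultimately have "((\<lambda>m. (v (x + (1 / real (Suc m)) *\<^sub>R ?e) - v x) / (1 / real (Suc m)))
          \<longlongrightarrow> v' x) sequentially"
        by (rule filterlim_compose)
      then show ?thesis by (simp add: q_def del: of_nat_Suc)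
    qed
    then show "AE x in lborel. (\<lambda>m. q m x) \<longlonglongrightarrow> v' x" by simp
    have "norm (q m x) \<le> indicator C x *\<^sub>R B" for m x
    proof (cases "x \<in> C")
      case True
      let ?s = "1 / real (Suc m)"
      have s: "0 < ?s" "?s \<le> 1" by auto
      obtain z where z: "0 < z" "z < ?s"
        "v (x + ?s *\<^sub>R ?e) - v (x + 0 *\<^sub>R ?e) = (?s - 0) * v' (x + z *\<^sub>R ?e)"
        using MVT2[OF s(1), of "\<lambda>s. v (x + s *\<^sub>R ?e)" "\<lambda>s. v' (x + s *\<^sub>R ?e)"] d by blast
      then have "q m x = v' (x + z *\<^sub>R ?e)"
        by (simp add: q_def field_simps del: of_nat_Suc)
      moreover have "x + z *\<^sub>R ?e \<in> cball 0 (r + 2)"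
      proof -
        have "norm (x + z *\<^sub>R ?e) \<le> norm x + z"
          using z(1) norm_triangle_ineq[of x "z *\<^sub>R ?e"] by simp
        moreover have "norm x \<le> r + 1" using True by (simp add: C_def)
        ultimately have "norm (x + z *\<^sub>R ?e) \<le> r + 2" using z(2) s(2) by linarith
        then show ?thesis by simp
      qed
      ultimately show ?thesis
        using B True by simp
    next
      case False
      with out[of x "1 / real (Suc m)"] out[of x 0] show ?thesis
        by (simp add: q_def)
    qed
    then show "AE x in lborel. norm (q m x) \<le> indicator C x *\<^sub>R B" for m by simp
  qed
  then show ?thesis
    unfolding qi by (simp add: LIMSEQ_const_iff)
qed

lemma integral_lebesgue_on_eq_lborel:
  fixes f :: "real^'n::finite \<Rightarrow> real"
  assumes "f \<in> borel_measurable borel" "S \<in> sets lebesgue" "\<And>x. x \<notin> S \<Longrightarrow> f x = 0"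
  shows "(LINT x|lebesgue_on S. f x) = (LINT x|lborel. f x)"
proof -
  have "(LINT x|lebesgue_on S. f x) = (LINT x|lebesgue. indicator S x *\<^sub>R f x)"
    using assms(2) by (intro integral_restrict_space) auto
  also have "(\<lambda>x. indicator S x *\<^sub>R f x) = f"
    using assms(3) by (auto simp: indicator_def fun_eq_iff)
  also have "(LINT x|lebesgue. f x) = (LINT x|lborel. f x)"
    using assms(1) by (intro integral_completion) simp
  finally show ?thesis .
qed

lemma continuous_absolutely_integrable_on_compact:
  fixes f :: "real^'n::finite \<Rightarrow> real"
  assumes "continuous_on K f" "compact K"
  shows "f absolutely_integrable_on K"
proof -
  have "integrable lborel (\<lambda>x. indicator K x *\<^sub>R f x)"
    using assms by (intro borel_integrable_compact)
  then show ?thesis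
    unfolding set_integrable_def
    by (subst integrable_completion) auto
qed

lemma partial_deriv_eq_0_outside:
  fixes f :: "real^'n::finite \<Rightarrow> real"
  assumes "x \<notin> closure {x. f x \<noteq> 0}"
  shows "partial_deriv i f x = 0"
proof -
  let ?e = "axis i 1 :: real^'n"
  have "open (- closure {x. f x \<noteq> 0})" by auto
  then obtain e where e: "e > 0" "ball x e \<subseteq> - closure {x. f x \<noteq> 0}"
    using assms openE by blast
  have "((\<lambda>t. f (x + t *\<^sub>R ?e)) has_vector_derivative 0) (at 0)"
  proof (rule has_vector_derivative_transform_within_open[where S = "ball 0 e" and f = "\<lambda>t. 0"])
    fix t :: real assume "t \<in> ball 0 e"
    then have "x + t *\<^sub>R ?e \<in> ball x e" by (simp add: dist_norm)
    with e(2) have "x + t *\<^sub>R ?e \<notin> closure {x. f x \<noteq> 0}"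
      by blast
    then have "x + t *\<^sub>R ?e \<notin> {x. f x \<noteq> 0}"
      using closure_subset[of "{x. f x \<noteq> 0}"] by (auto simp: subset_iff)
    then show "0 = f (x + t *\<^sub>R ?e)" by simp
  qed (use e in auto)
  then show ?thesis
    by (simp add: partial_deriv_def vector_derivative_at)
qed

text \<open>Integration by parts: the derivative of \<open>u * \<phi>\<close> integrates to zero
  over the whole space because the product is smooth everywhere and vanishes outside the compact
  support of \<phi>. That support lies in S, so the integrals over S and over the whole space
  agree.\<close>

lemma has_weak_partial_smooth:
  fixes u :: "real^'n::finite \<Rightarrow> real"
  assumes u: "smooth_in UNIV u" and "open S"
  shows "has_weak_partial S i u (partial_deriv i u)"
  unfolding has_weak_partial_def
proof (intro conjI allI impI)
  show "locally_integrable_on u S" "locally_integrable_on (partial_deriv i u) S"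
    unfolding locally_integrable_on_def
    by (simp_all add: smooth_in_continuous[OF u] continuous_absolutely_integrable_on_compact)
  fix \<phi> assume \<phi>: "test_function S \<phi>"
  let ?K = "closure {x. \<phi> x \<noteq> 0}"
  have s: "smooth_in UNIV \<phi>" and K: "compact ?K" "?K \<subseteq> S"
    using \<phi> unfolding test_function_def by blast+
  note c = smooth_in_continuous[OF u, of UNIV] smooth_in_continuous[OF s, of UNIV]
  have [measurable]: "u \<in> borel_measurable borel" "\<phi> \<in> borel_measurable borel"
    "partial_deriv i u \<in> borel_measurable borel" "partial_deriv i \<phi> \<in> borel_measurable borel"
    by (simp_all add: c borel_measurable_continuous_onI)
  have \<phi>0: "\<phi> x = 0" if "x \<notin> ?K" for x
    using that closure_subset[of "{x. \<phi> x \<noteq> 0}"] by auto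
  have d\<phi>0: "partial_deriv i \<phi> x = 0" if "x \<notin> ?K" for x
    using that by (rule partial_deriv_eq_0_outside)
  have int: "integrable lborel g" if "continuous_on UNIV g" "\<And>x. x \<notin> ?K \<Longrightarrow> g x = 0" for g :: "real^'n \<Rightarrow> real"
  proof -
    have "integrable lborel (\<lambda>x. indicator ?K x *\<^sub>R g x)"
      using K(1) continuous_on_subset[OF that(1) subset_UNIV] by (rule borel_integrable_compact)
    moreover have "(\<lambda>x. indicator ?K x *\<^sub>R g x) = g"
      using that(2) by (auto simp: indicator_def fun_eq_iff)
    ultimately show ?thesis by simp
  qed
  have "(LINT x|lborel. u x * partial_deriv i \<phi> x + partial_deriv i u x * \<phi> x) = 0"
  proof (rule integral_partial_eq_0[where v = "\<lambda>x. u x * \<phi> x" and K = ?K and i = i])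
    show "((\<lambda>t. u (x + t *\<^sub>R axis i 1) * \<phi> (x + t *\<^sub>R axis i 1)) has_real_derivative
        u (x + s *\<^sub>R axis i 1) * partial_deriv i \<phi> (x + s *\<^sub>R axis i 1) +
        partial_deriv i u (x + s *\<^sub>R axis i 1) * \<phi> (x + s *\<^sub>R axis i 1)) (at s)" for x s
      using DERIV_mult[OF smooth_in_partial_derivative[OF u] smooth_in_partial_derivative[OF s]]
      by (simp add: mult.commute add.commute)
    show "continuous_on UNIV (\<lambda>x. u x * \<phi> x)"
      "continuous_on UNIV (\<lambda>x. u x * partial_deriv i \<phi> x + partial_deriv i u x * \<phi> x)"
      by (intro continuous_on_add continuous_on_mult c)+
    show "u x * \<phi> x = 0" if "x \<notin> ?K" for x
      using \<phi>0[OF that] by simp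
  qed (fact K(1))
  moreover have "integrable lborel (\<lambda>x. u x * partial_deriv i \<phi> x)"
    "integrable lborel (\<lambda>x. partial_deriv i u x * \<phi> x)"
  proof -
    show "integrable lborel (\<lambda>x. u x * partial_deriv i \<phi> x)"
      by (rule int[OF continuous_on_mult[OF c(1) c(4)]]) (drule d\<phi>0, simp)
    show "integrable lborel (\<lambda>x. partial_deriv i u x * \<phi> x)"
      by (rule int[OF continuous_on_mult[OF c(2) c(3)]]) (drule \<phi>0, simp)
  qed
  ultimately have "(LINT x|lborel. u x * partial_deriv i \<phi> x) = - (LINT x|lborel. partial_deriv i u x * \<phi> x)"
    by simp
  moreover have "(LINT x|lebesgue_on S. u x * partial_deriv i \<phi> x) = (LINT x|lborel. u x * partial_deriv i \<phi> x)"
    "(LINT x|lebesgue_on S. partial_deriv i u x * \<phi> x) = (LINT x|lborel. partial_deriv i u x * \<phi> x)"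
  proof -
    have S: "S \<in> sets lebesgue"
      using \<open>open S\<close> by simp
    have "\<phi> x = 0" "partial_deriv i \<phi> x = 0" if "x \<notin> S" for x
      using that K(2) \<phi>0[of x] d\<phi>0[of x] by auto
    then show "(LINT x|lebesgue_on S. u x * partial_deriv i \<phi> x) = (LINT x|lborel. u x * partial_deriv i \<phi> x)"
      "(LINT x|lebesgue_on S. partial_deriv i u x * \<phi> x) = (LINT x|lborel. partial_deriv i u x * \<phi> x)"
      by (intro integral_lebesgue_on_eq_lborel S; simp)+
  qed
  ultimately show "(LINT x|lebesgue_on S. u x * partial_deriv i \<phi> x) =
      - (LINT x|lebesgue_on S. partial_deriv i u x * \<phi> x)" by simp
qed


section \<open>Smooth bump functions on boxes\<close>

definition flat_exp :: "real poly \<Rightarrow> real \<Rightarrow> real" where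
  "flat_exp P t = (if t > 0 then poly P (1 / t) * exp (- (1 / t)) else 0)"

lemma flat_exp_tendsto_0: "(flat_exp P \<longlongrightarrow> 0) (at 0)"
proof -
  have "((\<lambda>s. \<Sum>k\<le>degree P. coeff P k * (s ^ k / exp s)) \<longlongrightarrow> (\<Sum>k\<le>degree P. coeff P k * 0)) at_top"
    by (intro tendsto_intros tendsto_power_div_exp_0)
  then have "((\<lambda>s. poly P s / exp s) \<longlongrightarrow> 0) at_top"
    by (simp add: poly_altdef sum_divide_distrib)
  then have "((\<lambda>t. poly P (inverse t) / exp (inverse t)) \<longlongrightarrow> 0) (at_right 0)"
    by (rule filterlim_compose[OF _ filterlim_inverse_at_top_right])
  moreover have "\<forall>\<^sub>F t in at_right 0. poly P (inverse t) / exp (inverse t) = flat_exp P t"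
    by (auto simp: flat_exp_def eventually_at_right_field exp_minus divide_simps intro: exI[of _ 1])
  ultimately have "(flat_exp P \<longlongrightarrow> 0) (at_right 0)"
    by (rule Lim_transform_eventually)
  moreover have "(flat_exp P \<longlongrightarrow> 0) (at_left 0)"
    by (rule tendsto_eventually) (auto simp: flat_exp_def eventually_at_left_field intro: exI[of _ "-1"])
  ultimately show ?thesis
    by (rule filterlim_split_at[rotated])
qed

text \<open>In the variable s = 1/t one has ds/dt = -s^2, so differentiation replaces the polynomial
  P by s^2 (P - P'). The polynomial parameter exists to make the class closed under
  differentiation.\<close>

lemma flat_exp_derivative:
  "(flat_exp P has_real_derivative flat_exp (monom 1 2 * (P - pderiv P)) t) (at t)"
proof (cases t "0::real" rule: linorder_cases)
  case less
  have "(flat_exp P has_real_derivative 0) (at t)"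
    by (rule has_field_derivative_transform_within_open[where S = "{..<0}" and f = "\<lambda>t. 0"])
      (use less in \<open>auto simp: flat_exp_def\<close>)
  then show ?thesis
    using less by (simp add: flat_exp_def)
next
  case equal
  \<comment> \<open>Dividing by h multiplies the polynomial in 1/h by its variable, so the
    difference quotient at 0 is again of the same form and tends to 0.\<close>
  have "(\<lambda>h. (flat_exp P (0 + h) - flat_exp P 0) / h) = flat_exp (pCons 0 P)"
    by (auto simp: flat_exp_def fun_eq_iff)
  then have "(flat_exp P has_real_derivative 0) (at 0)"
    unfolding DERIV_def using flat_exp_tendsto_0[of "pCons 0 P"] by simp
  then show ?thesis
    using equal by (simp add: flat_exp_def)
next
  case greater
  have "((\<lambda>t. poly P (1 / t) * exp (- (1 / t))) has_real_derivative
      flat_exp (monom 1 2 * (P - pderiv P)) t) (at t)"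
    using greater
    by (auto intro!: derivative_eq_intros DERIV_chain2[OF poly_DERIV]
        simp: flat_exp_def poly_monom power2_eq_square field_simps)
  then show ?thesis
    by (rule has_field_derivative_transform_within_open[where S = "{0<..}"])
      (use greater in \<open>auto simp: flat_exp_def\<close>)
qed

text \<open>Each factor is positive exactly when the i-th coordinate lies strictly between its
  bounds. The factor \<open>Suc k\<close> drives the exponents to 0, so the bumps tend to the
  indicator of the open box while their support stays the same.\<close>

definition box_bump :: "nat \<Rightarrow> real^'n::finite \<Rightarrow> real^'n \<Rightarrow> real^'n \<Rightarrow> real" where
  "box_bump k a b x = (\<Prod>i\<in>UNIV. flat_exp 1 (real (Suc k) * ((x $ i - a $ i) * (b $ i - x $ i))))"

text \<open>With the zero generator the kernel calculus applies to explicit functions of the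
  coordinates.\<close>

lemma generator_closed_zero: "generator_closed (\<lambda>x. 0)"
  by (auto simp: generator_closed_def intro!: bexI[of _ "\<lambda>t x. 0"] kernels.const)

lemma box_bump_smooth:
  fixes a b :: "real^'n::finite"
  shows "smooth_in S (box_bump k a b)"
proof (rule smooth_in_kernel[OF generator_closed_zero])
  let ?\<phi> = "\<lambda>j. flat_exp (((\<lambda>P. monom 1 2 * (P - pderiv P)) ^^ j) 1)"
  have "(\<lambda>t x. ?\<phi> 0 (real (Suc k) * ((x $ i - a $ i) * (b $ i - x $ i)))) \<in> kernels (\<lambda>x::real^'n. 0)" for i
    by (rule kernels.comp[where S = UNIV and \<phi> = ?\<phi> and j = 0])
      (use flat_exp_derivative in \<open>auto intro!: kernels.const kernels.coord kernels.mult kernels_diff\<close>)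
  then show "(\<lambda>t. box_bump k a b) \<in> kernels (\<lambda>x. 0)"
    unfolding box_bump_def by (intro kernels_prod) simp
qed simp

lemma flat_exp_1_bounds: "0 \<le> flat_exp 1 t" "flat_exp 1 t \<le> 1"
  by (auto simp: flat_exp_def)

lemma box_bump_bounds: "0 \<le> box_bump k a b x" "box_bump k a b x \<le> 1"
  by (auto simp: box_bump_def flat_exp_1_bounds intro!: prod_nonneg prod_le_1)

lemma box_bump_nonzero:
  assumes "box a b \<noteq> {}"
  shows "{x. box_bump k a b x \<noteq> 0} = box a b"
proof -
  have "a $ i < b $ i" for i
    using assms by (simp add: interval_ne_empty_cart)
  then have "(x $ i - a $ i) * (b $ i - x $ i) > 0 \<longleftrightarrow> a $ i < x $ i \<and> x $ i < b $ i" for i x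
    by (smt (verit) mult_less_0_iff mult_pos_pos zero_less_mult_iff)
  then have "flat_exp 1 (real (Suc k) * ((x $ i - a $ i) * (b $ i - x $ i))) \<noteq> 0 \<longleftrightarrow>
      a $ i < x $ i \<and> x $ i < b $ i" for i x
    unfolding flat_exp_def by (simp add: zero_less_mult_iff del: of_nat_Suc)
  then show ?thesis
    by (auto simp: box_bump_def mem_box_cart)
qed

lemma box_bump_test_function:
  assumes "box a b \<noteq> {}" "cbox a b \<subseteq> S"
  shows "test_function S (box_bump k a b)"
  unfolding test_function_def box_bump_nonzero[OF assms(1)] closure_box[OF assms(1)]
  using assms(2) by (simp add: box_bump_smooth)

lemma box_bump_tendsto:
  fixes x :: "real^'a::finite"
  assumes "box a b \<noteq> {}"
  shows "(\<lambda>k. box_bump k a b x) \<longlonglongrightarrow> indicator (box a b) x"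
proof (cases "x \<in> box a b")
  case True
  have L: "(\<lambda>k. flat_exp 1 (real (Suc k) * ((x $ i - a $ i) * (b $ i - x $ i)))) \<longlonglongrightarrow> 1" for i
  proof -
    let ?c = "(x $ i - a $ i) * (b $ i - x $ i)"
    have c: "?c > 0" using True by (simp add: mem_box_cart)
    have "(\<lambda>k. exp (- (1 / ?c * inverse (real (Suc k))))) \<longlonglongrightarrow> exp (- (1 / ?c * 0))"
      by (intro tendsto_intros LIMSEQ_inverse_real_of_nat)
    moreover have "exp (- (1 / ?c * inverse (real (Suc k)))) = flat_exp 1 (real (Suc k) * ?c)" for k
      using c by (simp add: flat_exp_def zero_less_mult_iff divide_simps del: of_nat_Suc)
    ultimately show ?thesis by simp
  qed
  have "(\<lambda>k. box_bump k a b x) \<longlonglongrightarrow> (\<Prod>i\<in>(UNIV::'a set). 1)"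
    unfolding box_bump_def by (intro tendsto_prod L)
  with True show ?thesis by simp
next
  case False
  then have "box_bump k a b x = 0" for k
    using box_bump_nonzero[OF assms, of k] by blast
  with False show ?thesis by simp
qed

section \<open>Uniqueness of weak derivatives up to null sets\<close>

lemma weak_zero_box:
  fixes g :: "real^'n::finite \<Rightarrow> real"
  assumes g: "locally_integrable_on g S" and S: "open S" and sub: "cbox a b \<subseteq> S"
    and z: "\<And>\<phi>. test_function S \<phi> \<Longrightarrow> (LINT x|lebesgue_on S. g x * \<phi> x) = 0"
  shows "(LINT x|lebesgue. indicator (box a b) x * g x) = 0"
proof (cases "box a b = {}")
  case False
  have i: "integrable lebesgue (\<lambda>x. indicator (cbox a b) x * g x)"
    using g sub by (auto simp: locally_integrable_on_def set_integrable_def)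
  have bm: "box_bump k a b \<in> borel_measurable lebesgue" for k
    using smooth_in_continuous(1)[OF box_bump_smooth, of UNIV k a b]
    by (auto intro!: measurable_completion borel_measurable_continuous_onI)
  have "indicator (cbox a b) x * box_bump k a b x = box_bump k a b x" for k x
    using box_bump_nonzero[OF False, of k] box_subset_cbox[of a b] by (auto simp: indicator_def)
  then have e: "indicator (cbox a b) x * g x * box_bump k a b x = g x * box_bump k a b x" for k x
    by (metis mult.commute mult.left_commute)
  have "(LINT x|lebesgue. indicator (cbox a b) x * g x * box_bump k a b x) = 0" for k
  proof -
    have "0 = (LINT x|lebesgue_on S. g x * box_bump k a b x)"
      using z[OF box_bump_test_function[OF False sub]] by simp
    also have "\<dots> = (LINT x|lebesgue. indicator S x *\<^sub>R (g x * box_bump k a b x))"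
      using S by (intro integral_restrict_space) auto
    also have "(\<lambda>x. indicator S x *\<^sub>R (g x * box_bump k a b x)) = (\<lambda>x. g x * box_bump k a b x)"
      using box_bump_nonzero[OF False, of k] box_subset_cbox[of a b] sub
      by (auto simp: indicator_def fun_eq_iff)
    finally show ?thesis by (simp add: e)
  qed
  \<comment> \<open>The bumps take values between 0 and 1 and live in the box, so the absolute value
    of g on the compact closed box dominates; it is integrable there by local integrability.\<close>
  moreover have "(\<lambda>k. LINT x|lebesgue. indicator (cbox a b) x * g x * box_bump k a b x) \<longlonglongrightarrow>
      (LINT x|lebesgue. indicator (cbox a b) x * g x * indicator (box a b) x)"
  proof (rule integral_dominated_convergence[where w = "\<lambda>x. norm (indicator (cbox a b) x * g x)"])
    show "(\<lambda>x. indicator (cbox a b) x * g x * box_bump k a b x) \<in> borel_measurable lebesgue" for k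
      using borel_measurable_times[OF borel_measurable_integrable[OF i] bm] .
    show "(\<lambda>x. indicator (cbox a b) x * g x * indicator (box a b) x) \<in> borel_measurable lebesgue"
      by (intro borel_measurable_times[OF borel_measurable_integrable[OF i]])
        (simp add: measurable_completion)
    show "AE x in lebesgue. (\<lambda>k. indicator (cbox a b) x * g x * box_bump k a b x) \<longlonglongrightarrow>
        indicator (cbox a b) x * g x * indicator (box a b) x"
      by (intro AE_I2 tendsto_mult tendsto_const box_bump_tendsto[OF False])
    show "AE x in lebesgue. norm (indicator (cbox a b) x * g x * box_bump k a b x)
        \<le> norm (indicator (cbox a b) x * g x)" for k
      using box_bump_bounds[of k a b] by (intro AE_I2) (simp add: abs_mult mult_left_le)
  qed (use i in auto)
  moreover have "(\<lambda>x. indicator (cbox a b) x * g x * indicator (box a b) x) = (\<lambda>x. indicator (box a b) x * g x)"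
    using box_subset_cbox[of a b] by (auto simp: indicator_def fun_eq_iff)
  ultimately show ?thesis by (simp add: LIMSEQ_const_iff)
qed simp

lemma AE_not_in_cbox_diff_box: "AE x in lborel. x \<notin> cbox c d - box c d"
proof -
  have "cbox c d - box c d \<in> null_sets lebesgue"
    by (simp add: negligible_frontier_interval flip: negligible_iff_null_sets)
  from AE_not_in[OF this] show ?thesis
    by (simp only: AE_completion_iff)
qed

text \<open>Open boxes form an intersection-stable generator of the Borel sets, and the sets over
  which f integrates to zero form a Dynkin system containing them. Complements need the total
  integral to vanish; it does, because f lives on one closed box, whose boundary is null.\<close>

lemma AE_zero_if_box_integrals_zero:
  fixes f :: "real^'n::finite \<Rightarrow> real"
  assumes f: "integrable lborel f" and c: "\<And>x. x \<notin> cbox c d \<Longrightarrow> f x = 0"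
    and z: "\<And>a b. (LINT x|lborel. indicator (box a b) x * f x) = 0"
  shows "AE x in lborel. f x = 0"
proof (rule sigma_finite_measure.density_zero[OF sigma_finite_lborel f])
  have [measurable]: "f \<in> borel_measurable borel"
    using borel_measurable_integrable[OF f] by simp
  have si: "set_integrable lborel A f" if "A \<in> sets borel" for A
    unfolding set_integrable_def using that f by (intro integrable_mult_indicator) simp_all
  have "AE x in lborel. f x = indicator (box c d) x * f x"
    using AE_not_in_cbox_diff_box[of c d] by eventually_elim (use c in \<open>auto simp: indicator_def\<close>)
  then have "(LINT x|lborel. f x) = (LINT x|lborel. indicator (box c d) x * f x)"
    by (intro integral_cong_AE) simp_all
  then have total: "(LINT x|lborel. f x) = 0"
    using z by simp
  fix A assume "A \<in> sets (lborel :: (real^'n) measure)"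
  then have A: "A \<in> sigma_sets UNIV (range (\<lambda>(a, b). box a b))"
    by (simp add: borel_eq_box)
  have "Int_stable (range (\<lambda>(a, b). box a b :: (real^'n) set))"
    by (auto simp: Int_stable_def box_Int_box)
  moreover have "range (\<lambda>(a, b). box a b :: (real^'n) set) \<subseteq> Pow UNIV"
    by simp
  ultimately show "set_lebesgue_integral lborel A f = 0"
    using A
  proof (induction rule: sigma_sets_induct_disjoint)
    case (basic A)
    then show ?case
      using z by (auto simp: set_lebesgue_integral_def)
  next
    case (compl A)
    then have A: "A \<in> sets borel" by (simp add: borel_eq_box)
    have "set_lebesgue_integral lborel UNIV f =
        set_lebesgue_integral lborel A f + set_lebesgue_integral lborel (UNIV - A) f"
      using A by (subst set_integral_Un[symmetric]) (auto simp: si)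
    with compl total show ?case
      by (simp add: set_lebesgue_integral_def)
  next
    case (union A)
    then have A: "A i \<in> sets borel" for i by (auto simp: borel_eq_box)
    have "(LINT x:(\<Union>i. A i)|lborel. f x) = (\<Sum>i. (LINT x:(A i)|lborel. f x))"
      using union(1) A by (intro lebesgue_integral_countable_add si) (auto simp: disjoint_family_on_def)
    with union show ?case by simp
  qed (simp add: set_lebesgue_integral_def)
qed

lemma weak_zero_AE:
  fixes g :: "real^'n::finite \<Rightarrow> real"
  assumes g: "locally_integrable_on g S" and S: "open S"
    and z: "\<And>\<phi>. test_function S \<phi> \<Longrightarrow> (LINT x|lebesgue_on S. g x * \<phi> x) = 0"
  shows "AE x in lebesgue_on S. g x = 0"
proof -
  have box: "AE x in lebesgue. x \<in> cbox c d \<longrightarrow> g x = 0" if sub: "cbox c d \<subseteq> S" for c d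
  proof -
    define G where "G = (\<lambda>x. indicator (cbox c d) x * g x)"
    have G: "integrable lebesgue G"
      using g sub by (auto simp: locally_integrable_on_def set_integrable_def G_def)
    \<comment> \<open>The function g is only Lebesgue measurable, whereas the generator argument
      runs over Borel sets; hence the passage to a Borel representative.\<close>
    obtain f' where f': "f' \<in> borel_measurable lborel" "AE x in lborel. G x = f' x"
      using completion_ex_borel_measurable_real borel_measurable_integrable[OF G] by blast
    define f where "f = (\<lambda>x. indicator (cbox c d) x * f' x)"
    have [measurable]: "f \<in> borel_measurable borel"
      using f'(1) by (simp add: f_def)
    have ae: "AE x in lebesgue. G x = f x"
      using AE_completion[OF f'(2)] by eventually_elim (auto simp: G_def f_def indicator_def)
    have fl: "f \<in> borel_measurable lebesgue"
      by (simp add: measurable_completion)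
    have "integrable lebesgue f"
      using integrable_cong_AE_imp[OF G fl ae] .
    then have "integrable lborel f"
      by (subst (asm) integrable_completion) auto
    then have "AE x in lborel. f x = 0"
    proof (rule AE_zero_if_box_integrals_zero[where c = c and d = d])
      fix a b
      obtain a' b' where ab: "box a b \<inter> box c d = box a' b'" by (simp add: box_Int_box)
      obtain a'' b'' where ab'': "cbox a b \<inter> cbox c d = cbox a'' b''" by (simp add: Int_interval)
      have null: "AE x in lebesgue. x \<notin> cbox c d - box c d"
        by (rule AE_completion[OF AE_not_in_cbox_diff_box])
      have "(LINT x|lborel. indicator (box a b) x * f x) = (LINT x|lebesgue. indicator (box a b) x * f x)"
        by (intro integral_completion[symmetric]) simp
      also have "\<dots> = (LINT x|lebesgue. indicator (box a b \<inter> box c d) x * g x)"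
      proof (rule integral_cong_AE)
        show m: "(\<lambda>x. indicator (box a b) x * f x) \<in> borel_measurable lebesgue"
          by (intro measurable_completion) simp
        have "AE x in lebesgue. indicator (box a b) x * f x = indicator (box a b \<inter> box c d) x * g x"
          using ae null by eventually_elim (use box_subset_cbox[of c d] in \<open>auto simp: G_def indicator_def\<close>)
        then show "AE x in lebesgue. indicator (box a b) x * f x = indicator (box a b \<inter> box c d) x * g x"
          and "(\<lambda>x. indicator (box a b \<inter> box c d) x * g x) \<in> borel_measurable lebesgue"
          using borel_measurable_AE[OF m] by auto
      qed
      also have "\<dots> = 0"
      proof (cases "box a' b' = {}")
        case False
        then have "cbox a' b' \<subseteq> cbox c d"
          using ab by (metis Int_lower2 closure_box closure_mono box_subset_cbox closed_cbox closure_minimal order_trans)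
        then show ?thesis
          using weak_zero_box[OF g S _ z] sub unfolding ab by (meson order_trans)
      qed (simp add: ab)
      finally show "(LINT x|lborel. indicator (box a b) x * f x) = 0" .
    qed (simp add: f_def)
    then have "AE x in lebesgue. f x = 0" by (rule AE_completion)
    with ae show ?thesis
      by eventually_elim (auto simp: G_def)
  qed
  \<comment> \<open>The result on single boxes globalises because an open set is a countable union
    of closed boxes.\<close>
  obtain \<D> where D: "countable \<D>" "\<D> \<subseteq> Pow S" "\<And>X. X \<in> \<D> \<Longrightarrow> \<exists>a b. X = cbox a b" "\<Union>\<D> = S"
    using open_countable_Union_open_cbox[OF S] by blast
  have "AE x in lebesgue. \<forall>X\<in>\<D>. x \<in> X \<longrightarrow> g x = 0"
    unfolding AE_ball_countable[OF D(1)] using box D(2,3) by (metis PowD subsetD)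
  then have "AE x in lebesgue. x \<in> S \<longrightarrow> g x = 0"
    by eventually_elim (use D(4) in blast)
  then show ?thesis
    using S by (subst AE_restrict_space_iff) auto
qed

text \<open>This makes \<open>W12_norm\<close> computable: \<open>weak_partial\<close> is picked by
  choice, and only its class modulo null sets is determined.\<close>

lemma has_weak_partial_AE_unique:
  fixes u :: "real^'n::finite \<Rightarrow> real"
  assumes S: "open S" and g: "has_weak_partial S i u g" and g': "has_weak_partial S i u g'"
  shows "AE x in lebesgue_on S. g x = g' x"
proof -
  have int: "integrable (lebesgue_on S) (\<lambda>x. h x * \<phi> x)"
    if h: "locally_integrable_on h S" and \<phi>: "test_function S \<phi>" for h \<phi>
  proof -
    let ?K = "closure {x. \<phi> x \<noteq> 0}"
    have K: "compact ?K" "?K \<subseteq> S" and c: "continuous_on UNIV \<phi>"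
      using \<phi> smooth_in_continuous(1) unfolding test_function_def by blast+
    obtain B where B: "\<And>x. x \<in> ?K \<Longrightarrow> norm (\<phi> x) \<le> B"
      using compact_imp_bounded[OF compact_continuous_image[OF continuous_on_subset[OF c subset_UNIV] K(1)]]
      unfolding bounded_iff by blast
    have hK: "integrable lebesgue (\<lambda>x. indicator ?K x *\<^sub>R h x)"
      using h K unfolding locally_integrable_on_def set_integrable_def by blast
    have mK: "?K \<in> sets lebesgue" by simp
    have \<phi>m: "\<phi> \<in> borel_measurable lebesgue"
      using c by (auto intro!: measurable_completion borel_measurable_continuous_onI)
    have e: "indicator S x *\<^sub>R (h x * \<phi> x) = (indicator ?K x *\<^sub>R h x) * \<phi> x" for x
    proof (cases "x \<in> ?K")
      case True
      with K show ?thesis by (auto simp: indicator_def)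
    next
      case False
      then have "\<phi> x = 0" using closure_subset[of "{x. \<phi> x \<noteq> 0}"] by blast
      then show ?thesis by simp
    qed
    have "integrable lebesgue (\<lambda>x. (indicator ?K x *\<^sub>R h x) * \<phi> x)"
    proof (rule Bochner_Integration.integrable_bound)
      show "integrable lebesgue (\<lambda>x. B * (indicator ?K x *\<^sub>R h x))"
        using hK by simp
      show "(\<lambda>x. (indicator ?K x *\<^sub>R h x) * \<phi> x) \<in> borel_measurable lebesgue"
        by (rule borel_measurable_times[OF borel_measurable_integrable[OF hK] \<phi>m])
      show "AE x in lebesgue. norm ((indicator ?K x *\<^sub>R h x) * \<phi> x) \<le> norm (B * (indicator ?K x *\<^sub>R h x))"
      proof (intro AE_I2)
        fix x
        show "norm ((indicator ?K x *\<^sub>R h x) * \<phi> x) \<le> norm (B * (indicator ?K x *\<^sub>R h x))"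
        proof (cases "x \<in> ?K")
          case True
          from B[OF this] have "\<bar>\<phi> x\<bar> \<le> \<bar>B\<bar>" by simp
          with True show ?thesis by (simp add: abs_mult mult.commute mult_right_mono)
        qed simp
      qed
    qed
    then show ?thesis
      unfolding e[symmetric] using S by (subst integrable_restrict_space) simp_all
  qed
  have "AE x in lebesgue_on S. g x - g' x = 0"
  proof (rule weak_zero_AE[OF _ S])
    show "locally_integrable_on (\<lambda>x. g x - g' x) S"
      using g g' unfolding has_weak_partial_def locally_integrable_on_def by (auto intro: set_integral_diff(1))
    fix \<phi> assume \<phi>: "test_function S \<phi>"
    have "(LINT x|lebesgue_on S. g x * \<phi> x) = (LINT x|lebesgue_on S. g' x * \<phi> x)"
      using g g' \<phi> unfolding has_weak_partial_def by force
    moreover have "integrable (lebesgue_on S) (\<lambda>x. g x * \<phi> x)" "integrable (lebesgue_on S) (\<lambda>x. g' x * \<phi> x)"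
      using g g' \<phi> int unfolding has_weak_partial_def by blast+
    ultimately show "(LINT x|lebesgue_on S. (g x - g' x) * \<phi> x) = 0"
      by (simp add: left_diff_distrib)
  qed
  then show ?thesis by simp
qed


section \<open>Norms\<close>

lemma continuous_Lp_space:
  fixes f :: "real^'n::finite \<Rightarrow> 'b::euclidean_space"
  assumes f: "continuous_on UNIV f" and S: "open S" "bounded S" and p: "p \<ge> 1"
  shows "f \<in> Lp_space p (lebesgue_on S)"
proof -
  have [measurable]: "f \<in> borel_measurable borel"
    using f by (rule borel_measurable_continuous_onI)
  have [measurable]: "f \<in> borel_measurable (lebesgue_on S)"
    by (intro measurable_restrict_space1 measurable_completion) simp
  have "compact (closure S)"
    using S(2) by simp
  then have "bounded (f ` closure S)"
    by (intro compact_imp_bounded compact_continuous_image continuous_on_subset[OF f]) auto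
  then obtain B where B: "\<And>x. x \<in> S \<Longrightarrow> norm (f x) \<le> B"
    using closure_subset[of S] unfolding bounded_iff by blast
  interpret finite_measure "lebesgue_on S"
    using S by (intro finite_measure_lebesgue_on) (simp add: lmeasurable_open)
  have "integrable (lebesgue_on S) (\<lambda>x. norm (f x) powr p)"
  proof (rule integrable_const_bound)
    show "AE x in lebesgue_on S. norm (norm (f x) powr p) \<le> B powr p"
      using B p by (intro AE_I2) (auto simp: powr_mono2)
  qed measurable
  then show ?thesis by (simp add: Lp_space_def)
qed

text \<open>Lebesgue measure is complete, so measurability passes from g to f. In the application f
  is a weak derivative picked by choice and g the classical one.\<close>

lemma Lp_norm_cong_AE:
  fixes f g :: "real^'n::finite \<Rightarrow> real"
  assumes g: "g \<in> borel_measurable (lebesgue_on S)" and S: "S \<in> sets lebesgue"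
    and ae: "AE x in lebesgue_on S. f x = g x"
  shows "Lp_norm p (lebesgue_on S) f = Lp_norm p (lebesgue_on S) g"
proof -
  have S': "S \<inter> space lebesgue \<in> sets lebesgue" using S by simp
  have gm: "(\<lambda>x. indicator S x *\<^sub>R norm (g x) powr p) \<in> borel_measurable lebesgue"
    using borel_measurable_restrict_space_iff[OF S', of "\<lambda>x. norm (g x) powr p"] g by simp
  have ae': "AE x in lebesgue. indicator S x *\<^sub>R norm (g x) powr p = indicator S x *\<^sub>R norm (f x) powr p"
    using ae unfolding AE_restrict_space_iff[OF S'] by eventually_elim (auto simp: indicator_def)
  have "(LINT x|lebesgue_on S. norm (f x) powr p) = (LINT x|lebesgue_on S. norm (g x) powr p)"
    unfolding integral_restrict_space[OF S']
    using ae' by (intro integral_cong_AE gm borel_measurable_AE[OF gm ae']) auto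
  then show ?thesis by (simp add: Lp_norm_def)
qed

lemma W12_smooth:
  fixes u :: "real^'n::finite \<Rightarrow> real"
  assumes u: "smooth_in UNIV u" and S: "open S" "bounded S"
  shows "u \<in> W12_space S"
    and "W12_norm S u = sqrt ((Lp_norm 2 (lebesgue_on S) u)\<^sup>2 +
           (\<Sum>i\<in>UNIV. (Lp_norm 2 (lebesgue_on S) (partial_deriv i u))\<^sup>2))"
proof -
  have L: "u \<in> Lp_space 2 (lebesgue_on S)" "partial_deriv i u \<in> Lp_space 2 (lebesgue_on S)" for i
    by (intro continuous_Lp_space smooth_in_continuous[OF u] S; simp)+
  with has_weak_partial_smooth[OF u S(1)] show "u \<in> W12_space S"
    unfolding W12_space_def by blast
  have "Lp_norm 2 (lebesgue_on S) (weak_partial S i u) = Lp_norm 2 (lebesgue_on S) (partial_deriv i u)" for i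
  proof (rule Lp_norm_cong_AE)
    show "partial_deriv i u \<in> borel_measurable (lebesgue_on S)"
      using L(2) by (simp add: Lp_space_def)
    have "has_weak_partial S i u (weak_partial S i u)"
      unfolding weak_partial_def by (rule someI[of _ "partial_deriv i u"]) (rule has_weak_partial_smooth[OF u S(1)])
    then show "AE x in lebesgue_on S. weak_partial S i u x = partial_deriv i u x"
      by (rule has_weak_partial_AE_unique[OF S(1) _ has_weak_partial_smooth[OF u S(1)]])
  qed (use S in simp)
  then show "W12_norm S u = sqrt ((Lp_norm 2 (lebesgue_on S) u)\<^sup>2 +
           (\<Sum>i\<in>UNIV. (Lp_norm 2 (lebesgue_on S) (partial_deriv i u))\<^sup>2))"
    by (simp add: W12_norm_def)
qed

section \<open>Integrable product weights\<close>

lemma nn_integral_abs_powr_finite: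
  fixes a :: real
  assumes "a < 1"
  shows "(\<integral>\<^sup>+t. ennreal (indicator {-1..1} t * \<bar>t\<bar> powr (- a)) \<partial>lborel) < \<infinity>"
proof -
  have h: "((\<lambda>t. \<bar>t\<bar> powr (- a)) has_integral (1 / (1 - a))) {0..1}"
    using has_integral_powr_from_0[of "- a" 1] assms
    by (subst has_integral_cong[where g = "\<lambda>t. t powr (- a)"]) auto
  have h': "((\<lambda>t. \<bar>t\<bar> powr (- a)) has_integral (1 / (1 - a))) {-1..0}"
    using h has_integral_reflect_real[where f = "\<lambda>t. \<bar>t\<bar> powr (- a)" and a = 0 and b = 1] by simp
  have "(\<integral>\<^sup>+t. ennreal (indicator {-1..1} t * \<bar>t\<bar> powr (- a)) \<partial>lborel) \<le>
    (\<integral>\<^sup>+t. ennreal (indicator {0..1} t * \<bar>t\<bar> powr (- a)) + ennreal (indicator {-1..0} t * \<bar>t\<bar> powr (- a)) \<partial>lborel)"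
    by (intro nn_integral_mono) (auto simp: indicator_def)
  also have "\<dots> = (\<integral>\<^sup>+t. ennreal (indicator {0..1} t * \<bar>t\<bar> powr (- a)) \<partial>lborel) +
      (\<integral>\<^sup>+t. ennreal (indicator {-1..0} t * \<bar>t\<bar> powr (- a)) \<partial>lborel)"
    by (intro nn_integral_add) measurable
  also have "\<dots> = ennreal (1 / (1 - a)) + ennreal (1 / (1 - a))"
  proof -
    have "(\<integral>\<^sup>+t. ennreal (indicator S t * \<bar>t\<bar> powr (- a)) \<partial>lborel) = ennreal I"
      if "((\<lambda>t. \<bar>t\<bar> powr (- a)) has_integral I) S" "S \<in> sets borel" for S I
    proof (rule nn_integral_has_integral_lborel)
      have "(\<lambda>t. indicator S t * \<bar>t\<bar> powr (- a)) = (\<lambda>t. if t \<in> S then \<bar>t\<bar> powr (- a) else 0)"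
        by (auto simp: indicator_def fun_eq_iff)
      then show "((\<lambda>t. indicator S t * \<bar>t\<bar> powr (- a)) has_integral I) UNIV"
        using that(1) by (simp only: has_integral_restrict_UNIV)
    qed (use that(2) in auto)
    from this[OF h] this[OF h'] show ?thesis by simp
  qed
  also have "\<dots> < \<infinity>"
    by (simp add: less_top[symmetric])
  finally show ?thesis .
qed

text \<open>By Tonelli the weight has as its integral over a cube a power of a one-dimensional
  integral, finite for a < 1. The bound on f is asked only off the coordinate hyperplanes: these are
  null sets, and on them the weight is 0 by the convention for \<open>0 powr _\<close>.\<close>

lemma product_weight_integral_bound:
  fixes a :: real
  assumes "a < 1"
  obtains K where "K > 0"
    "\<And>f C. 0 \<le> C \<Longrightarrow>
      (\<And>x::real^'n::finite. norm x < 1/2 \<Longrightarrow> (\<And>i. x $ i \<noteq> 0) \<Longrightarrow> f x \<le> C * (\<Prod>i\<in>UNIV. \<bar>x $ i\<bar> powr (- a))) \<Longrightarrow>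
      (LINT x|lebesgue_on (ball 0 (1/2)). f x) \<le> C * K"
proof -
  define w where "w = (\<lambda>x::real^'n. \<Prod>b\<in>Basis. indicator {-1..1} (x \<bullet> b) * \<bar>x \<bullet> b\<bar> powr (- a))"
  have w0: "w x \<ge> 0" for x by (auto simp: w_def intro!: prod_nonneg)
  have [measurable]: "w \<in> borel_measurable borel" unfolding w_def by measurable
  have "(\<integral>\<^sup>+x. ennreal (w x) \<partial>lborel) =
      (\<integral>\<^sup>+x. (\<Prod>b\<in>Basis. ennreal (indicator {-1..1} (x \<bullet> b) * \<bar>x \<bullet> b\<bar> powr (- a))) \<partial>(lborel :: (real^'n) measure))"
    by (simp add: w_def prod_ennreal)
  also have "\<dots> = (\<Prod>b\<in>(Basis :: (real^'n) set). \<integral>\<^sup>+t. ennreal (indicator {-1..1} t * \<bar>t\<bar> powr (- a)) \<partial>lborel)"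
    by (rule nn_integral_lborel_prod[where f = "\<lambda>b t. ennreal (indicator {-1..1} t * \<bar>t\<bar> powr (- a))"]) auto
  also have "\<dots> < \<infinity>"
    using nn_integral_abs_powr_finite[OF assms]
    by (simp add: less_top[symmetric] power_eq_top_ennreal)
  finally have "integrable lborel w"
    using w0 by (intro integrableI_nonneg) auto
  then have w: "integrable lebesgue w"
    by (subst integrable_completion) auto
  \<comment> \<open>The summand 1 gives K > 0 from the nonnegativity of w alone.\<close>
  define K where "K = (LINT x|lebesgue. w x) + 1"
  have K: "K > 0"
    using w0 by (auto simp: K_def intro!: add_nonneg_pos integral_nonneg_AE)
  show ?thesis
  proof
    fix f :: "real^'n \<Rightarrow> real" and C :: real
    assume C: "0 \<le> C" and f: "\<And>x. norm x < 1/2 \<Longrightarrow> (\<And>i. x $ i \<noteq> 0) \<Longrightarrow> f x \<le> C * (\<Prod>i\<in>UNIV. \<bar>x $ i\<bar> powr (- a))"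
    have "AE x in lebesgue. x \<notin> {x::real^'n. x $ i = 0}" for i
    proof -
      have "negligible {x::real^'n. axis i 1 \<bullet> x = 0}"
        by (rule negligible_hyperplane) (simp add: axis_eq_0_iff)
      then have "{x::real^'n. x $ i = 0} \<in> null_sets lebesgue"
        by (simp add: negligible_iff_null_sets inner_axis' )
      then show ?thesis by (rule AE_not_in)
    qed
    then have ae: "AE x in lebesgue. \<forall>i. (x::real^'n) $ i \<noteq> 0"
      by (simp add: AE_all_countable)
    have "(LINT x|lebesgue_on (ball 0 (1/2)). f x) = (LINT x|lebesgue. indicator (ball 0 (1/2)) x *\<^sub>R f x)"
      by (intro integral_restrict_space) auto
    also have "\<dots> \<le> (LINT x|lebesgue. C * w x)"
    proof (rule integral_mono_AE')
      show "integrable lebesgue (\<lambda>x. C * w x)" using w by simp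
      show "AE x in lebesgue. indicator (ball 0 (1/2)) x *\<^sub>R f x \<le> C * w x"
        using ae
      proof eventually_elim
        case (elim x)
        show ?case
        proof (cases "x \<in> ball 0 (1/2)")
          case True
          then have "\<bar>x $ i\<bar> \<le> 1" for i
            using component_le_norm_cart[of x i] by simp
          then have "w x = (\<Prod>i\<in>UNIV. \<bar>x $ i\<bar> powr (- a))"
          proof -
            have B: "Basis = range (\<lambda>i. axis i 1 :: real^'n)"
              by (auto simp: Basis_vec_def)
            have "inj (\<lambda>i. axis i 1 :: real^'n)"
              by (auto simp: inj_on_def axis_eq_axis)
            then have "w x = (\<Prod>i\<in>UNIV. indicator {-1..1} (x $ i) * \<bar>x $ i\<bar> powr (- a))"
              unfolding w_def B by (subst prod.reindex) (simp_all add: inner_axis)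
            with \<open>\<And>i. \<bar>x $ i\<bar> \<le> 1\<close> show ?thesis
              by (simp add: indicator_def abs_le_iff)
          qed
          then show ?thesis using f[of x] True elim by simp
        qed (use C w0 in simp)
      qed
    qed (use C w0 in simp)
    also have "\<dots> \<le> C * K"
      using C by (simp add: K_def mult_left_mono)
    finally show "(LINT x|lebesgue_on (ball 0 (1/2)). f x) \<le> C * K" .
  qed (rule K)
qed


section \<open>The profile of the level sets\<close>

text \<open>The value that comes out of \<open>PP_QQ_bound\<close>. The 14 is 1 + 6 + 7, from the
  largest coefficient polynomial M^3 + 6 M^2 + 7 M; 256 is the fourth power of the 4 in
  \<open>loss\<close>; the two brackets collect the bounds for \<open>JJ\<close> and
  \<open>JJ1\<close> in |PP| + 2 |PP1|. It is essential that the smoothing width d does not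
  occur.\<close>

definition drift_const :: "real \<Rightarrow> nat \<Rightarrow> real" where
  "drift_const M n = (let c = 14 * M ^ 3 in
     256 * ((real n + 3 + 5 * c) * (1 + 2 * c) + 2 * (10 * c + 11 * c\<^sup>2)))"

text \<open>The parameter d is the width of the smoothing and will be tied to \<epsilon>, so
  quantitative bounds must not depend on it. The bound 16 gives 8/M \<le> 1/2, which lets the
  integral along a level set converge even for n = 3.\<close>

locale profile =
  fixes M d :: real and n :: nat
  assumes M: "M \<ge> 16" and d: "0 < d" "d \<le> 1" and n: "n \<ge> 3"
begin

text \<open>The argument of these functions is \<open>m = h\<^sup>2\<close>; a trailing digit counts derivatives in \<open>m\<close>.\<close>

definition rad :: "real \<Rightarrow> real" where
  "rad m = sqrt ((m - 1/4)\<^sup>2 + d\<^sup>2)"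

definition zeta :: "real \<Rightarrow> real" where
  "zeta m = (m - 1/4 + rad m) powr M"

definition zeta1 :: "real \<Rightarrow> real" where
  "zeta1 m = M * zeta m / rad m"

definition zeta2 :: "real \<Rightarrow> real" where
  "zeta2 m = M * zeta m * (M - (m - 1/4) / rad m) / (rad m)\<^sup>2"

definition zeta3 :: "real \<Rightarrow> real" where
  "zeta3 m = M * zeta m * (M\<^sup>2 - 3 * M * ((m - 1/4) / rad m) - 1 + 3 * ((m - 1/4) / rad m)\<^sup>2) / (rad m) ^ 3"

text \<open>The derivative of m * \<open>zeta m\<close>. Consequently \<open>WW s\<close> is the
  m-derivative of m * \<open>DD s m\<close>, and the latter is z^2 on the level set.\<close>

definition omega :: "real \<Rightarrow> real" where "omega m = zeta m + m * zeta1 m"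
definition omega1 :: "real \<Rightarrow> real" where "omega1 m = 2 * zeta1 m + m * zeta2 m"
definition omega2 :: "real \<Rightarrow> real" where "omega2 m = 3 * zeta2 m + m * zeta3 m"

lemma rad_pos: "rad m > 0"
  using d by (simp add: rad_def add_nonneg_pos)

lemma rad_gt: "\<bar>m - 1/4\<bar> < rad m"
  using d by (simp add: rad_def real_less_rsqrt)

lemma base_pos: "m - 1/4 + rad m > 0"
  using rad_gt[of m] by linarith

lemma zeta_pos: "zeta m > 0"
  using base_pos[of m] by (simp add: zeta_def)

lemma zeta1_pos: "zeta1 m > 0"
  using M zeta_pos[of m] rad_pos[of m] by (simp add: zeta1_def)

lemma omega_ge_zeta: "m \<ge> 0 \<Longrightarrow> omega m \<ge> zeta m"
  using zeta1_pos[of m] by (simp add: omega_def)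

lemma omega_pos: "m \<ge> 0 \<Longrightarrow> omega m > 0"
  using omega_ge_zeta[of m] zeta_pos[of m] by linarith

lemma rad_deriv: "(rad has_real_derivative (m - 1/4) / rad m) (at m)"
proof -
  have "(m - 1/4)\<^sup>2 + d\<^sup>2 > 0"
    using d by (simp add: add_nonneg_pos)
  then have "((\<lambda>m. sqrt ((m - 1/4)\<^sup>2 + d\<^sup>2)) has_real_derivative (m - 1/4) / rad m) (at m)"
    by (auto intro!: derivative_eq_intros simp: rad_def field_simps)
  then show ?thesis by (simp add: rad_def[abs_def])
qed

text \<open>The base y = m - 1/4 + \<open>rad m\<close> is a smooth positive substitute for twice
  the positive part of m - 1/4 and satisfies y' = y / \<open>rad m\<close>. So every derivative of
  \<open>zeta\<close> is \<open>zeta\<close> times powers of 1 / \<open>rad m\<close> and of the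
  bounded ratio (m - 1/4) / \<open>rad m\<close>.\<close>

lemma zeta_deriv: "(zeta has_real_derivative zeta1 m) (at m)"
proof -
  let ?y = "\<lambda>m. m - 1/4 + rad m"
  have "(?y has_real_derivative ?y m / rad m) (at m)"
    using rad_pos[of m] by (auto intro!: derivative_eq_intros rad_deriv simp: field_simps)
  then have "((\<lambda>m. ?y m powr M) has_real_derivative M * ?y m powr (M - 1) * (?y m / rad m)) (at m)"
    using DERIV_fun_powr[of ?y "?y m / rad m" m M] base_pos[of m] by simp
  moreover have "M * ?y m powr (M - 1) * (?y m / rad m) = zeta1 m"
    using base_pos[of m] by (simp add: zeta1_def zeta_def powr_diff)
  ultimately show ?thesis by (simp add: zeta_def[abs_def])
qed

lemma inverse_rad_deriv:
  "((\<lambda>m. inverse (rad m)) has_real_derivative - ((m - 1/4) * inverse (rad m) ^ 3)) (at m)"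
  using rad_pos[of m]
  by (auto intro!: derivative_eq_intros rad_deriv simp: field_simps power3_eq_cube)

lemma zeta1_deriv: "(zeta1 has_real_derivative zeta2 m) (at m)"
proof -
  have "((\<lambda>m. M * zeta m * inverse (rad m)) has_real_derivative
      M * zeta1 m * inverse (rad m) + - ((m - 1/4) * inverse (rad m) ^ 3) * (M * zeta m)) (at m)"
    by (intro DERIV_mult DERIV_cmult zeta_deriv inverse_rad_deriv)
  moreover have "M * zeta1 m * inverse (rad m) + - ((m - 1/4) * inverse (rad m) ^ 3) * (M * zeta m) = zeta2 m"
  proof -
    \<comment> \<open>With q for the inverse of \<open>rad m\<close>, the claim turns into a
      polynomial identity; the same device is used for the later derivatives.\<close>
    define k q z where "k = m - 1/4" and "q = inverse (rad m)" and "z = zeta m"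
    have "M * (M * z * q) * q + - (k * q ^ 3) * (M * z) = M * z * (M - k * q) * q\<^sup>2"
      by (simp add: algebra_simps power2_eq_square power3_eq_cube)
    then show ?thesis
      unfolding zeta2_def zeta1_def
      by (simp only: k_def[symmetric] z_def[symmetric] divide_inverse[of _ "rad m"]
          divide_inverse[of _ "rad m ^ _"] power_inverse[symmetric] q_def[symmetric])
  qed
  ultimately show ?thesis by (simp add: zeta1_def[abs_def] divide_inverse[of _ "rad _"])
qed

lemma zeta2_deriv: "(zeta2 has_real_derivative zeta3 m) (at m)"
proof -
  let ?q = "\<lambda>m. inverse (rad m)"
  have "((\<lambda>m. M * zeta m * ((M - (m - 1/4) * ?q m) * ?q m ^ 2)) has_real_derivative
      M * zeta1 m * ((M - (m - 1/4) * ?q m) * ?q m ^ 2) +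
      ((0 - ((1 - 0) * ?q m + - ((m - 1/4) * ?q m ^ 3) * (m - 1/4))) * ?q m ^ 2 +
       real 2 * (- ((m - 1/4) * ?q m ^ 3) * ?q m ^ (2 - Suc 0)) * (M - (m - 1/4) * ?q m)) * (M * zeta m)) (at m)"
    by (intro DERIV_mult DERIV_cmult DERIV_diff DERIV_const DERIV_ident DERIV_power zeta_deriv inverse_rad_deriv)
  moreover have "M * zeta1 m * ((M - (m - 1/4) * ?q m) * ?q m ^ 2) +
      ((0 - ((1 - 0) * ?q m + - ((m - 1/4) * ?q m ^ 3) * (m - 1/4))) * ?q m ^ 2 +
       real 2 * (- ((m - 1/4) * ?q m ^ 3) * ?q m ^ (2 - Suc 0)) * (M - (m - 1/4) * ?q m)) * (M * zeta m) = zeta3 m"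
  proof -
    define k q z where "k = m - 1/4" and "q = inverse (rad m)" and "z = zeta m"
    have "M * (M * z * q) * ((M - k * q) * q\<^sup>2) +
        ((0 - ((1 - 0) * q + - (k * q ^ 3) * k)) * q\<^sup>2 + 2 * (- (k * q ^ 3) * q) * (M - k * q)) * (M * z) =
      M * z * (M\<^sup>2 - 3 * M * (k * q) - 1 + 3 * (k * q)\<^sup>2) * q ^ 3"
      by (simp add: algebra_simps power2_eq_square power3_eq_cube)
    then show ?thesis
      unfolding zeta3_def zeta1_def
      by (simp only: k_def[symmetric] z_def[symmetric] divide_inverse[of _ "rad m"]
          divide_inverse[of _ "rad m ^ _"] power_inverse[symmetric] q_def[symmetric]) simp
  qed
  ultimately show ?thesis
    by (simp add: zeta2_def[abs_def] divide_inverse[of _ "rad _"] divide_inverse[of _ "(rad _)\<^sup>2"]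
        power_inverse mult.assoc)
qed

lemma omega_deriv: "(omega has_real_derivative omega1 m) (at m)"
proof -
  have "((\<lambda>m. zeta m + m * zeta1 m) has_real_derivative omega1 m) (at m)"
    by (auto intro!: derivative_eq_intros zeta_deriv zeta1_deriv simp: omega1_def)
  then show ?thesis by (simp add: omega_def[abs_def])
qed

lemma omega1_deriv: "(omega1 has_real_derivative omega2 m) (at m)"
proof -
  have "((\<lambda>m. 2 * zeta1 m + m * zeta2 m) has_real_derivative omega2 m) (at m)"
    by (auto intro!: derivative_eq_intros zeta1_deriv zeta2_deriv simp: omega2_def)
  then show ?thesis by (simp add: omega1_def[abs_def])
qed

text \<open>Here \<open>s = \<rho>\<^sup>2\<close>. In these coordinates \<open>z = h * sqrt (DD s m)\<close> has
  \<open>h\<close>-derivative \<open>WW s m / sqrt (DD s m)\<close>, and \<open>h * PP s m\<close> is the quotient of \<open>\<Delta>u\<close> by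
  \<open>\<partial>u/\<partial>z\<close>, with \<open>h\<close>-derivative \<open>QQ s m\<close>.\<close>

definition DD :: "real \<Rightarrow> real \<Rightarrow> real" where "DD s m = s + zeta m"
definition WW :: "real \<Rightarrow> real \<Rightarrow> real" where "WW s m = s + omega m"

definition JJ :: "real \<Rightarrow> real \<Rightarrow> real" where
  "JJ s m = 3 * s / WW s m + zeta1 m / WW s m - (real n - 1)
     - 2 * (m * s + DD s m) * omega1 m / (WW s m)\<^sup>2"

definition JJ1 :: "real \<Rightarrow> real \<Rightarrow> real" where
  "JJ1 s m = zeta2 m / WW s m - (5 * s + 3 * zeta1 m) * omega1 m / (WW s m)\<^sup>2
     - 2 * (m * s + DD s m) * omega2 m / (WW s m)\<^sup>2
     + 4 * (m * s + DD s m) * (omega1 m)\<^sup>2 / (WW s m) ^ 3"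

definition PP :: "real \<Rightarrow> real \<Rightarrow> real" where "PP s m = JJ s m / sqrt (DD s m)"

definition PP1 :: "real \<Rightarrow> real \<Rightarrow> real" where
  "PP1 s m = (JJ1 s m - JJ s m * zeta1 m / (2 * DD s m)) / sqrt (DD s m)"

definition QQ :: "real \<Rightarrow> real \<Rightarrow> real" where "QQ s m = PP s m + 2 * m * PP1 s m"

lemma DD_pos: "s \<ge> 0 \<Longrightarrow> DD s m > 0"
  using zeta_pos[of m] by (simp add: DD_def)

lemma WW_ge_DD: "m \<ge> 0 \<Longrightarrow> WW s m \<ge> DD s m"
  using omega_ge_zeta[of m] by (simp add: DD_def WW_def)

lemma WW_pos: "s \<ge> 0 \<Longrightarrow> m \<ge> 0 \<Longrightarrow> WW s m > 0"
  using DD_pos[of s m] WW_ge_DD[of m s] by linarith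

lemma JJ_deriv:
  assumes "s \<ge> 0" "m \<ge> 0"
  shows "(JJ s has_real_derivative JJ1 s m) (at m)"
proof -
  let ?i = "\<lambda>m. inverse (WW s m)"
  have i: "(?i has_real_derivative - (omega1 m * ?i m ^ 2)) (at m)"
    unfolding WW_def using WW_pos[OF assms]
    by (auto intro!: derivative_eq_intros omega_deriv simp: WW_def field_simps power2_eq_square)
  have D: "((\<lambda>m. m * s + DD s m) has_real_derivative s + zeta1 m) (at m)"
    unfolding DD_def by (auto intro!: derivative_eq_intros zeta_deriv)
  have "((\<lambda>m. 3 * s * ?i m + zeta1 m * ?i m - (real n - 1) - 2 * ((m * s + DD s m) * omega1 m * ?i m ^ 2))
    has_real_derivative
      3 * s * - (omega1 m * ?i m ^ 2) + (zeta2 m * ?i m + - (omega1 m * ?i m ^ 2) * zeta1 m) - 0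
      - 2 * (((s + zeta1 m) * omega1 m + omega2 m * (m * s + DD s m)) * ?i m ^ 2 +
        real 2 * (- (omega1 m * ?i m ^ 2) * ?i m ^ (2 - Suc 0)) * ((m * s + DD s m) * omega1 m))) (at m)"
    by (intro DERIV_mult DERIV_cmult DERIV_add DERIV_diff DERIV_const DERIV_power i D omega1_deriv zeta1_deriv)
  moreover have "3 * s * - (omega1 m * ?i m ^ 2) + (zeta2 m * ?i m + - (omega1 m * ?i m ^ 2) * zeta1 m) - 0
      - 2 * (((s + zeta1 m) * omega1 m + omega2 m * (m * s + DD s m)) * ?i m ^ 2 +
        real 2 * (- (omega1 m * ?i m ^ 2) * ?i m ^ (2 - Suc 0)) * ((m * s + DD s m) * omega1 m)) = JJ1 s m"
  proof -
    define i T a b c e where "i = ?i m" and "T = m * s + DD s m" and "a = zeta1 m"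
      and "b = zeta2 m" and "c = omega1 m" and "e = omega2 m"
    have "3 * s * - (c * i\<^sup>2) + (b * i + - (c * i\<^sup>2) * a) - 0
        - 2 * (((s + a) * c + e * T) * i\<^sup>2 + 2 * (- (c * i\<^sup>2) * i) * (T * c)) =
      b * i - (5 * s + 3 * a) * c * i\<^sup>2 - 2 * T * e * i\<^sup>2 + 4 * T * c\<^sup>2 * i ^ 3"
      by (simp add: algebra_simps power2_eq_square power3_eq_cube)
    then show ?thesis
      unfolding JJ1_def
      by (simp only: T_def[symmetric] a_def[symmetric] b_def[symmetric] c_def[symmetric] e_def[symmetric]
          divide_inverse power_inverse[symmetric] i_def[symmetric]) simp
  qed
  ultimately show ?thesis
    by (simp add: JJ_def[abs_def] divide_inverse power_inverse mult.assoc del: distrib_left_numeral)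
qed

lemma PP_deriv:
  assumes "s \<ge> 0" "m \<ge> 0"
  shows "(PP s has_real_derivative PP1 s m) (at m)"
proof -
  have D: "DD s m > 0" using DD_pos[OF assms(1)] .
  have "((\<lambda>m. s + zeta m) has_real_derivative zeta1 m) (at m)"
    by (auto intro!: derivative_eq_intros zeta_deriv)
  then have "(DD s has_real_derivative zeta1 m) (at m)"
    by (simp add: DD_def[abs_def])
  from DERIV_chain2[OF DERIV_real_sqrt[OF D] this]
  have "((\<lambda>m. sqrt (DD s m)) has_real_derivative inverse (sqrt (DD s m)) / 2 * zeta1 m) (at m)" .
  from DERIV_divide[OF JJ_deriv[OF assms] this] D
  have "((\<lambda>m. JJ s m / sqrt (DD s m)) has_real_derivative
      (JJ1 s m * sqrt (DD s m) - JJ s m * (inverse (sqrt (DD s m)) / 2 * zeta1 m)) / (sqrt (DD s m) * sqrt (DD s m))) (at m)"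
    by simp
  moreover have "(JJ1 s m * sqrt (DD s m) - JJ s m * (inverse (sqrt (DD s m)) / 2 * zeta1 m)) / (sqrt (DD s m) * sqrt (DD s m)) = PP1 s m"
  proof -
    define q where "q = sqrt (DD s m)"
    have q: "q > 0" "DD s m = q * q" using D by (simp_all add: q_def)
    show ?thesis
      unfolding PP1_def q_def[symmetric] q(2)
      using q(1) by (simp add: field_simps)
  qed
  ultimately show ?thesis by (simp add: PP_def[abs_def])
qed

text \<open>An upper bound for the factor lost with every derivative in \<open>m\<close>.\<close>

definition loss :: "real \<Rightarrow> real \<Rightarrow> real" where "loss s m = 4 * DD s m powr (- (1 / M))"

section \<open>Profile estimates with constants independent of d\<close>

context
  fixes s m :: real
  assumes s: "0 \<le> s" "s \<le> 1" and m: "0 \<le> m" "m \<le> 1"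
begin

lemma rad_le: "rad m \<le> 5/4"
proof -
  have "\<bar>m - 1/4\<bar> \<le> 3/4" using m by (auto simp: abs_if)
  then have "(m - 1/4)\<^sup>2 \<le> (3/4)\<^sup>2" by (intro power2_le_iff_abs_le[THEN iffD2]) auto
  moreover have "d\<^sup>2 \<le> 1" using d by (simp add: power_le_one)
  ultimately have "(m - 1/4)\<^sup>2 + d\<^sup>2 \<le> (5/4)\<^sup>2" by (simp add: power2_eq_square)
  then show ?thesis unfolding rad_def by (intro real_le_lsqrt) auto
qed

text \<open>This bound matches the factor 4 in \<open>loss\<close>: it makes \<open>loss\<close> at
  least 1, so that lower powers of it can be absorbed into higher ones.\<close>

lemma DD_le: "DD s m \<le> 4 powr M"
proof -
  have "m - 1/4 + rad m \<le> 2" using rad_le m by simp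
  then have "zeta m \<le> 2 powr M"
    unfolding zeta_def using base_pos[of m] M by (intro powr_mono2) auto
  moreover have two: "(2::real) \<le> 2 powr M" using M powr_mono[of 1 M 2] by simp
  moreover have "(4::real) powr M = 2 powr M * 2 powr M"
    using powr_mult[of 2 2 M] by simp
  moreover have "2 * 2 powr M \<le> 2 powr M * (2::real) powr M"
    using two by (intro mult_right_mono) auto
  ultimately show ?thesis using s unfolding DD_def by linarith
qed

lemma loss_ge_1: "loss s m \<ge> 1"
proof -
  have D: "DD s m > 0" by (rule DD_pos[OF s(1)])
  have "DD s m powr (1 / M) \<le> (4 powr M) powr (1 / M)"
    using D DD_le M by (intro powr_mono2) auto
  also have "\<dots> = 4" using M by (simp add: powr_powr)
  finally show ?thesis
    using D by (simp add: loss_def powr_minus field_simps)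
qed

text \<open>The central estimate. With y the M-th root of \<open>zeta m\<close> one has 1 /
  \<open>rad m\<close> \<le> 2 / y, which may be huge when \<open>zeta m\<close> is tiny. But then
  the ratio v of the M-th root of D to y is huge too, and \<open>zeta m\<close> * v^j \<le>
  \<open>zeta m\<close> * v^M = D since v \<ge> 1 and j \<le> M. So each division by
  \<open>rad m\<close> costs one factor \<open>loss\<close>.\<close>

lemma zeta_le:
  assumes "j \<le> 3"
  shows "zeta m / rad m ^ j \<le> loss s m ^ j * DD s m"
proof -
  define y where "y = m - 1/4 + rad m"
  have y: "y > 0" "y \<le> 2 * rad m" using base_pos[of m] rad_gt[of m] by (auto simp: y_def)
  have D: "DD s m > 0" by (rule DD_pos[OF s(1)])
  define v where "v = DD s m powr (1 / M) / y"
  have yM: "zeta m = y powr M" by (simp add: zeta_def y_def)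
  have yz: "zeta m powr (1 / M) = y" using y M by (simp add: yM powr_powr)
  have "zeta m powr (1 / M) \<le> DD s m powr (1 / M)"
    using zeta_pos[of m] s M by (intro powr_mono2) (auto simp: DD_def)
  then have v: "v \<ge> 1" using y by (simp add: v_def yz)
  have "v powr M = DD s m / zeta m"
    using y D M by (simp add: v_def yM powr_divide powr_powr)
  moreover have "v ^ j \<le> v powr M"
    using v assms M powr_mono[of "real j" M v] by (simp add: powr_realpow)
  ultimately have vj: "zeta m * v ^ j \<le> DD s m"
    using zeta_pos[of m] mult_left_mono[of "v ^ j" "v powr M" "zeta m"] by simp
  have "1 / rad m \<le> 2 / y" using y rad_pos[of m] by (simp add: field_simps)
  also have "\<dots> \<le> loss s m * v"
    using y D by (simp add: loss_def v_def powr_minus field_simps)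
  finally have "(1 / rad m) ^ j \<le> (loss s m * v) ^ j"
    using rad_pos[of m] by (intro power_mono) auto
  then have "zeta m * (1 / rad m) ^ j \<le> zeta m * (loss s m * v) ^ j"
    using zeta_pos[of m] by (intro mult_left_mono) auto
  also have "\<dots> = loss s m ^ j * (zeta m * v ^ j)" by (simp add: power_mult_distrib)
  also have "\<dots> \<le> loss s m ^ j * DD s m"
    using vj loss_ge_1 by (intro mult_left_mono) auto
  finally show ?thesis by (simp add: power_divide)
qed

lemma rel_le_1: "\<bar>(m - 1/4) / rad m\<bar> \<le> 1"
  using rad_gt[of m] rad_pos[of m] by (simp add: abs_divide)

lemma zeta1_le: "zeta1 m \<le> M * loss s m * DD s m"
  using mult_left_mono[OF zeta_le[of 1], of M] M by (simp add: zeta1_def)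

lemma zeta2_le: "\<bar>zeta2 m\<bar> \<le> (M\<^sup>2 + M) * (loss s m)\<^sup>2 * DD s m"
proof -
  have "\<bar>M - (m - 1/4) / rad m\<bar> \<le> M + 1" using rel_le_1 M by linarith
  then have "M * (zeta m / (rad m)\<^sup>2) * \<bar>M - (m - 1/4) / rad m\<bar> \<le> M * ((loss s m)\<^sup>2 * DD s m) * (M + 1)"
    using zeta_le[of 2] M zeta_pos[of m] DD_pos[OF s(1), of m] by (intro mult_mono mult_left_mono) auto
  moreover have "\<bar>zeta2 m\<bar> = M * (zeta m / (rad m)\<^sup>2) * \<bar>M - (m - 1/4) / rad m\<bar>"
    using M zeta_pos[of m] by (simp add: zeta2_def abs_mult)
  ultimately show ?thesis by (simp add: power2_eq_square algebra_simps)
qed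

lemma zeta3_le: "\<bar>zeta3 m\<bar> \<le> (M ^ 3 + 3 * M\<^sup>2 + 4 * M) * loss s m ^ 3 * DD s m"
proof -
  define q where "q = (m - 1/4) / rad m"
  have "\<bar>q\<bar> \<le> 1" using rel_le_1 by (simp add: q_def)
  then have q: "q\<^sup>2 \<le> 1" "\<bar>M * q\<bar> \<le> M" using M
    by (auto simp: abs_square_le_1 abs_mult mult_left_le)
  have "\<bar>M\<^sup>2 - 3 * M * q - 1 + 3 * q\<^sup>2\<bar> \<le> \<bar>M\<^sup>2\<bar> + 3 * \<bar>M * q\<bar> + 1 + 3 * \<bar>q\<^sup>2\<bar>" by linarith
  with q have "\<bar>M\<^sup>2 - 3 * M * q - 1 + 3 * q\<^sup>2\<bar> \<le> M\<^sup>2 + 3 * M + 4" by simp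
  then have "M * (zeta m / rad m ^ 3) * \<bar>M\<^sup>2 - 3 * M * q - 1 + 3 * q\<^sup>2\<bar> \<le> M * (loss s m ^ 3 * DD s m) * (M\<^sup>2 + 3 * M + 4)"
    using zeta_le[of 3] M zeta_pos[of m] DD_pos[OF s(1), of m] rad_pos[of m] loss_ge_1 by (intro mult_mono mult_left_mono) auto
  moreover have "\<bar>zeta3 m\<bar> = M * (zeta m / rad m ^ 3) * \<bar>M\<^sup>2 - 3 * M * q - 1 + 3 * q\<^sup>2\<bar>"
    using M zeta_pos[of m] rad_pos[of m] by (simp add: zeta3_def q_def abs_mult)
  ultimately show ?thesis by (simp add: power2_eq_square power3_eq_cube algebra_simps)
qed

text \<open>Since W \<ge> D, dividing by W cancels the factor D in the bounds for the derivatives of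
  \<open>zeta\<close> and leaves a power of E = \<open>loss s m\<close> counting derivatives. The
  worst term is the square of \<open>omega1\<close> in \<open>JJ1\<close>, two factors of size E^2;
  this is the origin of 4/M.\<close>

lemma PP_QQ_bound:
  "\<bar>PP s m\<bar> \<le> drift_const M n * DD s m powr (- (1/2 + 4 / M))"
  "\<bar>QQ s m\<bar> \<le> drift_const M n * DD s m powr (- (1/2 + 4 / M))"
proof -
  define c where "c = 14 * M ^ 3"
  define E where "E = loss s m"
  define W where "W = WW s m"
  define D where "D = DD s m"
  have E: "E \<ge> 1" using loss_ge_1 by (simp add: E_def)
  have D: "D > 0" using DD_pos[OF s(1)] by (simp add: D_def)
  have W: "W \<ge> D" "W > 0" using WW_ge_DD[OF m(1)] WW_pos[OF s(1) m(1)] by (auto simp: W_def D_def)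
  have M1: "1 \<le> M" "M \<le> M\<^sup>2" "M\<^sup>2 \<le> M ^ 3" "M \<le> M ^ 3"
    using M power_increasing[of 1 2 M] power_increasing[of 2 3 M] power_increasing[of 1 3 M] by auto
  have c: "c \<ge> 1" "M \<le> c" "M\<^sup>2 + M \<le> c" "M\<^sup>2 + 3 * M \<le> c" "M ^ 3 + 6 * M\<^sup>2 + 7 * M \<le> c"
    using M1 by (auto simp: c_def)
  have E1: "E \<le> E\<^sup>2" "E\<^sup>2 \<le> E ^ 3" "E ^ 3 \<le> E ^ 4" "1 \<le> E\<^sup>2" "E\<^sup>2 \<le> E ^ 4" "1 \<le> E ^ 4"
    using E power_increasing[of 1 2 E] power_increasing[of 2 3 E] power_increasing[of 3 4 E]
      power_increasing[of 2 4 E] one_le_power[of E 2] one_le_power[of E 4] by auto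
  have scale: "\<bar>f\<bar> / W \<le> c * E ^ j" if "\<bar>f\<bar> \<le> C * E ^ j * D" "C \<le> c" for f C j
  proof -
    have "C * E ^ j * D \<le> c * E ^ j * W"
      using that(2) W(1) c E D by (intro mult_mono) auto
    with that(1) have "\<bar>f\<bar> \<le> c * E ^ j * W" by simp
    then show ?thesis using W by (simp add: field_simps)
  qed
  define a where "a = zeta1 m / W"
  define b where "b = zeta2 m / W"
  define a1 where "a1 = omega1 m / W"
  define a2 where "a2 = omega2 m / W"
  define x where "x = s / W"
  define T where "T = (m * s + D) / W"
  have z1: "\<bar>zeta1 m\<bar> \<le> M * E * D"
    using zeta1_le zeta1_pos[of m] by (simp add: E_def D_def)
  have z2: "\<bar>zeta2 m\<bar> \<le> (M\<^sup>2 + M) * E\<^sup>2 * D" using zeta2_le by (simp add: E_def D_def)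
  have z3: "\<bar>zeta3 m\<bar> \<le> (M ^ 3 + 3 * M\<^sup>2 + 4 * M) * E ^ 3 * D" using zeta3_le by (simp add: E_def D_def)
  have ma: "\<bar>a\<bar> \<le> c * E" using scale[of "zeta1 m" M 1] z1 c by (simp add: a_def abs_divide W less_imp_le)
  have mb: "\<bar>b\<bar> \<le> c * E\<^sup>2" using scale[of "zeta2 m" _ 2, OF z2] c W by (simp add: b_def abs_divide)
  have mz: "\<bar>m * f\<bar> \<le> \<bar>f\<bar>" for f
    using m mult_right_mono[of m 1 "\<bar>f\<bar>"] by (simp add: abs_mult)
  have "\<bar>omega1 m\<bar> \<le> (M\<^sup>2 + 3 * M) * E\<^sup>2 * D"
  proof -
    have "M * E * D \<le> M * E\<^sup>2 * D"
      using E1 M1 D by (intro mult_right_mono mult_left_mono) auto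
    with z1 have "\<bar>zeta1 m\<bar> \<le> M * E\<^sup>2 * D" by simp
    with z2 mz[of "zeta2 m"] have "\<bar>omega1 m\<bar> \<le> 2 * (M * E\<^sup>2 * D) + (M\<^sup>2 + M) * E\<^sup>2 * D"
      unfolding omega1_def by linarith
    then show ?thesis by (simp add: algebra_simps)
  qed
  from scale[of _ _ 2, OF this] have ma1: "\<bar>a1\<bar> \<le> c * E\<^sup>2" using c W by (simp add: a1_def abs_divide)
  have "\<bar>omega2 m\<bar> \<le> (M ^ 3 + 6 * M\<^sup>2 + 7 * M) * E ^ 3 * D"
  proof -
    have "(M\<^sup>2 + M) * E\<^sup>2 * D \<le> (M\<^sup>2 + M) * E ^ 3 * D"
      using E1 M1 D by (intro mult_right_mono mult_left_mono) auto
    with z2 have "\<bar>zeta2 m\<bar> \<le> (M\<^sup>2 + M) * E ^ 3 * D" by simp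
    with z3 mz[of "zeta3 m"] have "\<bar>omega2 m\<bar> \<le> 3 * ((M\<^sup>2 + M) * E ^ 3 * D) + (M ^ 3 + 3 * M\<^sup>2 + 4 * M) * E ^ 3 * D"
      unfolding omega2_def by linarith
    then show ?thesis by (simp add: algebra_simps)
  qed
  from scale[OF this] have ma2: "\<bar>a2\<bar> \<le> c * E ^ 3" using c W by (simp add: a2_def abs_divide)
  have x: "0 \<le> x" "x \<le> 1" using s W omega_pos[OF m(1)] by (auto simp: x_def W_def WW_def field_simps)
  have T: "0 \<le> T" "T \<le> 2"
  proof -
    have "m * s \<le> s" using mz[of s] s m by simp
    then have "m * s + D \<le> 2 * W" using W x by (simp add: x_def field_simps)
    then show "T \<le> 2" using W by (simp add: T_def field_simps)
    show "0 \<le> T" using m s D W by (simp add: T_def)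
  qed
  have J: "JJ s m = 3 * x + a - (real n - 1) - 2 * T * a1"
    by (simp add: JJ_def x_def a_def T_def a1_def W_def[symmetric] D_def[symmetric] power2_eq_square)
  have J1: "JJ1 s m = b - (5 * x + 3 * a) * a1 - 2 * T * a2 + 4 * T * a1\<^sup>2"
    using W by (simp add: JJ1_def x_def a_def b_def T_def a1_def a2_def W_def[symmetric] D_def[symmetric]
        power2_eq_square power3_eq_cube field_simps)
  have Ta1: "\<bar>T * a1\<bar> \<le> 2 * (c * E\<^sup>2)"
    unfolding abs_mult using T ma1 by (intro mult_mono) auto
  have Ta2: "\<bar>T * a2\<bar> \<le> 2 * (c * E ^ 3)"
    unfolding abs_mult using T ma2 by (intro mult_mono) auto
  have Ta11: "\<bar>T * a1\<^sup>2\<bar> \<le> 2 * (c\<^sup>2 * E ^ 4)"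
  proof -
    have "\<bar>a1\<bar>\<^sup>2 \<le> (c * E\<^sup>2)\<^sup>2" using ma1 by (intro power_mono) auto
    then have "a1\<^sup>2 \<le> c\<^sup>2 * E ^ 4" by (simp add: power_mult_distrib)
    then show ?thesis unfolding abs_mult using T by (intro mult_mono) auto
  qed
  have xa1: "\<bar>x * a1\<bar> \<le> 1 * (c * E\<^sup>2)"
    unfolding abs_mult using x ma1 by (intro mult_mono) auto
  have aa1: "\<bar>a * a1\<bar> \<le> c\<^sup>2 * E ^ 3"
  proof -
    have "\<bar>a * a1\<bar> \<le> (c * E) * (c * E\<^sup>2)"
      unfolding abs_mult using ma ma1 c E by (intro mult_mono) auto
    then show ?thesis by (simp add: power2_eq_square power3_eq_cube algebra_simps)
  qed
  have cE: "c * E \<le> c * E\<^sup>2" "c * E\<^sup>2 \<le> c * E ^ 4" "c * E ^ 3 \<le> c * E ^ 4" "c\<^sup>2 * E ^ 3 \<le> c\<^sup>2 * E ^ 4"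
    using c E1 by (auto intro!: mult_left_mono)
  have nE: "real n + 3 \<le> (real n + 3) * E\<^sup>2"
    using mult_left_mono[OF E1(4), of "real n + 3"] by simp
  have JJb: "\<bar>JJ s m\<bar> \<le> (real n + 3 + 5 * c) * E\<^sup>2"
  proof -
    have "\<bar>JJ s m\<bar> \<le> real n + 3 + 5 * (c * E\<^sup>2)"
      unfolding J using x ma Ta1 cE n by (simp add: abs_le_iff)
    with nE show ?thesis by (simp add: algebra_simps)
  qed
  have JJ1b: "\<bar>JJ1 s m\<bar> \<le> (10 * c + 11 * c\<^sup>2) * E ^ 4"
  proof -
    have "JJ1 s m = b - 5 * (x * a1) - 3 * (a * a1) - 2 * (T * a2) + 4 * (T * a1\<^sup>2)"
      unfolding J1 by (simp add: algebra_simps)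
    then have "\<bar>JJ1 s m\<bar> \<le> 10 * (c * E ^ 4) + 11 * (c\<^sup>2 * E ^ 4)"
      using mb xa1 aa1 Ta2 Ta11 cE by (simp add: abs_le_iff)
    then show ?thesis by (simp add: algebra_simps)
  qed
  have z1D: "\<bar>JJ s m * zeta1 m / (2 * D)\<bar> \<le> (real n + 3 + 5 * c) * c * E ^ 4"
  proof -
    have "M * (E * D) \<le> c * (E * D)"
      using c(2) E D by (intro mult_right_mono) auto
    with z1 have "\<bar>zeta1 m\<bar> \<le> c * E * D" by (simp add: mult.assoc)
    then have "\<bar>zeta1 m\<bar> / (2 * D) \<le> c * E * D / (2 * D)"
      using D by (intro divide_right_mono) auto
    also have "\<dots> = c * E / 2" using D by simp
    also have "\<dots> \<le> c * E" using c E by simp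
    also have "\<dots> \<le> c * E\<^sup>2" by (rule cE)
    finally have "\<bar>zeta1 m / (2 * D)\<bar> \<le> c * E\<^sup>2"
      using D by (simp add: abs_divide)
    then have "\<bar>JJ s m\<bar> * \<bar>zeta1 m / (2 * D)\<bar> \<le> ((real n + 3 + 5 * c) * E\<^sup>2) * (c * E\<^sup>2)"
      using JJb c by (intro mult_mono) auto
    then show ?thesis by (simp add: abs_mult[symmetric] power2_eq_square power4_eq_xxxx algebra_simps)
  qed
  define C where "C = (real n + 3 + 5 * c) * (1 + 2 * c) + 2 * (10 * c + 11 * c\<^sup>2)"
  have sq: "sqrt D > 0" using D by simp
  have P: "\<bar>PP s m\<bar> * sqrt D \<le> (real n + 3 + 5 * c) * E ^ 4"
  proof -
    have "\<bar>PP s m\<bar> * sqrt D = \<bar>JJ s m\<bar>" using sq by (simp add: PP_def D_def[symmetric] abs_divide)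
    moreover have "(real n + 3 + 5 * c) * E\<^sup>2 \<le> (real n + 3 + 5 * c) * E ^ 4"
      using E1 c by (intro mult_left_mono) auto
    ultimately show ?thesis using JJb by simp
  qed
  have P1: "\<bar>PP1 s m\<bar> * sqrt D \<le> (10 * c + 11 * c\<^sup>2) * E ^ 4 + (real n + 3 + 5 * c) * c * E ^ 4"
  proof -
    have "\<bar>PP1 s m\<bar> * sqrt D = \<bar>JJ1 s m - JJ s m * zeta1 m / (2 * D)\<bar>"
      using sq by (simp add: PP1_def D_def[symmetric] abs_divide)
    with JJ1b z1D show ?thesis by linarith
  qed
  have Pb: "\<bar>PP s m\<bar> * sqrt D \<le> C * E ^ 4"
  proof -
    have "(real n + 3 + 5 * c) * E ^ 4 \<le> C * E ^ 4"
      using E1 c by (intro mult_right_mono) (auto simp: C_def algebra_simps)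
    with P show ?thesis by simp
  qed
  have Qb: "\<bar>QQ s m\<bar> * sqrt D \<le> C * E ^ 4"
  proof -
    have "\<bar>QQ s m\<bar> \<le> \<bar>PP s m\<bar> + 2 * \<bar>PP1 s m\<bar>"
      using mz[of "PP1 s m"] unfolding QQ_def by linarith
    then have "\<bar>QQ s m\<bar> * sqrt D \<le> (\<bar>PP s m\<bar> + 2 * \<bar>PP1 s m\<bar>) * sqrt D"
      using sq by (intro mult_right_mono) auto
    also have "\<dots> \<le> C * E ^ 4"
      using P P1 by (simp add: C_def algebra_simps)
    finally show ?thesis .
  qed
  have E4: "E ^ 4 / sqrt D = 256 * D powr (- (1/2 + 4 / M))"
  proof -
    have "E ^ 4 = 256 * D powr (- (4 / M))"
      using D by (simp add: E_def loss_def D_def[symmetric] power_mult_distrib powr_power)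
    moreover have "1 / sqrt D = D powr (- (1/2))"
      using D by (simp add: powr_half_sqrt powr_minus inverse_eq_divide)
    ultimately have "E ^ 4 * (1 / sqrt D) = 256 * (D powr (- (4 / M)) * D powr (- (1/2)))" by simp
    then show ?thesis by (simp add: powr_add[symmetric] add.commute)
  qed
  have fin: "\<bar>f\<bar> \<le> drift_const M n * DD s m powr (- (1/2 + 4 / M))" if "\<bar>f\<bar> * sqrt D \<le> C * E ^ 4" for f
  proof -
    have "\<bar>f\<bar> \<le> C * (E ^ 4 / sqrt D)" using that sq by (simp add: field_simps)
    also have "\<dots> = drift_const M n * DD s m powr (- (1/2 + 4 / M))"
      unfolding E4 by (simp add: drift_const_def Let_def C_def c_def D_def)
    finally show ?thesis .
  qed
  show "\<bar>PP s m\<bar> \<le> drift_const M n * DD s m powr (- (1/2 + 4 / M))"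
    "\<bar>QQ s m\<bar> \<le> drift_const M n * DD s m powr (- (1/2 + 4 / M))"
    using fin Pb Qb by blast+
qed

end

end


section \<open>The chain rule for \<open>QQ\<close> and implicit differentiation of the height
  equation\<close>

lemma real_differentiableI: "(f has_real_derivative f') (at x) \<Longrightarrow> f differentiable (at x)"
  by (auto simp: has_field_derivative_def differentiable_def)

context profile
begin

lemma zeta3_differentiable: "zeta3 differentiable (at m)"
proof -
  have "rad m \<noteq> 0" using rad_pos[of m] by simp
  moreover have "rad differentiable (at m)" "zeta differentiable (at m)"
    using rad_deriv zeta_deriv by (auto intro: real_differentiableI)
  ultimately have "(\<lambda>m. M * zeta m * (M\<^sup>2 - 3 * M * ((m - 1/4) / rad m) - 1 + 3 * ((m - 1/4) / rad m)\<^sup>2) / (rad m) ^ 3)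
      differentiable (at m)"
    by (intro differentiable_mult differentiable_divide differentiable_add differentiable_diff
        differentiable_power differentiable_const differentiable_ident) simp_all
  then show ?thesis by (simp add: zeta3_def[abs_def])
qed

text \<open>Joint differentiability suffices: the partial derivatives of \<open>QQ\<close> enter
  only through the chain rule and never have to be computed or estimated.\<close>

lemma QQ_differentiable:
  assumes "s \<ge> 0" "m \<ge> 0"
  shows "(\<lambda>p. QQ (fst p) (snd p)) differentiable (at (s, m))"
proof -
  have snd: "(\<lambda>p. f (snd p)) differentiable (at (s, m))" if "f differentiable (at m)" for f :: "real \<Rightarrow> real"
    using differentiable_chain_at[of snd "(s, m)" f] that
    by (simp add: bounded_linear_imp_differentiable bounded_linear_snd o_def)
  have z: "zeta differentiable (at m)" "zeta1 differentiable (at m)" "zeta2 differentiable (at m)"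
    "zeta3 differentiable (at m)"
    using zeta_deriv zeta1_deriv zeta2_deriv zeta3_differentiable by (auto intro: real_differentiableI)
  have id: "(\<lambda>p::real \<times> real. fst p) differentiable (at (s, m))" "(\<lambda>p::real \<times> real. snd p) differentiable (at (s, m))"
    by (simp_all add: bounded_linear_imp_differentiable bounded_linear_fst bounded_linear_snd)
  have D: "(\<lambda>p. DD (fst p) (snd p)) differentiable (at (s, m))"
    unfolding DD_def by (intro differentiable_add id snd z)
  have W: "(\<lambda>p. WW (fst p) (snd p)) differentiable (at (s, m))"
    unfolding WW_def omega_def by (intro differentiable_add differentiable_mult id snd z)
  have pos: "WW (fst (s, m)) (snd (s, m)) \<noteq> 0" "DD (fst (s, m)) (snd (s, m)) \<noteq> 0"
    "sqrt (DD (fst (s, m)) (snd (s, m))) \<noteq> 0"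
    using WW_pos[OF assms] DD_pos[OF assms(1), of m] by simp_all
  have "sqrt differentiable (at (DD s m))"
    by (rule real_differentiableI[OF DERIV_real_sqrt]) (rule DD_pos[OF assms(1)])
  then have sq: "(\<lambda>p. sqrt (DD (fst p) (snd p))) differentiable (at (s, m))"
    using differentiable_chain_at[OF D, of sqrt] by (simp add: o_def)
  have o: "(\<lambda>p. omega1 (snd p)) differentiable (at (s, m))" "(\<lambda>p. omega2 (snd p)) differentiable (at (s, m))"
    unfolding omega1_def omega2_def
    by (intro differentiable_add differentiable_mult id snd z differentiable_const)+
  have J: "(\<lambda>p. JJ (fst p) (snd p)) differentiable (at (s, m))"
    unfolding JJ_def
    by (intro differentiable_mult differentiable_divide differentiable_add differentiable_diff
        differentiable_power differentiable_const id D W o snd z) (use pos in simp_all)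
  have J1: "(\<lambda>p. JJ1 (fst p) (snd p)) differentiable (at (s, m))"
    unfolding JJ1_def
    by (intro differentiable_mult differentiable_divide differentiable_add differentiable_diff
        differentiable_power differentiable_const id D W o snd z) (use pos in simp_all)
  show ?thesis
    unfolding QQ_def PP_def PP1_def
    by (intro differentiable_mult differentiable_divide differentiable_add differentiable_diff
        differentiable_power differentiable_const id D W o J J1 sq snd z) (use pos in simp_all)
qed

definition QQs :: "real \<Rightarrow> real \<Rightarrow> real" where
  "QQs s m = frechet_derivative (\<lambda>p. QQ (fst p) (snd p)) (at (s, m)) (1, 0)"

definition QQm :: "real \<Rightarrow> real \<Rightarrow> real" where
  "QQm s m = frechet_derivative (\<lambda>p. QQ (fst p) (snd p)) (at (s, m)) (0, 1)"

lemma QQ_chain: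
  assumes "f t \<ge> 0" "g t \<ge> 0"
    and f: "(f has_real_derivative f') (at t)" and g: "(g has_real_derivative g') (at t)"
  shows "((\<lambda>t. QQ (f t) (g t)) has_real_derivative QQs (f t) (g t) * f' + QQm (f t) (g t) * g') (at t)"
proof -
  let ?q = "\<lambda>p. QQ (fst p) (snd p)"
  let ?L = "frechet_derivative ?q (at (f t, g t))"
  have L: "(?q has_derivative ?L) (at (f t, g t))"
    using QQ_differentiable[OF assms(1,2)] by (simp add: frechet_derivative_works)
  have "((\<lambda>t. (f t, g t)) has_derivative (\<lambda>u. (f' * u, g' * u))) (at t)"
    using f g by (intro has_derivative_Pair) (simp_all add: has_field_derivative_def)
  from has_derivative_compose[OF this L]
  have "((\<lambda>t. QQ (f t) (g t)) has_derivative (\<lambda>u. ?L (f' * u, g' * u))) (at t)" by simp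
  moreover have "?L (f' * u, g' * u) = (QQs (f t) (g t) * f' + QQm (f t) (g t) * g') * u" for u
  proof -
    interpret L: bounded_linear ?L using L by (rule has_derivative_bounded_linear)
    have "(f' * u, g' * u) = (f' * u) *\<^sub>R (1, 0) + (g' * u) *\<^sub>R (0, 1)" by simp
    then have "?L (f' * u, g' * u) = (f' * u) * QQs (f t) (g t) + (g' * u) * QQm (f t) (g t)"
      by (simp only: L.add L.scaleR QQs_def QQm_def real_scaleR_def)
    then show ?thesis by (simp add: algebra_simps)
  qed
  ultimately show ?thesis by (simp add: has_field_derivative_def)
qed

definition height :: "real \<Rightarrow> real \<Rightarrow> real" where "height s y = y * sqrt (DD s (y\<^sup>2))"
definition height_slope :: "real \<Rightarrow> real \<Rightarrow> real" where "height_slope s y = WW s (y\<^sup>2) / sqrt (DD s (y\<^sup>2))"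

lemma height_deriv:
  assumes "s \<ge> 0"
  shows "(height s has_real_derivative height_slope s y) (at y)"
proof -
  define q where "q = sqrt (DD s (y\<^sup>2))"
  have D: "DD s (y\<^sup>2) > 0" by (rule DD_pos[OF assms])
  have q: "q > 0" "DD s (y\<^sup>2) = q\<^sup>2" using D by (simp_all add: q_def)
  have W: "WW s (y\<^sup>2) = q\<^sup>2 + y\<^sup>2 * zeta1 (y\<^sup>2)"
    by (simp add: q(2)[symmetric] WW_def DD_def omega_def)
  have "((\<lambda>y. zeta (y\<^sup>2)) has_real_derivative zeta1 (y\<^sup>2) * (2 * y)) (at y)"
    by (rule DERIV_chain2[OF zeta_deriv]) (auto intro!: derivative_eq_intros)
  then have "((\<lambda>y. DD s (y\<^sup>2)) has_real_derivative zeta1 (y\<^sup>2) * (2 * y)) (at y)"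
    unfolding DD_def by (auto intro!: derivative_eq_intros)
  from DERIV_mult[OF DERIV_ident DERIV_chain2[OF DERIV_real_sqrt[OF D] this]]
  have "((\<lambda>y. y * sqrt (DD s (y\<^sup>2))) has_real_derivative
      1 * q + inverse q / 2 * (zeta1 (y\<^sup>2) * (2 * y)) * y) (at y)"
    by (simp add: q_def)
  moreover have "1 * q + inverse q / 2 * (zeta1 (y\<^sup>2) * (2 * y)) * y = height_slope s y"
    unfolding height_slope_def W q_def[symmetric] using q(1) by (simp add: field_simps power2_eq_square)
  ultimately show ?thesis by (simp add: height_def[abs_def])
qed

lemma zeta_mono: "a \<le> b \<Longrightarrow> zeta a \<le> zeta b"
  by (rule DERIV_nonneg_imp_nondecreasing[of a b zeta]) (use zeta_deriv zeta1_pos in \<open>auto intro: less_imp_le\<close>)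

text \<open>A purely qualitative bound: \<open>zeta 0\<close> degenerates as d tends to 0, so it
  serves existence, uniqueness and regularity of the solution but none of the uniform
  estimates.\<close>

lemma height_slope_ge:
  assumes "s \<ge> 0"
  shows "sqrt (zeta 0) \<le> height_slope s y"
proof -
  have D: "DD s (y\<^sup>2) > 0" by (rule DD_pos[OF assms])
  have "zeta 0 \<le> DD s (y\<^sup>2)" using zeta_mono[of 0 "y\<^sup>2"] assms by (simp add: DD_def)
  then have "sqrt (zeta 0) \<le> DD s (y\<^sup>2) / sqrt (DD s (y\<^sup>2))"
    using D by (simp add: real_div_sqrt)
  also have "\<dots> \<le> height_slope s y"
    unfolding height_slope_def using D WW_ge_DD[of "y\<^sup>2" s] by (intro divide_right_mono) auto
  finally show ?thesis .
qed

text \<open>The location of \<xi> is given by a distance instead of an interval, which covers both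
  orders of a and b and makes \<xi> converge to a together with b.\<close>

lemma height_mvt:
  assumes "s \<ge> 0"
  obtains \<xi> where "\<bar>\<xi> - a\<bar> \<le> \<bar>b - a\<bar>" "height s b - height s a = (b - a) * height_slope s \<xi>"
proof (cases a b rule: linorder_cases)
  case less
  obtain z where "a < z" "z < b" "height s b - height s a = (b - a) * height_slope s z"
    using MVT2[OF less, of "height s" "height_slope s"] height_deriv[OF assms] by blast
  then show ?thesis by (intro that[of z]) auto
next
  case greater
  obtain z where "b < z" "z < a" "height s a - height s b = (a - b) * height_slope s z"
    using MVT2[OF greater, of "height s" "height_slope s"] height_deriv[OF assms] by blast
  then show ?thesis by (intro that[of z]) (auto simp: algebra_simps)
qed (use that[of a] in auto)

lemma height_expanding:
  assumes "s \<ge> 0"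
  shows "sqrt (zeta 0) * \<bar>b - a\<bar> \<le> \<bar>height s b - height s a\<bar>"
proof -
  obtain \<xi> where "height s b - height s a = (b - a) * height_slope s \<xi>" using height_mvt[OF assms] by blast
  then have "\<bar>height s b - height s a\<bar> = \<bar>b - a\<bar> * \<bar>height_slope s \<xi>\<bar>" by (simp add: abs_mult)
  moreover have "sqrt (zeta 0) \<le> \<bar>height_slope s \<xi>\<bar>" using height_slope_ge[OF assms, of \<xi>] by linarith
  ultimately show ?thesis using mult_left_mono[of "sqrt (zeta 0)" "\<bar>height_slope s \<xi>\<bar>" "\<bar>b - a\<bar>"]
    by (simp add: mult.commute)
qed

lemma height_strict_mono:
  assumes "s \<ge> 0" "a < b"
  shows "height s a < height s b"
proof -
  obtain \<xi> where "height s b - height s a = (b - a) * height_slope s \<xi>" using height_mvt[OF assms(1)] by blast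
  moreover have "height_slope s \<xi> > 0"
    using height_slope_ge[OF assms(1), of \<xi>] zeta_pos[of 0] by (smt (verit) real_sqrt_gt_zero)
  ultimately show ?thesis using assms(2) by (smt (verit) mult_pos_pos)
qed

lemma height_surj:
  assumes s: "s \<ge> 0"
  obtains y where "height s y = z"
proof -
  let ?k = "sqrt (zeta 0)"
  have k: "?k > 0" using zeta_pos[of 0] by simp
  have c: "continuous_on S (height s)" for S
    using height_deriv[OF s] by (intro continuous_at_imp_continuous_on ballI) (blast intro: DERIV_isCont)
  define Y where "Y = \<bar>z\<bar> / ?k"
  have Y: "Y \<ge> 0" "?k * Y = \<bar>z\<bar>" using k by (simp_all add: Y_def)
  have "?k * Y \<le> height s Y"
    using height_expanding[OF s, of Y 0] Y DD_pos[OF s, of "Y\<^sup>2"] by (simp add: height_def)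
  moreover have "height s (- Y) = - height s Y" by (simp add: height_def)
  ultimately have "height s (- Y) \<le> z" "z \<le> height s Y" using Y by auto
  then show ?thesis
    using IVT'[of "height s" "- Y" z Y] Y c that by auto
qed

lemma height_slope_isCont:
  assumes "s \<ge> 0"
  shows "isCont (\<lambda>p. height_slope (fst p) (snd p)) (s, y)"
proof -
  have z: "isCont zeta v" "isCont zeta1 v" for v
    using zeta_deriv zeta1_deriv DERIV_isCont by blast+
  have "isCont (\<lambda>p. (fst p + (zeta ((snd p)\<^sup>2) + (snd p)\<^sup>2 * zeta1 ((snd p)\<^sup>2))) / sqrt (fst p + zeta ((snd p)\<^sup>2))) (s, y)"
    using DD_pos[OF assms, of "y\<^sup>2"] 
    by (intro continuous_intros isCont_o2[OF _ z(1)] isCont_o2[OF _ z(2)]) (simp_all add: DD_def)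
  then show ?thesis by (simp add: height_slope_def WW_def DD_def omega_def)
qed

lemma height_deriv_s:
  assumes "f t \<ge> 0" "(f has_real_derivative f') (at t)"
  shows "((\<lambda>t. height (f t) y) has_real_derivative y * f' / (2 * sqrt (DD (f t) (y\<^sup>2)))) (at t)"
proof -
  have D: "DD (f t) (y\<^sup>2) > 0" by (rule DD_pos[OF assms(1)])
  have "((\<lambda>t. DD (f t) (y\<^sup>2)) has_real_derivative f') (at t)"
    unfolding DD_def by (auto intro!: derivative_eq_intros assms)
  from DERIV_cmult[OF DERIV_chain2[OF DERIV_real_sqrt[OF D] this], of y]
  show ?thesis using D by (simp add: height_def field_simps)
qed

text \<open>The mean value theorem in y turns the equation into an explicit quotient: g t - g 0 is
  the residual of the old value g 0 divided by a slope at an intermediate point. Continuity of g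
  makes the slope converge, and the residual is differentiable by inspection.\<close>

lemma implicit_derivative:
  assumes f0: "\<And>t. f t \<ge> 0" and f: "(f has_real_derivative f') (at 0)"
    and c: "(c has_real_derivative c') (at 0)" and g: "isCont g 0"
    and eq: "\<And>t. height (f t) (g t) = c t"
  shows "(g has_real_derivative
    (c' - g 0 * f' / (2 * sqrt (DD (f 0) ((g 0)\<^sup>2)))) / height_slope (f 0) (g 0)) (at 0)"
proof -
  have "\<exists>\<xi>. \<bar>\<xi> - g 0\<bar> \<le> \<bar>g t - g 0\<bar> \<and> height (f t) (g t) - height (f t) (g 0) = (g t - g 0) * height_slope (f t) \<xi>" for t
  proof -
    obtain \<xi> where "\<bar>\<xi> - g 0\<bar> \<le> \<bar>g t - g 0\<bar>" "height (f t) (g t) - height (f t) (g 0) = (g t - g 0) * height_slope (f t) \<xi>"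
      by (rule height_mvt[OF f0])
    then show ?thesis by (intro exI conjI)
  qed
  then obtain \<xi> where x: "\<And>t. \<bar>\<xi> t - g 0\<bar> \<le> \<bar>g t - g 0\<bar> \<and> height (f t) (g t) - height (f t) (g 0) = (g t - g 0) * height_slope (f t) (\<xi> t)"
    by metis
  note x1 = x[THEN conjunct1] and x2 = x[THEN conjunct2]
  have gl: "((\<lambda>t. g t - g 0) \<longlongrightarrow> 0) (at 0)"
    using g by (simp add: isCont_def LIM_zero)
  have "((\<lambda>t. \<xi> t - g 0) \<longlongrightarrow> 0) (at 0)"
    by (rule Lim_null_comparison[OF _ tendsto_rabs_zero[OF gl]]) (simp add: x1)
  then have xl: "(\<xi> \<longlongrightarrow> g 0) (at 0)" by (rule LIM_zero_cancel)
  have fl: "(f \<longlongrightarrow> f 0) (at 0)" using DERIV_isCont[OF f] by (simp add: isCont_def)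
  have Fl: "((\<lambda>t. height_slope (f t) (\<xi> t)) \<longlongrightarrow> height_slope (f 0) (g 0)) (at 0)"
    using isCont_tendsto_compose[OF height_slope_isCont[OF f0[of 0], of "g 0"] tendsto_Pair[OF fl xl]] by simp
  have pos: "height_slope s y > 0" if "s \<ge> 0" for s y
    using height_slope_ge[OF that, of y] zeta_pos[of 0] by (smt (verit) real_sqrt_gt_zero)
  define w where "w = (\<lambda>t. c t - height (f t) (g 0))"
  have w0: "w 0 = 0" using eq[of 0] by (simp add: w_def)
  have "(w has_real_derivative c' - g 0 * f' / (2 * sqrt (DD (f 0) ((g 0)\<^sup>2)))) (at 0)"
    unfolding w_def by (intro DERIV_diff c height_deriv_s f f0)
  then have "((\<lambda>t. w t / t) \<longlongrightarrow> c' - g 0 * f' / (2 * sqrt (DD (f 0) ((g 0)\<^sup>2)))) (at 0)"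
    by (simp add: DERIV_def w0)
  from tendsto_divide[OF this Fl]
  have "((\<lambda>t. w t / t / height_slope (f t) (\<xi> t)) \<longlongrightarrow>
      (c' - g 0 * f' / (2 * sqrt (DD (f 0) ((g 0)\<^sup>2)))) / height_slope (f 0) (g 0)) (at 0)"
    using pos[OF f0[of 0], of "g 0"] by simp
  moreover have "w t / t / height_slope (f t) (\<xi> t) = (g (0 + t) - g 0) / t" for t
  proof -
    have "w t = (g t - g 0) * height_slope (f t) (\<xi> t)" using x2[of t] eq[of t] by (simp add: w_def)
    then show ?thesis using pos[OF f0[of t], of "\<xi> t"] by simp
  qed
  ultimately show ?thesis by (simp add: DERIV_def)
qed

end

section \<open>The solution and the drift\<close>

locale vortex = profile M d "CARD('n)" for M d :: real and l :: "'n::finite"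
begin

definition rho2 :: "real^'n \<Rightarrow> real" where "rho2 x = (\<Sum>i\<in>UNIV - {l}. (x $ i)\<^sup>2)"
definition soln :: "real^'n \<Rightarrow> real" where "soln x = (THE y. height (rho2 x) y = x $ l)"
abbreviation "mm x \<equiv> (soln x)\<^sup>2"
abbreviation "D x \<equiv> DD (rho2 x) (mm x)"
abbreviation "W x \<equiv> WW (rho2 x) (mm x)"

definition soln_partial :: "'n \<Rightarrow> real^'n \<Rightarrow> real" where
  "soln_partial i x = (if i = l then sqrt (D x) / W x else - (soln x * x $ i) / W x)"

lemma rho2_nonneg: "rho2 x \<ge> 0" by (simp add: rho2_def sum_nonneg)

lemma D_pos: "D x > 0" by (rule DD_pos[OF rho2_nonneg])
lemma W_ge_D: "W x \<ge> D x" by (rule WW_ge_DD) simp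
lemma W_pos: "W x > 0" by (rule WW_pos[OF rho2_nonneg]) simp

lemma soln_eqI: "height (rho2 x) y = x $ l \<Longrightarrow> soln x = y"
  unfolding soln_def
  by (rule the_equality) (use height_strict_mono[OF rho2_nonneg, of _ _ x] in \<open>metis linorder_neqE less_irrefl\<close>)+

lemma soln_eq: "height (rho2 x) (soln x) = x $ l"
  using height_surj[OF rho2_nonneg, of x "x $ l"] soln_eqI by metis

lemma soln_geI: "height (rho2 x) y \<le> x $ l \<Longrightarrow> y \<le> soln x"
  using height_strict_mono[OF rho2_nonneg, of "soln x" y x] soln_eq[of x] by linarith

lemma soln_continuous: "continuous_on S soln"
proof (intro continuous_at_imp_continuous_on ballI)
  fix x
  let ?k = "sqrt (zeta 0)"
  have k: "?k > 0" using zeta_pos[of 0] by simp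
  \<comment> \<open>The residual of the old value \<open>soln x\<close> in the equation at x'
    controls the change of the solution; it is continuous in x' and vanishes at x.\<close>
  have bound: "norm (soln x' - soln x) \<le> \<bar>x' $ l - height (rho2 x') (soln x)\<bar> / ?k" for x'
    using height_expanding[OF rho2_nonneg, of "soln x'" "soln x" x'] k by (simp add: soln_eq field_simps)
  have "isCont (\<lambda>x'. \<bar>x' $ l - height (rho2 x') (soln x)\<bar> / ?k) x"
    unfolding height_def DD_def rho2_def using k by (intro continuous_intros) auto
  then have "((\<lambda>x'. \<bar>x' $ l - height (rho2 x') (soln x)\<bar> / ?k) \<longlongrightarrow> \<bar>x $ l - height (rho2 x) (soln x)\<bar> / ?k) (at x)"
    by (simp add: isCont_def)
  then have "((\<lambda>x'. \<bar>x' $ l - height (rho2 x') (soln x)\<bar> / ?k) \<longlongrightarrow> 0) (at x)"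
    by (simp add: soln_eq)
  then have "((\<lambda>x'. soln x' - soln x) \<longlongrightarrow> 0) (at x)"
    by (rule Lim_null_comparison[OF always_eventually[OF allI[OF bound]]])
  then show "isCont soln x" by (simp add: isCont_def LIM_zero_cancel)
qed

definition rho2_partial :: "'n \<Rightarrow> real^'n \<Rightarrow> real" where "rho2_partial i x = (if i = l then 0 else 2 * x $ i)"

lemma rho2_deriv: "((\<lambda>t. rho2 (x + t *\<^sub>R axis i 1)) has_real_derivative rho2_partial i x) (at 0)"
proof -
  have "((\<lambda>t. \<Sum>j\<in>UNIV - {l}. ((x + t *\<^sub>R axis i 1) $ j)\<^sup>2) has_real_derivative
      (\<Sum>j\<in>UNIV - {l}. 2 * x $ j * axis i 1 $ j)) (at 0)"
    by (auto intro!: derivative_eq_intros sum.cong simp: mult_ac)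
  also have "(\<Sum>j\<in>UNIV - {l}. 2 * x $ j * axis i 1 $ j) = (\<Sum>j\<in>UNIV - {l}. if j = i then 2 * x $ i else 0)"
    by (intro sum.cong) (auto simp: axis_def)
  also have "\<dots> = rho2_partial i x" by (auto simp: rho2_partial_def)
  finally show ?thesis by (simp add: rho2_def)
qed

lemma soln_deriv: "((\<lambda>t. soln (x + t *\<^sub>R axis i 1)) has_real_derivative soln_partial i x) (at 0)"
proof -
  let ?e = "axis i 1 :: real^'n"
  have c: "((\<lambda>t. (x + t *\<^sub>R ?e) $ l) has_real_derivative (if i = l then 1 else 0)) (at 0)"
    by (auto intro!: derivative_eq_intros simp: axis_def)
  have "isCont soln (x + 0 *\<^sub>R ?e)"
    using soln_continuous[of UNIV] by (simp add: continuous_on_eq_continuous_at)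
  then have "isCont (\<lambda>t. soln (x + t *\<^sub>R ?e)) 0"
    by (rule isCont_o2[rotated]) (intro continuous_intros)
  from implicit_derivative[OF rho2_nonneg rho2_deriv c this soln_eq]
  have "((\<lambda>t. soln (x + t *\<^sub>R ?e)) has_real_derivative
      ((if i = l then 1 else 0) - soln x * rho2_partial i x / (2 * sqrt (D x))) / height_slope (rho2 x) (soln x)) (at 0)"
    by simp
  moreover have "((if i = l then 1 else 0) - soln x * rho2_partial i x / (2 * sqrt (D x))) / height_slope (rho2 x) (soln x) = soln_partial i x"
    using D_pos[of x] W_pos[of x] by (auto simp: soln_partial_def height_slope_def rho2_partial_def field_simps)
  ultimately show ?thesis by simp
qed

section \<open>Smoothness of the solution\<close>

lemma kernels_rad: "k \<in> kernels h \<Longrightarrow> (\<lambda>t x. rad (k t x)) \<in> kernels h"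
  unfolding rad_def by (intro kernels_intros) (use d in \<open>auto intro: add_nonneg_pos\<close>)

lemma kernels_zeta: "k \<in> kernels h \<Longrightarrow> (\<lambda>t x. zeta (k t x)) \<in> kernels h"
  unfolding zeta_def by (intro kernels_intros kernels_rad) (auto simp: base_pos)

lemma kernels_zeta1: "k \<in> kernels h \<Longrightarrow> (\<lambda>t x. zeta1 (k t x)) \<in> kernels h"
  unfolding zeta1_def by (intro kernels_intros kernels_rad kernels_zeta) (auto simp: rad_pos)

lemma kernels_zeta2: "k \<in> kernels h \<Longrightarrow> (\<lambda>t x. zeta2 (k t x)) \<in> kernels h"
  unfolding zeta2_def by (intro kernels_intros kernels_rad kernels_zeta) (assumption | intro zero_less_power rad_pos)+

lemma kernels_zeta3: "k \<in> kernels h \<Longrightarrow> (\<lambda>t x. zeta3 (k t x)) \<in> kernels h"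
  unfolding zeta3_def by (intro kernels_intros kernels_rad kernels_zeta) (assumption | intro zero_less_power rad_pos)+

lemma kernels_DD: "j \<in> kernels h \<Longrightarrow> k \<in> kernels h \<Longrightarrow> (\<lambda>t x. DD (j t x) (k t x)) \<in> kernels h"
  unfolding DD_def by (intro kernels_intros kernels_zeta)

lemma kernels_WW: "j \<in> kernels h \<Longrightarrow> k \<in> kernels h \<Longrightarrow> (\<lambda>t x. WW (j t x) (k t x)) \<in> kernels h"
  unfolding WW_def omega_def by (intro kernels_intros kernels_zeta kernels_zeta1)

lemmas kernels_profile = kernels_zeta kernels_zeta1 kernels_zeta2 kernels_zeta3 kernels_DD kernels_WW

context
  fixes j k :: "real \<Rightarrow> real^'n \<Rightarrow> real" and h :: "real^'n \<Rightarrow> real"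
  assumes jk: "j \<in> kernels h" "k \<in> kernels h" "\<And>t x. j t x \<ge> 0" "\<And>t x. k t x \<ge> 0"
begin

lemma kernels_JJ: "(\<lambda>t x. JJ (j t x) (k t x)) \<in> kernels h"
  unfolding JJ_def omega1_def
  by (intro kernels_intros kernels_profile jk) (intro zero_less_power WW_pos jk)+

lemma kernels_JJ1: "(\<lambda>t x. JJ1 (j t x) (k t x)) \<in> kernels h"
  unfolding JJ1_def omega1_def omega2_def
  by (intro kernels_intros kernels_profile jk) (intro zero_less_power WW_pos jk)+

lemma kernels_PP: "(\<lambda>t x. PP (j t x) (k t x)) \<in> kernels h"
  unfolding PP_def by (intro kernels_intros kernels_profile kernels_JJ jk) (use DD_pos jk in auto)

lemma kernels_QQ: "(\<lambda>t x. QQ (j t x) (k t x)) \<in> kernels h"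
  unfolding QQ_def PP1_def
  by (intro kernels_intros kernels_profile kernels_JJ kernels_JJ1 kernels_PP jk) (use DD_pos jk in auto)

end

lemma kernels_rho2: "(\<lambda>t. rho2) \<in> kernels soln"
  unfolding rho2_def[abs_def] by (intro kernels_intros)

lemma kernels_soln_partial: "(\<lambda>t. soln_partial i) \<in> kernels soln"
proof (cases "i = l")
  case True
  have "(\<lambda>t x. sqrt (D x) / W x) \<in> kernels soln"
    by (intro kernels_intros kernels_profile kernels_rho2) (auto simp: D_pos W_pos)
  with True show ?thesis by (simp add: soln_partial_def[abs_def])
next
  case False
  have "(\<lambda>t x. - (soln x * x $ i) / W x) \<in> kernels soln"
    by (intro kernels_intros kernels_profile kernels_rho2) (auto simp: W_pos)
  with False show ?thesis by (simp add: soln_partial_def[abs_def])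
qed

lemma generator_closed_soln: "generator_closed soln"
  unfolding generator_closed_def
proof (intro conjI allI soln_continuous)
  show "\<exists>k\<in>kernels soln. \<forall>t x. ((\<lambda>s. soln (x + s *\<^sub>R axis i 1)) has_real_derivative k t x) (at 0)" for i
    by (rule bexI[OF _ kernels_soln_partial[of i]]) (simp add: soln_deriv)
qed

end


section \<open>The drift and the two equations\<close>

context vortex
begin

text \<open>The \<open>h\<close>-derivative of \<open>\<rho> powr (1 - n)\<close> times the stream function is \<open>strain\<close>, where the
  substitution \<open>\<rho>' = t\<rho>\<close> puts the integral along the level set over \<open>{0..1}\<close>.\<close>

definition strain_kernel :: "real \<Rightarrow> real^'n \<Rightarrow> real" where
  "strain_kernel t x = t ^ (CARD('n) - 2) * QQ (t\<^sup>2 * rho2 x) (mm x)"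

definition strain :: "real^'n \<Rightarrow> real" where "strain x = integral {0..1} (\<lambda>t. strain_kernel t x)"

definition strain_kernel_partial :: "'n \<Rightarrow> real \<Rightarrow> real^'n \<Rightarrow> real" where
  "strain_kernel_partial i t x = t ^ (CARD('n) - 2) * (QQs (t\<^sup>2 * rho2 x) (mm x) * (t\<^sup>2 * rho2_partial i x)
     + QQm (t\<^sup>2 * rho2 x) (mm x) * (2 * soln x * soln_partial i x))"

definition strain_partial :: "'n \<Rightarrow> real^'n \<Rightarrow> real" where "strain_partial i x = integral {0..1} (\<lambda>t. strain_kernel_partial i t x)"

definition radial_deriv :: "real^'n \<Rightarrow> real" where "radial_deriv x = (\<Sum>j\<in>UNIV - {l}. x $ j * soln_partial j x)"

text \<open>The vertical field \<open>soln x * PP (rho2 x) (mm x)\<close> alone already produces the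
  Laplacian in the equation. Added to it is \<open>strain\<close> times a field tangent to the level
  sets of \<open>soln\<close>, which leaves the equation untouched and is free to cancel the
  divergence.\<close>

definition drift :: "real^'n \<Rightarrow> real^'n" where
  "drift x = (\<chi> i. if i = l then soln x * PP (rho2 x) (mm x) + strain x * radial_deriv x else - (x $ i * (strain x * soln_partial l x)))"

lemma kernels_strain_kernel: "strain_kernel \<in> kernels soln"
proof -
  have "(\<lambda>t x. t ^ (CARD('n) - 2) * QQ (t\<^sup>2 * rho2 x) (mm x)) \<in> kernels soln"
    by (intro kernels_intros kernels_QQ kernels_rho2) (auto simp: rho2_nonneg)
  then show ?thesis by (simp add: strain_kernel_def[abs_def])
qed

lemma mm_deriv: "((\<lambda>s. mm (x + s *\<^sub>R axis i 1)) has_real_derivative 2 * soln x * soln_partial i x) (at 0)"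
  using DERIV_power[OF soln_deriv, of x i 2] by (simp add: mult_ac)

lemma strain_kernel_deriv: "((\<lambda>s. strain_kernel t (x + s *\<^sub>R axis i 1)) has_real_derivative strain_kernel_partial i t x) (at 0)"
proof -
  have "((\<lambda>s. QQ (t\<^sup>2 * rho2 (x + s *\<^sub>R axis i 1)) (mm (x + s *\<^sub>R axis i 1))) has_real_derivative
      QQs (t\<^sup>2 * rho2 x) (mm x) * (t\<^sup>2 * rho2_partial i x) + QQm (t\<^sup>2 * rho2 x) (mm x) * (2 * soln x * soln_partial i x)) (at 0)"
    using QQ_chain[of "\<lambda>s. t\<^sup>2 * rho2 (x + s *\<^sub>R axis i 1)" 0 "\<lambda>s. mm (x + s *\<^sub>R axis i 1)",
        OF _ _ DERIV_cmult[OF rho2_deriv] mm_deriv] by (simp add: rho2_nonneg)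
  from DERIV_cmult[OF this, of "t ^ (CARD('n) - 2)"] show ?thesis
    by (simp add: strain_kernel_def strain_kernel_partial_def)
qed

text \<open>The kernel calculus provides some derivative inside the class, and uniqueness of
  derivatives identifies it with the chain rule formula. Thus \<open>QQs\<close> and
  \<open>QQm\<close> need no membership proofs of their own.\<close>

lemma kernels_strain_kernel_partial: "strain_kernel_partial i \<in> kernels soln"
proof -
  obtain k' where k': "k' \<in> kernels soln"
    "\<And>t x. ((\<lambda>s. strain_kernel t (x + s *\<^sub>R axis i 1)) has_real_derivative k' t x) (at 0)"
    using kernels_derivative[OF generator_closed_soln kernels_strain_kernel] by blast
  have "k' = strain_kernel_partial i"
    using DERIV_unique[OF k'(2) strain_kernel_deriv] by (intro ext) blast
  with k'(1) show ?thesis by simp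
qed

lemma strain_deriv: "((\<lambda>s. strain (x + s *\<^sub>R axis i 1)) has_real_derivative strain_partial i x) (at 0)"
  unfolding strain_def strain_partial_def
  by (rule kernel_integral_derivative[OF generator_closed_soln kernels_strain_kernel kernels_strain_kernel_partial strain_kernel_deriv])

lemma kernel_has_integral:
  "k \<in> kernels soln \<Longrightarrow> ((\<lambda>t. k t x) has_integral integral {0..1} (\<lambda>t. k t x)) {0..1}"
  by (intro integrable_integral integrable_continuous_interval kernels_continuous'(2)[OF generator_closed_soln])

lemma sum_rho2_partial: "(\<Sum>i\<in>UNIV - {l}. x $ i * rho2_partial i x) = 2 * rho2 x"
  by (simp add: rho2_def sum_distrib_left rho2_partial_def power2_eq_square mult_ac)

text \<open>The vector field \<open>soln_partial l x * (\<Sum>i\<noteq>l. x\<^sub>i \<partial>\<^sub>i) - radial_deriv x * \<partial>\<^sub>l\<close> annihilates \<open>soln\<close>,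
  so it only sees the dependence of \<open>strain\<close> on \<open>rho2\<close>.\<close>

lemma strain_identity:
  "soln_partial l x * (\<Sum>i\<in>UNIV - {l}. x $ i * strain_partial i x) - radial_deriv x * strain_partial l x =
    soln_partial l x * (QQ (rho2 x) (mm x) - (real CARD('n) - 1) * strain x)"
proof -
  define N where "N = CARD('n)"
  have N: "N \<ge> 3" using n by (simp add: N_def)
  let ?s = "rho2 x" and ?m = "mm x"
  let ?g = "\<lambda>t. t ^ (N - 1) * (QQs (t\<^sup>2 * ?s) ?m * (2 * t * ?s))"
  \<comment> \<open>Integration by parts in t: the product t^(N-1) * \<open>QQ\<close> takes the
    value \<open>QQ\<close> at the point itself for t = 1 and vanishes for t = 0. The remaining
    integral is that of the s-derivative, which the tangential field produces.\<close>
  have "((\<lambda>t. t ^ (N - 1) * QQ (t\<^sup>2 * ?s) ?m) has_real_derivative (real N - 1) * strain_kernel t x + ?g t) (at t)" for t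
  proof -
    have "((\<lambda>t. t\<^sup>2 * ?s) has_real_derivative 2 * t * ?s) (at t)"
      by (auto intro!: derivative_eq_intros)
    from QQ_chain[OF _ _ this DERIV_const[of ?m]]
    have 1: "((\<lambda>t. QQ (t\<^sup>2 * ?s) ?m) has_real_derivative QQs (t\<^sup>2 * ?s) ?m * (2 * t * ?s)) (at t)"
      by (simp add: rho2_nonneg)
    have 2: "((\<lambda>t. t ^ (N - 1)) has_real_derivative (real N - 1) * t ^ (N - 2)) (at t)"
      using DERIV_pow[of "N - 1" t] N by (simp add: of_nat_diff numeral_2_eq_2)
    show ?thesis
      using DERIV_mult[OF 2 1] by (simp add: strain_kernel_def N_def mult_ac)
  qed
  then have "((\<lambda>t. (real N - 1) * strain_kernel t x + ?g t) has_integral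
      (1 ^ (N - 1) * QQ (1\<^sup>2 * ?s) ?m - 0 ^ (N - 1) * QQ (0\<^sup>2 * ?s) ?m)) {0..1}"
    by (intro fundamental_theorem_of_calculus)
      (auto simp: has_real_derivative_iff_has_vector_derivative[symmetric] intro: DERIV_subset)
  then have "((\<lambda>t. (real N - 1) * strain_kernel t x + ?g t) has_integral QQ ?s ?m) {0..1}"
    using N by (simp add: power_0_left)
  from has_integral_diff[OF this has_integral_mult_right[OF kernel_has_integral[OF kernels_strain_kernel, of x], of "real N - 1"]]
  have "(?g has_integral QQ ?s ?m - (real N - 1) * strain x) {0..1}"
    by (simp add: strain_def)
  from has_integral_mult_right[OF this, of "soln_partial l x"]
  have 1: "((\<lambda>t. soln_partial l x * ?g t) has_integral soln_partial l x * (QQ ?s ?m - (real N - 1) * strain x)) {0..1}" .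
  have "((\<lambda>t. soln_partial l x * (\<Sum>i\<in>UNIV - {l}. x $ i * strain_kernel_partial i t x) - radial_deriv x * strain_kernel_partial l t x) has_integral
      soln_partial l x * (\<Sum>i\<in>UNIV - {l}. x $ i * strain_partial i x) - radial_deriv x * strain_partial l x) {0..1}"
    unfolding strain_partial_def
    by (intro has_integral_diff has_integral_mult_right has_integral_sum kernel_has_integral kernels_strain_kernel_partial) simp
  moreover have "soln_partial l x * (\<Sum>i\<in>UNIV - {l}. x $ i * strain_kernel_partial i t x) - radial_deriv x * strain_kernel_partial l t x = soln_partial l x * ?g t" for t
  proof -
    let ?a = "QQs (t\<^sup>2 * ?s) ?m" and ?b = "QQm (t\<^sup>2 * ?s) ?m" and ?t = "t ^ (N - 2)"
    have "(\<Sum>i\<in>UNIV - {l}. x $ i * strain_kernel_partial i t x) =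
        (\<Sum>i\<in>UNIV - {l}. ?t * ?a * t\<^sup>2 * (x $ i * rho2_partial i x) + ?t * ?b * 2 * soln x * (x $ i * soln_partial i x))"
      by (intro sum.cong) (simp_all add: strain_kernel_partial_def N_def algebra_simps)
    also have "\<dots> = ?t * ?a * t\<^sup>2 * (2 * ?s) + ?t * ?b * 2 * soln x * radial_deriv x"
      by (simp only: sum.distrib sum_distrib_left[symmetric] sum_rho2_partial radial_deriv_def)
    finally have 1: "(\<Sum>i\<in>UNIV - {l}. x $ i * strain_kernel_partial i t x) = ?t * ?a * t\<^sup>2 * (2 * ?s) + ?t * ?b * 2 * soln x * radial_deriv x" .
    have 2: "strain_kernel_partial l t x = ?t * ?b * 2 * soln x * soln_partial l x" by (simp add: strain_kernel_partial_def N_def rho2_partial_def)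
    have "N - 1 = Suc (N - 2)" using N by simp
    then have 3: "t ^ (N - 1) = t * t ^ (N - 2)" by simp
    show ?thesis unfolding 1 2 3 by (simp add: algebra_simps power2_eq_square)
  qed
  ultimately have "((\<lambda>t. soln_partial l x * ?g t) has_integral
      soln_partial l x * (\<Sum>i\<in>UNIV - {l}. x $ i * strain_partial i x) - radial_deriv x * strain_partial l x) {0..1}" by simp
  from has_integral_unique[OF this 1] show ?thesis by (simp add: N_def)
qed

lemma smooth_soln: "smooth_in S soln"
  by (rule smooth_in_kernel[OF generator_closed_soln kernels.base]) simp

lemma smooth_drift_component: "smooth_in S (\<lambda>x. drift x $ i)"
proof (cases "i = l")
  case True
  have radial_deriv: "(\<lambda>t x. radial_deriv x) \<in> kernels soln"
    unfolding radial_deriv_def by (intro kernels_intros kernels_soln_partial)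
  have k: "(\<lambda>t x. soln x * PP (rho2 x) (mm x) + strain_kernel t x * radial_deriv x) \<in> kernels soln"
    by (intro kernels_intros kernels_PP kernels_rho2 kernels_strain_kernel radial_deriv) (auto simp: rho2_nonneg)
  have "drift x $ i = integral {0..1} (\<lambda>t. soln x * PP (rho2 x) (mm x) + strain_kernel t x * radial_deriv x)" for x
  proof -
    have "((\<lambda>t. soln x * PP (rho2 x) (mm x) + strain_kernel t x * radial_deriv x) has_integral
        soln x * PP (rho2 x) (mm x) + strain x * radial_deriv x) {0..1}"
      using has_integral_add[OF has_integral_const_real[of "soln x * PP (rho2 x) (mm x)" 0 1]
          has_integral_mult_left[OF kernel_has_integral[OF kernels_strain_kernel]]] by (simp add: strain_def)
    with True show ?thesis by (simp add: drift_def integral_unique)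
  qed
  with smooth_in_kernel_integral[OF generator_closed_soln k] show ?thesis by simp
next
  case False
  have k: "(\<lambda>t x. - (x $ i * soln_partial l x * strain_kernel t x)) \<in> kernels soln"
    by (intro kernels_intros kernels_strain_kernel kernels_soln_partial)
  have "drift x $ i = integral {0..1} (\<lambda>t. - (x $ i * soln_partial l x * strain_kernel t x))" for x
    using False by (simp add: drift_def strain_def)
  with smooth_in_kernel_integral[OF generator_closed_soln k] show ?thesis by simp
qed

lemma smooth_drift: "smooth_in S drift"
  by (rule smooth_in_vec) (rule smooth_drift_component)

lemma partial_derivI: "((\<lambda>t. f (x + t *\<^sub>R axis i 1)) has_real_derivative f') (at 0) \<Longrightarrow> partial_deriv i f x = f'"
  by (simp add: partial_deriv_def has_real_derivative_iff_has_vector_derivative vector_derivative_at)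

lemma partial_soln: "partial_deriv i soln = soln_partial i"
  by (intro ext partial_derivI soln_deriv)

lemma D_deriv: "((\<lambda>t. D (x + t *\<^sub>R axis i 1)) has_real_derivative
    rho2_partial i x + zeta1 (mm x) * (2 * soln x * soln_partial i x)) (at 0)"
  unfolding DD_def using DERIV_chain2[OF zeta_deriv mm_deriv[of x i], simplified]
  by (intro DERIV_add rho2_deriv) (simp add: mult_ac)

lemma W_deriv: "((\<lambda>t. W (x + t *\<^sub>R axis i 1)) has_real_derivative
    rho2_partial i x + omega1 (mm x) * (2 * soln x * soln_partial i x)) (at 0)"
  unfolding WW_def using DERIV_chain2[OF omega_deriv mm_deriv[of x i], simplified]
  by (intro DERIV_add rho2_deriv) (simp add: mult_ac)

definition soln_partial_l_partial :: "'n \<Rightarrow> real^'n \<Rightarrow> real" where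
  "soln_partial_l_partial i x = ((rho2_partial i x + zeta1 (mm x) * (2 * soln x * soln_partial i x)) / (2 * sqrt (D x)) * W x
     - (rho2_partial i x + omega1 (mm x) * (2 * soln x * soln_partial i x)) * sqrt (D x)) / (W x)\<^sup>2"

lemma soln_partial_l_deriv: "((\<lambda>t. soln_partial l (x + t *\<^sub>R axis i 1)) has_real_derivative soln_partial_l_partial i x) (at 0)"
proof -
  have "DD (rho2 (x + 0 *\<^sub>R axis i 1)) (mm (x + 0 *\<^sub>R axis i 1)) > 0" by (rule D_pos)
  from DERIV_chain2[OF DERIV_real_sqrt[OF this] D_deriv]
  have "((\<lambda>t. sqrt (D (x + t *\<^sub>R axis i 1))) has_real_derivative
     (rho2_partial i x + zeta1 (mm x) * (2 * soln x * soln_partial i x)) / (2 * sqrt (D x))) (at 0)"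
    by (simp add: field_simps)
  from DERIV_divide[OF this W_deriv[of x i]] W_pos[of x]
  have "((\<lambda>t. sqrt (D (x + t *\<^sub>R axis i 1)) / W (x + t *\<^sub>R axis i 1)) has_real_derivative soln_partial_l_partial i x) (at 0)"
    by (simp add: soln_partial_l_partial_def power2_eq_square[of "W x"] mult.commute[of "sqrt (D x)"])
  moreover have "soln_partial l = (\<lambda>y. sqrt (D y) / W y)" by (simp add: soln_partial_def[abs_def])
  ultimately show ?thesis by simp
qed

definition soln_partial_j_partial :: "'n \<Rightarrow> 'n \<Rightarrow> real^'n \<Rightarrow> real" where
  "soln_partial_j_partial j i x = - ((soln_partial i x * x $ j + axis i 1 $ j * soln x) * W x
     - (rho2_partial i x + omega1 (mm x) * (2 * soln x * soln_partial i x)) * (soln x * x $ j)) / (W x)\<^sup>2"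

lemma soln_partial_j_deriv:
  assumes "j \<noteq> l"
  shows "((\<lambda>t. soln_partial j (x + t *\<^sub>R axis i 1)) has_real_derivative soln_partial_j_partial j i x) (at 0)"
proof -
  have "((\<lambda>t. (x + t *\<^sub>R axis i 1) $ j) has_real_derivative axis i 1 $ j) (at 0)"
    by (auto intro!: derivative_eq_intros)
  from DERIV_divide[OF DERIV_minus[OF DERIV_mult[OF soln_deriv this]] W_deriv[of x i]] W_pos[of x]
  have "((\<lambda>t. - (soln (x + t *\<^sub>R axis i 1) * (x + t *\<^sub>R axis i 1) $ j) / W (x + t *\<^sub>R axis i 1))
      has_real_derivative soln_partial_j_partial j i x) (at 0)"
    by (auto simp: soln_partial_j_partial_def power2_eq_square[of "W x"] minus_divide_left algebra_simps elim!: DERIV_cong)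
  moreover have "soln_partial j = (\<lambda>y. - (soln y * y $ j) / W y)" using assms by (simp add: soln_partial_def[abs_def])
  ultimately show ?thesis by simp
qed

lemma W_eq: "W x = D x + mm x * zeta1 (mm x)"
  by (simp add: WW_def DD_def omega_def)

text \<open>Symmetry of second derivatives, read off from the two formulas. It makes the
  l-derivative of \<open>radial_deriv\<close> cancel against the derivatives of
  \<open>soln_partial l\<close> in the divergence.\<close>

lemma mixed_partials:
  assumes "j \<noteq> l"
  shows "soln_partial_j_partial j l x = soln_partial_l_partial j x"
proof -
  define q h w z o1 y where "q = sqrt (D x)" and "h = soln x" and "w = W x" and "z = zeta1 (mm x)"
    and "o1 = omega1 (mm x)" and "y = x $ j"
  have q: "q > 0" using D_pos[of x] by (simp add: q_def)
  have w: "w > 0" using W_pos[of x] by (simp add: w_def)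
  \<comment> \<open>The only relation between D and W that the computation uses; without it the two
    sides do not match.\<close>
  have wq: "q\<^sup>2 = w - h\<^sup>2 * z"
    using D_pos[of x] W_eq[of x] by (simp add: q_def w_def h_def z_def)
  have "soln_partial_j_partial j l x = - (q / w * y * w - o1 * (2 * h * (q / w)) * (h * y)) / w\<^sup>2"
    using assms by (simp add: soln_partial_j_partial_def rho2_partial_def axis_def soln_partial_def q_def h_def w_def z_def o1_def y_def)
  also have "\<dots> = y * q * (2 * h\<^sup>2 * o1 / w - 1) / w\<^sup>2"
    using w by (simp add: field_simps power2_eq_square)
  finally have 1: "soln_partial_j_partial j l x = y * q * (2 * h\<^sup>2 * o1 / w - 1) / w\<^sup>2" .
  have "soln_partial_l_partial j x = ((2 * y + z * (2 * h * (- (h * y) / w))) / (2 * q) * w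
     - (2 * y + o1 * (2 * h * (- (h * y) / w))) * q) / w\<^sup>2"
    using assms by (simp add: soln_partial_l_partial_def rho2_partial_def soln_partial_def q_def h_def w_def z_def o1_def y_def)
  also have "(2 * y + z * (2 * h * (- (h * y) / w))) / (2 * q) * w = y * (w - h\<^sup>2 * z) / q"
    using w q by (simp add: field_simps power2_eq_square)
  also have "\<dots> = y * q"
    unfolding wq[symmetric] using q by (simp add: power2_eq_square)
  also have "y * q - (2 * y + o1 * (2 * h * (- (h * y) / w))) * q = y * q * (2 * h\<^sup>2 * o1 / w - 1)"
    using w by (simp add: field_simps power2_eq_square)
  finally show ?thesis using 1 by simp
qed

text \<open>This is where \<open>JJ\<close> comes from: the Laplacian equals
  \<open>soln x * JJ / W\<close>, and division by \<open>soln_partial l x\<close>, which is sqrt D /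
  W, leaves \<open>soln x * PP\<close>. The n - 1 in \<open>JJ\<close> counts the horizontal
  directions, each contributing - \<open>soln x\<close> / W.\<close>

lemma laplacian_soln: "laplacian soln x = soln x * PP (rho2 x) (mm x) * soln_partial l x"
proof -
  define q h w z o1 where "q = sqrt (D x)" and "h = soln x" and "w = W x" and "z = zeta1 (mm x)"
    and "o1 = omega1 (mm x)"
  have q: "q > 0" using D_pos[of x] by (simp add: q_def)
  have w: "w > 0" using W_pos[of x] by (simp add: w_def)
  have l: "partial_deriv l (soln_partial l) x = h * z / w\<^sup>2 - 2 * h * q\<^sup>2 * o1 / w ^ 3"
  proof -
    have "partial_deriv l (soln_partial l) x = (z * (2 * h * (q / w)) / (2 * q) * w - o1 * (2 * h * (q / w)) * q) / w\<^sup>2"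
      unfolding partial_derivI[OF soln_partial_l_deriv] soln_partial_l_partial_def
      by (simp add: rho2_partial_def soln_partial_def q_def h_def w_def z_def o1_def)
    then show ?thesis using q w by (simp add: field_simps power2_eq_square power3_eq_cube)
  qed
  have i: "partial_deriv i (soln_partial i) x = (3 * h / w\<^sup>2 - 2 * h ^ 3 * o1 / w ^ 3) * (x $ i)\<^sup>2 - h / w" if "i \<noteq> l" for i
  proof -
    have "partial_deriv i (soln_partial i) x = - ((- (h * x $ i) / w * x $ i + h) * w
      - (2 * x $ i + o1 * (2 * h * (- (h * x $ i) / w))) * (h * x $ i)) / w\<^sup>2"
      unfolding partial_derivI[OF soln_partial_j_deriv[OF that]] soln_partial_j_partial_def
      using that by (simp add: rho2_partial_def soln_partial_def h_def w_def o1_def axis_def)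
    then show ?thesis using w by (simp add: field_simps power2_eq_square power3_eq_cube)
  qed
  have "laplacian soln x = (\<Sum>i\<in>UNIV. partial_deriv i (soln_partial i) x)"
    by (simp add: laplacian_def partial_soln)
  also have "\<dots> = partial_deriv l (soln_partial l) x + (\<Sum>i\<in>UNIV - {l}. partial_deriv i (soln_partial i) x)"
    by (rule sum.remove) auto
  also have "(\<Sum>i\<in>UNIV - {l}. partial_deriv i (soln_partial i) x) =
      (\<Sum>i\<in>UNIV - {l}. (3 * h / w\<^sup>2 - 2 * h ^ 3 * o1 / w ^ 3) * (x $ i)\<^sup>2 - h / w)"
    by (intro sum.cong) (auto simp: i)
  also have "\<dots> = (3 * h / w\<^sup>2 - 2 * h ^ 3 * o1 / w ^ 3) * rho2 x - (real CARD('n) - 1) * (h / w)"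
    by (simp add: sum_subtractf sum_distrib_left[symmetric] rho2_def card_Diff_singleton of_nat_diff)
  finally have L: "laplacian soln x = h * z / w\<^sup>2 - 2 * h * q\<^sup>2 * o1 / w ^ 3
      + ((3 * h / w\<^sup>2 - 2 * h ^ 3 * o1 / w ^ 3) * rho2 x - (real CARD('n) - 1) * (h / w))"
    by (simp add: l)
  have qD: "DD (rho2 x) (mm x) = q\<^sup>2" using D_pos[of x] by (simp add: q_def)
  have "soln x * PP (rho2 x) (mm x) * soln_partial l x = h * JJ (rho2 x) (mm x) / w"
    using q by (simp add: PP_def soln_partial_def q_def[symmetric] w_def h_def)
  also have "JJ (rho2 x) (mm x) = 3 * rho2 x / w + z / w - (real CARD('n) - 1)
     - 2 * (h\<^sup>2 * rho2 x + q\<^sup>2) * o1 / w\<^sup>2"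
    unfolding JJ_def qD by (simp add: w_def z_def o1_def h_def)
  finally have R: "soln x * PP (rho2 x) (mm x) * soln_partial l x = h * (3 * rho2 x / w + z / w - (real CARD('n) - 1)
     - 2 * (h\<^sup>2 * rho2 x + q\<^sup>2) * o1 / w\<^sup>2) / w" .
  show ?thesis
    unfolding L R using w by (simp add: field_simps power2_eq_square power3_eq_cube)
qed

lemma drift_gradient: "drift x \<bullet> gradient soln x = soln x * PP (rho2 x) (mm x) * soln_partial l x"
proof -
  have "drift x \<bullet> gradient soln x = (\<Sum>i\<in>UNIV. drift x $ i * soln_partial i x)"
    by (simp add: inner_vec_def gradient_def partial_soln)
  also have "\<dots> = drift x $ l * soln_partial l x + (\<Sum>i\<in>UNIV - {l}. drift x $ i * soln_partial i x)"
    by (rule sum.remove) auto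
  also have "(\<Sum>i\<in>UNIV - {l}. drift x $ i * soln_partial i x) = (\<Sum>i\<in>UNIV - {l}. - (strain x * soln_partial l x) * (x $ i * soln_partial i x))"
    by (intro sum.cong) (auto simp: drift_def)
  also have "\<dots> = - (strain x * soln_partial l x) * radial_deriv x"
    by (simp only: sum_distrib_left radial_deriv_def)
  finally show ?thesis by (simp add: drift_def algebra_simps)
qed

text \<open>The vertical field contributes \<open>soln_partial l * QQ\<close>, each of the n - 1
  horizontal directions contributes - \<open>strain * soln_partial l\<close>, and second derivatives
  cancel by symmetry. What remains is the derivative of \<open>strain\<close> along the tangential
  field, balanced by \<open>strain_identity\<close>.\<close>

lemma divergence_drift: "divergence drift x = 0"
proof -
  let ?T = "\<Sum>j\<in>UNIV - {l}. x $ j * soln_partial_l_partial j x"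
  have l: "partial_deriv l (\<lambda>y. drift y $ l) x = soln_partial l x * QQ (rho2 x) (mm x) + strain_partial l x * radial_deriv x + strain x * ?T"
  proof (rule partial_derivI)
    let ?e = "axis l 1 :: real^'n"
    have s: "rho2 (x + t *\<^sub>R ?e) = rho2 x" for t by (simp add: rho2_def axis_def)
    have PP: "((\<lambda>t. PP (rho2 (x + t *\<^sub>R ?e)) (mm (x + t *\<^sub>R ?e))) has_real_derivative
        PP1 (rho2 x) (mm x) * (2 * soln x * soln_partial l x)) (at 0)"
      unfolding s using DERIV_chain2[OF PP_deriv[OF rho2_nonneg] mm_deriv[of x l]] by simp
    have "((\<lambda>t. (x + t *\<^sub>R ?e) $ j * soln_partial j (x + t *\<^sub>R ?e)) has_real_derivative x $ j * soln_partial_l_partial j x) (at 0)"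
      if "j \<in> UNIV - {l}" for j
    proof -
      have "?e $ j = 0" using that by (simp add: axis_def)
      then show ?thesis
        using DERIV_cmult[OF soln_partial_j_deriv[of j x l], of "x $ j"] that mixed_partials[of j x] by simp
    qed
    then have radial_deriv: "((\<lambda>t. radial_deriv (x + t *\<^sub>R ?e)) has_real_derivative ?T) (at 0)"
      unfolding radial_deriv_def by (intro DERIV_sum)
    have "((\<lambda>t. drift (x + t *\<^sub>R ?e) $ l) has_real_derivative
        soln_partial l x * PP (rho2 x) (mm x) + PP1 (rho2 x) (mm x) * (2 * soln x * soln_partial l x) * soln x
        + (strain_partial l x * radial_deriv x + ?T * strain x)) (at 0)"
      using DERIV_add[OF DERIV_mult[OF soln_deriv PP] DERIV_mult[OF strain_deriv radial_deriv]] by (simp add: drift_def)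
    then show "((\<lambda>t. drift (x + t *\<^sub>R ?e) $ l) has_real_derivative
        soln_partial l x * QQ (rho2 x) (mm x) + strain_partial l x * radial_deriv x + strain x * ?T) (at 0)"
      by (rule DERIV_cong) (simp add: QQ_def algebra_simps power2_eq_square)
  qed
  have i: "partial_deriv i (\<lambda>y. drift y $ i) x =
      - (strain x * soln_partial l x) - soln_partial l x * (x $ i * strain_partial i x) - strain x * (x $ i * soln_partial_l_partial i x)" if "i \<noteq> l" for i
  proof (rule partial_derivI)
    let ?e = "axis i 1 :: real^'n"
    have c: "((\<lambda>t. (x + t *\<^sub>R ?e) $ i) has_real_derivative 1) (at 0)"
      by (auto intro!: derivative_eq_intros)
    have "((\<lambda>t. drift (x + t *\<^sub>R ?e) $ i) has_real_derivative
        - (1 * (strain x * soln_partial l x) + (strain_partial i x * soln_partial l x + soln_partial_l_partial i x * strain x) * x $ i)) (at 0)"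
      using DERIV_minus[OF DERIV_mult[OF c DERIV_mult[OF strain_deriv soln_partial_l_deriv]]] that by (simp add: drift_def)
    then show "((\<lambda>t. drift (x + t *\<^sub>R ?e) $ i) has_real_derivative
        - (strain x * soln_partial l x) - soln_partial l x * (x $ i * strain_partial i x) - strain x * (x $ i * soln_partial_l_partial i x)) (at 0)"
      by (rule DERIV_cong) (simp add: algebra_simps)
  qed
  have "divergence drift x = partial_deriv l (\<lambda>y. drift y $ l) x + (\<Sum>i\<in>UNIV - {l}. partial_deriv i (\<lambda>y. drift y $ i) x)"
    unfolding divergence_def by (rule sum.remove) auto
  also have "(\<Sum>i\<in>UNIV - {l}. partial_deriv i (\<lambda>y. drift y $ i) x) =
      (\<Sum>i\<in>UNIV - {l}. - (strain x * soln_partial l x) - soln_partial l x * (x $ i * strain_partial i x) - strain x * (x $ i * soln_partial_l_partial i x))"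
    by (intro sum.cong) (auto simp: i)
  also have "\<dots> = - ((real CARD('n) - 1) * (strain x * soln_partial l x)) - soln_partial l x * (\<Sum>i\<in>UNIV - {l}. x $ i * strain_partial i x) - strain x * ?T"
    by (simp add: sum_subtractf sum_distrib_left card_Diff_singleton of_nat_diff sum_negf
        sum.distrib algebra_simps)
  finally have "divergence drift x = soln_partial l x * (QQ (rho2 x) (mm x) - (real CARD('n) - 1) * strain x)
      - (soln_partial l x * (\<Sum>i\<in>UNIV - {l}. x $ i * strain_partial i x) - radial_deriv x * strain_partial l x)"
    by (simp add: l algebra_simps)
  then show ?thesis unfolding strain_identity by simp
qed

lemma divergence_soln_drift: "divergence (\<lambda>y. soln y *\<^sub>R drift y) x = drift x \<bullet> gradient soln x"
proof -
  have "partial_deriv i (\<lambda>y. (soln y *\<^sub>R drift y) $ i) x = soln_partial i x * drift x $ i + partial_deriv i (\<lambda>y. drift y $ i) x * soln x" for i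
    using DERIV_mult[OF soln_deriv smooth_in_partial_derivative[OF smooth_drift_component[of UNIV i], where x = x and i = i and s = 0]]
    by (intro partial_derivI) simp
  then have "divergence (\<lambda>y. soln y *\<^sub>R drift y) x = (\<Sum>i\<in>UNIV. soln_partial i x * drift x $ i) + divergence drift x * soln x"
    by (simp add: divergence_def sum.distrib sum_distrib_right)
  then show ?thesis
    by (simp add: divergence_drift inner_vec_def gradient_def partial_soln mult.commute)
qed

section \<open>Bounds on the ball uniform in d\<close>

lemma DD_ge_component: assumes "\<bar>soln x\<bar> \<le> 1" shows "(x $ i)\<^sup>2 \<le> D x"
proof (cases "i = l")
  case True
  have "(x $ l)\<^sup>2 = mm x * D x"
    using D_pos[of x] by (simp add: soln_eq[of x, symmetric] height_def power_mult_distrib)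
  also have "\<dots> \<le> 1 * D x"
    using assms D_pos[of x] by (intro mult_right_mono) (auto simp: abs_square_le_1)
  finally show ?thesis using True by simp
next
  case False
  then have "(x $ i)\<^sup>2 \<le> rho2 x" unfolding rho2_def by (intro member_le_sum) auto
  then show ?thesis using zeta_pos[of "mm x"] by (simp add: DD_def)
qed

text \<open>For m > 1 the profile is at least 1, so z^2 = m * D \<ge> 1 and the point lies outside
  the ball. This is the use of a profile of order one at the top levels.\<close>

lemma soln_le_1:
  assumes "norm x < 1/2"
  shows "\<bar>soln x\<bar> \<le> 1"
proof (rule ccontr)
  assume "\<not> \<bar>soln x\<bar> \<le> 1"
  then have m: "mm x > 1" by (simp add: abs_square_le_1[symmetric] not_le)
  then have "mm x - 1/4 + rad (mm x) \<ge> 1" using rad_gt[of "mm x"] by linarith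
  then have "zeta (mm x) \<ge> 1"
    unfolding zeta_def using M by (intro ge_one_powr_ge_zero) auto
  then have D1: "D x \<ge> 1" using rho2_nonneg[of x] by (simp add: DD_def)
  have "(x $ l)\<^sup>2 = mm x * D x"
    using D_pos[of x] by (simp add: soln_eq[of x, symmetric] height_def power_mult_distrib)
  also have "\<dots> \<ge> 1 * 1" using m D1 by (intro mult_mono) auto
  finally have "1 \<le> \<bar>x $ l\<bar>" using abs_le_square_iff[of 1 "x $ l"] by simp
  with component_le_norm_cart[of x l] assms show False by simp
qed

lemma rho2_le_1:
  assumes "norm x < 1/2"
  shows "rho2 x \<le> 1"
proof -
  have "rho2 x \<le> (\<Sum>i\<in>UNIV. (x $ i)\<^sup>2)" unfolding rho2_def by (intro sum_mono2) auto
  also have "\<dots> = (norm x)\<^sup>2"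
    by (simp add: norm_vec_def L2_set_def sum_nonneg)
  also have "\<dots> \<le> 1" using assms by (simp add: power_le_one)
  finally show ?thesis .
qed

text \<open>The power is split into n equal factors, and the i-th one is estimated through D \<ge>
  \<open>(x $ i)\<^sup>2\<close>. A singularity of radial type becomes a product weight, integrable
  when 2e < n.\<close>

lemma D_powr_le_product:
  assumes "norm x < 1/2" "e \<ge> 0" "\<And>i. x $ i \<noteq> 0"
  shows "D x powr (- e) \<le> (\<Prod>i\<in>UNIV. \<bar>x $ i\<bar> powr (- (2 * e / CARD('n))))"
proof -
  let ?a = "e / CARD('n)"
  have "D x powr (- e) = (\<Prod>i\<in>(UNIV :: 'n set). D x powr (- ?a))"
    using D_pos[of x] by (simp add: powr_power)
  also have "\<dots> \<le> (\<Prod>i\<in>UNIV. \<bar>x $ i\<bar> powr (- (2 * e / CARD('n))))"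
  proof (intro prod_mono conjI)
    fix i
    have "D x powr (- ?a) \<le> (\<bar>x $ i\<bar>\<^sup>2) powr (- ?a)"
      using DD_ge_component[OF soln_le_1[OF assms(1)], of i] assms(2,3) by (intro powr_mono2') auto
    also have "\<dots> = \<bar>x $ i\<bar> powr (- (2 * e / CARD('n)))"
    proof -
      have "\<bar>x $ i\<bar>\<^sup>2 = \<bar>x $ i\<bar> powr 2" using assms(3)[of i] by (simp only: powr_numeral zero_less_abs_iff)
      then show ?thesis by (simp only: powr_powr) simp
    qed
    finally show "D x powr (- ?a) \<le> \<bar>x $ i\<bar> powr (- (2 * e / CARD('n)))" .
  qed auto
  finally show ?thesis .
qed

lemma mm_le_1: "norm x < 1/2 \<Longrightarrow> mm x \<le> 1"
  using soln_le_1[of x] by (simp add: abs_square_le_1)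

lemma drift_const_nonneg: "drift_const M k \<ge> 0"
  using M by (simp add: drift_const_def Let_def)

text \<open>Since t \<le> 1, \<open>DD\<close> at t^2 * \<open>rho2 x\<close> is at least t^2 * D.
  The integrand is then at most a multiple of t^(n-2) * t powr (-1 - 8/M), hence of t powr (-8/M) by
  n \<ge> 3 and of t powr (-1/2) by M \<ge> 16; the integral 2 of the latter is the 2 in the
  bound.\<close>

lemma strain_bound:
  assumes x: "norm x < 1/2"
  shows "\<bar>strain x\<bar> \<le> 2 * drift_const M CARD('n) * D x powr (- (1/2 + 4 / M))"
proof -
  let ?w = "\<lambda>t. drift_const M CARD('n) * D x powr (- (1/2 + 4 / M)) * t powr (- (1/2))"
  have w: "(?w has_integral drift_const M CARD('n) * D x powr (- (1/2 + 4 / M)) * 2) {0..1}"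
    using has_integral_powr_from_0[of "- (1/2)" 1] by (intro has_integral_mult_right) simp
  have eM: "0 \<le> 1/2 + 4 / M" using M by simp
  have "norm (strain_kernel t x) \<le> ?w t" if t: "t \<in> {0..1}" for t
  proof (cases "t = 0")
    \<comment> \<open>At t = 0 both sides are 0: the left one because n - 2 is positive, the right
      one by the convention for \<open>0 powr _\<close>.\<close>
    case True
    then show ?thesis using n drift_const_nonneg by (simp add: strain_kernel_def power_0_left)
  next
    case False
    then have t0: "0 < t" "t \<le> 1" using t by auto
    have ts: "0 \<le> t\<^sup>2 * rho2 x" "t\<^sup>2 * rho2 x \<le> 1"
      using rho2_nonneg[of x] rho2_le_1[OF x] t0 mult_mono[of "t\<^sup>2" 1 "rho2 x" 1] by (auto simp: power_le_one)
    have "t\<^sup>2 * D x \<le> DD (t\<^sup>2 * rho2 x) (mm x)"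
      using t0 zeta_pos[of "mm x"] mult_right_mono[of "t\<^sup>2" 1 "zeta (mm x)"]
      by (simp add: DD_def algebra_simps power_le_one)
    then have "DD (t\<^sup>2 * rho2 x) (mm x) powr (- (1/2 + 4 / M)) \<le> (t\<^sup>2 * D x) powr (- (1/2 + 4 / M))"
      using t0 D_pos[of x] eM by (intro powr_mono2') auto
    also have "\<dots> = t powr (- 2 * (1/2 + 4 / M)) * D x powr (- (1/2 + 4 / M))"
    proof -
      have "t\<^sup>2 = t powr 2" using t0 by simp
      then show ?thesis using D_pos[of x] by (simp only: powr_mult powr_powr) simp
    qed
    finally have 1: "DD (t\<^sup>2 * rho2 x) (mm x) powr (- (1/2 + 4 / M)) \<le> t powr (- 2 * (1/2 + 4 / M)) * D x powr (- (1/2 + 4 / M))" .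
    have "t ^ (CARD('n) - 2) \<le> t ^ 1" using t0 n by (intro power_decreasing) auto
    then have "t ^ (CARD('n) - 2) * t powr (- 2 * (1/2 + 4 / M)) \<le> t powr 1 * t powr (- 2 * (1/2 + 4 / M))"
      using t0 by (intro mult_right_mono) auto
    also have "\<dots> = t powr (1 + - 2 * (1/2 + 4 / M))" by (simp only: powr_add)
    also have "\<dots> = t powr (- (8 / M))" by (simp add: field_simps)
    also have "\<dots> \<le> t powr (- (1/2))"
      using t0 M by (intro powr_mono') (auto simp: field_simps)
    finally have 2: "t ^ (CARD('n) - 2) * t powr (- 2 * (1/2 + 4 / M)) \<le> t powr (- (1/2))" .
    have "norm (strain_kernel t x) = t ^ (CARD('n) - 2) * \<bar>QQ (t\<^sup>2 * rho2 x) (mm x)\<bar>"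
      using t0 by (simp add: strain_kernel_def abs_mult)
    also have "\<dots> \<le> t ^ (CARD('n) - 2) * (drift_const M CARD('n) * DD (t\<^sup>2 * rho2 x) (mm x) powr (- (1/2 + 4 / M)))"
      using PP_QQ_bound(2)[OF ts, of "mm x"] mm_le_1[OF x] t0 by (intro mult_left_mono) auto
    also have "\<dots> \<le> t ^ (CARD('n) - 2) * (drift_const M CARD('n) * (t powr (- 2 * (1/2 + 4 / M)) * D x powr (- (1/2 + 4 / M))))"
      using 1 drift_const_nonneg t0 by (intro mult_left_mono) auto
    also have "\<dots> = drift_const M CARD('n) * D x powr (- (1/2 + 4 / M)) * (t ^ (CARD('n) - 2) * t powr (- 2 * (1/2 + 4 / M)))" by (simp add: mult_ac)
    also have "\<dots> \<le> drift_const M CARD('n) * D x powr (- (1/2 + 4 / M)) * t powr (- (1/2))"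
      using 2 drift_const_nonneg by (intro mult_left_mono) auto
    finally show ?thesis .
  qed
  then have "norm (strain x) \<le> integral {0..1} ?w"
    unfolding strain_def using kernel_has_integral[OF kernels_strain_kernel] w
    by (intro integral_norm_bound_integral) (auto simp: has_integral_iff)
  also have "\<dots> = drift_const M CARD('n) * D x powr (- (1/2 + 4 / M)) * 2" using w by (rule integral_unique)
  finally have "norm (strain x) \<le> drift_const M CARD('n) * D x powr (- (1/2 + 4 / M)) * 2" .
  then show ?thesis by (simp add: mult_ac)
qed

end


context vortex
begin

text \<open>Because |h| \<le> 1 and D dominates the square of each coordinate, all partial
  derivatives are at most sqrt D / W, and W \<ge> D.\<close>

lemma soln_partial_bound:
  assumes "norm x < 1/2"
  shows "\<bar>soln_partial i x\<bar> \<le> D x powr (- (1/2))"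
proof -
  have D: "D x > 0" by (rule D_pos)
  have e: "D x powr (- (1/2)) = sqrt (D x) / D x"
  proof -
    define q where "q = sqrt (D x)"
    have "q > 0" "D x = q * q" using D by (simp_all add: q_def)
    moreover have "D x powr (- (1/2)) = inverse q"
      using D by (simp add: powr_minus powr_half_sqrt q_def)
    ultimately show ?thesis by (simp add: q_def[symmetric] inverse_eq_divide)
  qed
  have "\<bar>soln_partial i x\<bar> \<le> sqrt (D x) / W x"
  proof (cases "i = l")
    case True
    then show ?thesis using D W_pos[of x] by (simp add: soln_partial_def)
  next
    case False
    have "\<bar>x $ i\<bar> \<le> sqrt (D x)"
      using DD_ge_component[OF soln_le_1[OF assms], of i] real_le_rsqrt[of "\<bar>x $ i\<bar>"] by simp
    then have "\<bar>soln x\<bar> * \<bar>x $ i\<bar> \<le> 1 * sqrt (D x)"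
      using soln_le_1[OF assms] by (intro mult_mono) auto
    then show ?thesis
      using False W_pos[of x] by (simp add: soln_partial_def abs_divide abs_mult divide_right_mono)
  qed
  also have "\<dots> \<le> sqrt (D x) / D x"
    using D W_ge_D[of x] by (intro divide_left_mono) auto
  finally show ?thesis unfolding e .
qed

text \<open>The coefficients multiplying \<open>strain\<close> are bounded by 1 in absolute value,
  so each component is at most the bound for \<open>PP\<close> plus twice as much for
  \<open>strain\<close>; this gives 3. The factor n comes from passing to the sum norm.\<close>

lemma drift_bound:
  assumes x: "norm x < 1/2"
  shows "norm (drift x) \<le> 3 * real CARD('n) * drift_const M CARD('n) * D x powr (- (1/2 + 4 / M))"
proof -
  let ?c = "drift_const M CARD('n) * D x powr (- (1/2 + 4 / M))"
  have c: "?c \<ge> 0" using drift_const_nonneg[of "CARD('n)"] by simp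
  have D: "D x > 0" by (rule D_pos)
  have A: "\<bar>strain x\<bar> \<le> 2 * ?c" using strain_bound[OF x] by (simp add: mult_ac)
  have "\<bar>drift x $ i\<bar> \<le> 3 * ?c" for i
  proof (cases "i = l")
    case True
    have "\<bar>radial_deriv x\<bar> \<le> 1"
    proof -
      have "radial_deriv x = (\<Sum>j\<in>UNIV - {l}. - (soln x / W x) * (x $ j)\<^sup>2)"
        unfolding radial_deriv_def by (intro sum.cong) (auto simp: soln_partial_def power2_eq_square)
      also have "\<dots> = - (soln x / W x) * rho2 x" by (simp only: sum_distrib_left rho2_def)
      finally have "\<bar>radial_deriv x\<bar> = \<bar>soln x\<bar> * (rho2 x / W x)"
        using rho2_nonneg[of x] W_pos[of x] by (simp add: abs_mult abs_divide)
      also have "\<dots> \<le> 1 * 1"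
        using soln_le_1[OF x] rho2_nonneg[of x] W_pos[of x] omega_pos[of "mm x"]
        by (intro mult_mono) (auto simp: WW_def)
      finally show ?thesis by simp
    qed
    then have "\<bar>strain x\<bar> * \<bar>radial_deriv x\<bar> \<le> (2 * ?c) * 1" using A c by (intro mult_mono) auto
    moreover have "\<bar>PP (rho2 x) (mm x)\<bar> \<le> ?c"
      using PP_QQ_bound(1)[OF rho2_nonneg rho2_le_1[OF x], of "mm x"] mm_le_1[OF x] by simp
    then have "\<bar>soln x\<bar> * \<bar>PP (rho2 x) (mm x)\<bar> \<le> 1 * ?c"
      using soln_le_1[OF x] by (intro mult_mono) auto
    ultimately show ?thesis
      using True abs_triangle_ineq[of "soln x * PP (rho2 x) (mm x)" "strain x * radial_deriv x"]
      by (simp add: drift_def abs_mult)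
  next
    case False
    have "\<bar>x $ i\<bar> * \<bar>soln_partial l x\<bar> \<le> sqrt (D x) * D x powr (- (1/2))"
      using soln_partial_bound[OF x] DD_ge_component[OF soln_le_1[OF x], of i] real_le_rsqrt[of "\<bar>x $ i\<bar>"] D
      by (intro mult_mono) auto
    also have "\<dots> = 1" using D by (simp add: powr_minus powr_half_sqrt)
    finally have "\<bar>strain x\<bar> * (\<bar>x $ i\<bar> * \<bar>soln_partial l x\<bar>) \<le> (2 * ?c) * 1"
      using A c by (intro mult_mono) auto
    then show ?thesis using False c by (simp add: drift_def abs_mult mult_ac)
  qed
  then have "(\<Sum>i\<in>UNIV. \<bar>drift x $ i\<bar>) \<le> (\<Sum>i\<in>(UNIV :: 'n set). 3 * ?c)"
    by (intro sum_mono)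
  with norm_le_l1_cart[of "drift x"] show ?thesis by (simp add: mult_ac)
qed

end

theorem theorem1p9:
  fixes p :: real and last :: "'n::finite"
  assumes "CARD('n) \<ge> 3" and "1 \<le> p" and "p < real CARD('n)"
  shows "\<exists>c0 c1 :: real. c0 > 0 \<and> c1 > 0 \<and>
    (\<forall>\<epsilon>\<in>{0<..<1/4 :: real}. \<exists>(b :: real^'n \<Rightarrow> real^'n) (u :: real^'n \<Rightarrow> real).
       smooth_closure (ball 0 (1/2)) b \<and>
       (\<forall>x\<in>ball 0 (1/2). divergence b x = 0) \<and>
       b \<in> Lp_space p (lebesgue_on (ball 0 (1/2))) \<and>
       Lp_norm p (lebesgue_on (ball 0 (1/2))) b \<le> c0 \<and>
       smooth_closure (ball 0 (1/2)) u \<and>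
       Linf_norm (lebesgue_on (ball 0 (1/2))) u \<le> 1 \<and>
       u \<in> W12_space (ball 0 (1/2)) \<and>
       W12_norm (ball 0 (1/2)) u \<le> c0 \<and>
       (\<forall>x\<in>ball 0 (1/2). - laplacian u x + b x \<bullet> gradient u x = 0) \<and>
       (\<forall>x\<in>ball 0 (1/2). - laplacian u x + divergence (\<lambda>y. u y *\<^sub>R b y) x = 0) \<and>
       u 0 = 0 \<and>
       u (axis last (2 * \<epsilon>)) \<ge> c1)"
proof -
  define N where "N = real CARD('n)"
  define B where "B = ball (0::real^'n) (1/2)"
  have N: "N \<ge> 3" "p < N" using assms by (simp_all add: N_def)
  \<comment> \<open>The second entry makes M exceed 8p/(N - p), which is the condition p * (1 + 8/M)
    < N, that is, a < 1.\<close>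
  define M where "M = max 16 (8 * p / (N - p) + 1)"
  define a where "a = p * (1 + 8 / M) / N"
  have M: "M \<ge> 16" by (simp add: M_def)
  have "a < 1"
  proof -
    have "8 * p / (N - p) < M" by (simp add: M_def)
    then have "p * 8 / M < N - p" using N M by (simp add: field_simps)
    then show ?thesis using N by (simp add: a_def field_simps)
  qed
  then obtain K where K: "K > 0" "\<And>f C. 0 \<le> C \<Longrightarrow>
      (\<And>x::real^'n. norm x < 1/2 \<Longrightarrow> (\<And>i. x $ i \<noteq> 0) \<Longrightarrow> f x \<le> C * (\<Prod>i\<in>UNIV. \<bar>x $ i\<bar> powr (- a))) \<Longrightarrow>
      (LINT x|lebesgue_on (ball 0 (1/2)). f x) \<le> C * K"
    using product_weight_integral_bound by metis
  \<comment> \<open>The squared partial derivatives are at most 1 / D, a product weight of exponent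
    2/N; n \<ge> 3 makes it integrable.\<close>
  have "2 / N < 1" using N by simp
  then obtain K' where K': "K' > 0" "\<And>f C. 0 \<le> C \<Longrightarrow>
      (\<And>x::real^'n. norm x < 1/2 \<Longrightarrow> (\<And>i. x $ i \<noteq> 0) \<Longrightarrow> f x \<le> C * (\<Prod>i\<in>UNIV. \<bar>x $ i\<bar> powr (- (2 / N)))) \<Longrightarrow>
      (LINT x|lebesgue_on (ball 0 (1/2)). f x) \<le> C * K'"
    using product_weight_integral_bound by metis
  define C where "C = 3 * N * drift_const M CARD('n)"
  define c0 where "c0 = (C powr p * K) powr (1 / p) + sqrt ((N + 1) * K')"
  have c0: "c0 > 0" using K'(1) N by (auto simp: c0_def intro!: add_nonneg_pos)
  have "\<exists>(b :: real^'n \<Rightarrow> real^'n) (u :: real^'n \<Rightarrow> real).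
       smooth_closure B b \<and>
       (\<forall>x\<in>B. divergence b x = 0) \<and>
       b \<in> Lp_space p (lebesgue_on B) \<and>
       Lp_norm p (lebesgue_on B) b \<le> c0 \<and>
       smooth_closure B u \<and>
       Linf_norm (lebesgue_on B) u \<le> 1 \<and>
       u \<in> W12_space B \<and>
       W12_norm B u \<le> c0 \<and>
       (\<forall>x\<in>B. - laplacian u x + b x \<bullet> gradient u x = 0) \<and>
       (\<forall>x\<in>B. - laplacian u x + divergence (\<lambda>y. u y *\<^sub>R b y) x = 0) \<and>
       u 0 = 0 \<and> u (axis last (2 * \<epsilon>)) \<ge> 1/2"
    if \<epsilon>: "\<epsilon> \<in> {0<..<1/4}" for \<epsilon> :: real
  proof -
    \<comment> \<open>Then the profile at m = 1/4 is d powr M = \<open>\<epsilon>\<^sup>2\<close>,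
      so the level 1/2 meets the axis at height \<epsilon>/2, below 2\<epsilon>. Hence the lower
      bound 1/2.\<close>
    define d where "d = \<epsilon> powr (2 / M)"
    have d: "0 < d" "d \<le> 1" using \<epsilon> M by (simp_all add: d_def powr_le1)
    interpret vortex M d last
      using M d assms(1) by unfold_locales simp_all
    have C: "C \<ge> 0" using N drift_const_nonneg by (simp add: C_def)
    have B: "open B" "bounded B" by (simp_all add: B_def)
    have nB: "norm x < 1/2 \<longleftrightarrow> x \<in> B" for x by (simp add: B_def)
    have Lp_drift: "drift \<in> Lp_space p (lebesgue_on B)"
    proof (rule continuous_Lp_space[OF _ B assms(2)])
      show "continuous_on UNIV drift"
        using smooth_drift[of UNIV] unfolding smooth_in_def by (metis iter_partial.simps(1))
    qed
    have "(LINT x|lebesgue_on B. norm (drift x) powr p) \<le> C powr p * K"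
      unfolding B_def
    proof (rule K(2))
      fix x :: "real^'n" assume x: "norm x < 1/2" "\<And>i. x $ i \<noteq> 0"
      have "norm (drift x) powr p \<le> (C * D x powr (- (1/2 + 4 / M))) powr p"
        using drift_bound[OF x(1)] assms(2) by (intro powr_mono2) (auto simp: C_def N_def)
      also have "\<dots> = C powr p * D x powr (- (p * (1/2 + 4 / M)))"
        by (simp only: powr_mult powr_powr mult_minus_left mult_minus_right mult.commute)
      also have "\<dots> \<le> C powr p * (\<Prod>i\<in>UNIV. \<bar>x $ i\<bar> powr (- (2 * (p * (1/2 + 4 / M)) / CARD('n))))"
        using x assms(2) M by (intro mult_left_mono D_powr_le_product) auto
      also have "2 * (p * (1/2 + 4 / M)) / CARD('n) = a"
        by (simp add: a_def N_def field_simps)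
      finally show "norm (drift x) powr p \<le> C powr p * (\<Prod>i\<in>UNIV. \<bar>x $ i\<bar> powr (- a))" .
    qed simp
    then have "Lp_norm p (lebesgue_on B) drift \<le> (C powr p * K) powr (1 / p)"
      unfolding Lp_norm_def using assms(2) by (intro powr_mono2) auto
    also have "\<dots> \<le> c0" using K'(1) N by (simp add: c0_def)
    finally have bn: "Lp_norm p (lebesgue_on B) drift \<le> c0" .
    have sq: "(Lp_norm 2 (lebesgue_on B) f)\<^sup>2 = (LINT x|lebesgue_on B. norm (f x) powr 2)" for f :: "real^'n \<Rightarrow> real"
      by (simp add: Lp_norm_def powr_half_sqrt)
    have u2: "(Lp_norm 2 (lebesgue_on B) soln)\<^sup>2 \<le> 1 * K'"
      unfolding sq unfolding B_def
    proof (rule K'(2))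
      fix x :: "real^'n" assume x: "norm x < 1/2" "\<And>i. x $ i \<noteq> 0"
      have "norm (soln x) powr 2 \<le> 1 powr 2" using soln_le_1[OF x(1)] by (intro powr_mono2) auto
      \<comment> \<open>All coordinates are below 1 in absolute value on the ball, so the weight for
        the gradient is at least 1 and K' also bounds the function itself.\<close>
      also have "\<dots> \<le> 1 * (\<Prod>i\<in>UNIV. \<bar>x $ i\<bar> powr (- (2 / N)))"
      proof -
        have "1 \<le> \<bar>x $ i\<bar> powr (- (2 / N))" for i
          using powr_mono2'[of "- (2 / N)" "\<bar>x $ i\<bar>" 1] x(2)[of i] component_le_norm_cart[of x i] x(1) N by simp
        then show ?thesis by (simp add: prod_ge_1)
      qed
      finally show "norm (soln x) powr 2 \<le> 1 * (\<Prod>i\<in>UNIV. \<bar>x $ i\<bar> powr (- (2 / N)))" .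
    qed simp
    have g2: "(Lp_norm 2 (lebesgue_on B) (partial_deriv i soln))\<^sup>2 \<le> 1 * K'" for i
      unfolding sq unfolding B_def
    proof (rule K'(2))
      fix x :: "real^'n" assume x: "norm x < 1/2" "\<And>i. x $ i \<noteq> 0"
      have "norm (partial_deriv i soln x) powr 2 \<le> (D x powr (- (1/2))) powr 2"
        using soln_partial_bound[OF x(1), of i] by (intro powr_mono2) (auto simp: partial_soln)
      also have "\<dots> = D x powr (- 1)" by (simp only: powr_powr) simp
      also have "\<dots> \<le> (\<Prod>i\<in>UNIV. \<bar>x $ i\<bar> powr (- (2 * 1 / CARD('n))))"
        using x by (intro D_powr_le_product) auto
      finally show "norm (partial_deriv i soln x) powr 2 \<le> 1 * (\<Prod>i\<in>UNIV. \<bar>x $ i\<bar> powr (- (2 / N)))"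
        by (simp add: N_def)
    qed simp
    have "W12_norm B soln \<le> sqrt (K' + (\<Sum>i\<in>(UNIV :: 'n set). K'))"
      unfolding W12_smooth(2)[OF smooth_soln B]
      using u2 g2 by (intro real_sqrt_le_mono add_mono sum_mono) auto
    also have "K' + (\<Sum>i\<in>(UNIV :: 'n set). K') = (N + 1) * K'"
      by (simp add: N_def algebra_simps)
    also have "sqrt ((N + 1) * K') \<le> c0" by (simp add: c0_def)
    finally have un: "W12_norm B soln \<le> c0" .
    have Linf: "Linf_norm (lebesgue_on B) soln \<le> 1"
      unfolding Linf_norm_def
    proof (rule esssup_I)
      have "soln \<in> borel_measurable borel" using soln_continuous by (rule borel_measurable_continuous_onI)
      then have "soln \<in> borel_measurable (lebesgue_on B)"
        by (intro measurable_restrict_space1 measurable_completion) simp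
      then show "(\<lambda>x. ereal (norm (soln x))) \<in> borel_measurable (lebesgue_on B)" by measurable
      show "AE x in lebesgue_on B. ereal (norm (soln x)) \<le> 1"
        using soln_le_1 nB by (intro AE_I2) (auto simp: one_ereal_def)
    qed
    have u0: "soln 0 = 0" by (rule soln_eqI) (simp add: height_def)
    have u1: "1/2 \<le> soln (axis last (2 * \<epsilon>))"
    proof (rule soln_geI)
      have "rad ((1/2)\<^sup>2) = d" using d by (simp add: rad_def power2_eq_square)
      then have "zeta ((1/2)\<^sup>2) = d powr M" by (simp add: zeta_def power2_eq_square)
      also have "\<dots> = \<epsilon>\<^sup>2" using \<epsilon> M by (simp add: d_def powr_powr)
      finally have "height 0 (1/2) = \<epsilon> / 2" using \<epsilon> by (simp add: height_def DD_def)
      moreover have "rho2 (axis last (2 * \<epsilon>)) = 0" by (simp add: rho2_def axis_def)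
      ultimately show "height (rho2 (axis last (2 * \<epsilon>))) (1/2) \<le> axis last (2 * \<epsilon>) $ last"
        using \<epsilon> by (simp add: axis_def)
    qed
    show ?thesis
      by (intro exI[of _ drift] exI[of _ soln] conjI ballI smooth_in_UNIV_imp_smooth_closure smooth_drift smooth_soln
          divergence_drift Lp_drift bn Linf W12_smooth(1)[OF smooth_soln B] un u0 u1)
        (simp_all add: laplacian_soln drift_gradient divergence_soln_drift)
  qed
  then show ?thesis
    unfolding B_def using c0 by (intro exI[of _ c0] exI[of _ "1/2"] conjI ballI) simp_all
qed

end
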